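(* Let $X$ be a compact complex manifold of complex dimension $3$. The following conditions are mutually exclusive: (1) $X$ admits a hermitian metric $\omega$ such that $dd^c\omega\geq0$ and $dd^c\omega\neq0$; (2) $X$ admits a hermitian metric $\omega$ such that $dd^c\omega=0$; (3) $X$ admits a hermitian metric $\omega$ such that $dd^c\omega\leq0$ and $dd^c\omega\neq0$; (4) $X$ does not admit any hermitian metric $\omega$ such that $dd^c\omega$ has a sign (i.e. such that $dd^c\omega\geq0$ or $dd^c\omega\leq0$).
   Context: A hermitian metric is a smooth positive definite real $(1,1)$-form; $dd^c=i\partial\overline{\partial}$. In complex dimension $3$, a real $(2,2)$-form $\Theta$ is $\geq0$ if $\Theta\wedge i\eta\wedge\overline{\eta}\geq0$ for every $(1,0)$-form $\eta$, and $\Theta\leq0$ if $-\Theta\geq0$; $dd^c\omega\neq0$ means not identically zero. *)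

theory Defs
  imports "HOL-Analysis.Analysis" "HOL-Combinatorics.Permutations"
begin

section \<open>Smooth and holomorphic maps\<close>

text \<open>On an open set of a finite-dimensional space this is the usual notion of a \<open>C\<^sup>k\<close> map:
  the iterated directional derivatives up to order \<open>k\<close> exist and are continuous.\<close>

primrec Ck_on :: "nat \<Rightarrow> 'a::euclidean_space set \<Rightarrow> ('a \<Rightarrow> 'b::euclidean_space) \<Rightarrow> bool" where
  "Ck_on 0 S f \<longleftrightarrow> continuous_on S f"
| "Ck_on (Suc k) S f \<longleftrightarrow> (\<forall>x\<in>S. f differentiable (at x)) \<and>
     (\<forall>v. Ck_on k S (\<lambda>x. frechet_derivative f (at x) v))"

definition smooth_on :: "'a::euclidean_space set \<Rightarrow> ('a \<Rightarrow> 'b::euclidean_space) \<Rightarrow> bool" where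
  "smooth_on S f \<longleftrightarrow> (\<forall>k. Ck_on k S f)"

definition holomorphic_map_on :: "(complex^'n) set \<Rightarrow> (complex^'n \<Rightarrow> complex^'m) \<Rightarrow> bool" where
  "holomorphic_map_on S f \<longleftrightarrow>
     (\<forall>x\<in>S. \<exists>L. (f has_derivative L) (at x) \<and> Vector_Spaces.linear (*s) (*s) L)"


section \<open>Complex manifolds\<close>

text \<open>A chart is a domain together with a coordinate map; only the values of the coordinate
  map on the domain matter.\<close>

type_synonym ('a, 'n) chart = "'a set \<times> ('a \<Rightarrow> complex^'n)"

definition chart_image :: "('a, 'n::finite) chart \<Rightarrow> (complex^'n) set" where
  "chart_image c = snd c ` fst c"

definition transition :: "('a, 'n::finite) chart \<Rightarrow> ('a, 'n) chart \<Rightarrow> complex^'n \<Rightarrow> complex^'n" where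
  "transition c d = snd d \<circ> inv_into (fst c) (snd c)"

definition overlap_image :: "('a, 'n::finite) chart \<Rightarrow> ('a, 'n) chart \<Rightarrow> (complex^'n) set" where
  "overlap_image c d = snd c ` (fst c \<inter> fst d)"

definition complex_manifold :: "'a topology \<Rightarrow> ('a, 'n::finite) chart set \<Rightarrow> bool" where
  "complex_manifold X A \<longleftrightarrow>
     Hausdorff_space X \<and> second_countable X \<and>
     \<Union> (fst ` A) = topspace X \<and>
     (\<forall>c\<in>A. openin X (fst c) \<and> open (chart_image c) \<and>
        homeomorphic_map (subtopology X (fst c)) (top_of_set (chart_image c)) (snd c)) \<and>
     (\<forall>c\<in>A. \<forall>d\<in>A. holomorphic_map_on (overlap_image c d) (transition c d))"


section \<open>Exterior algebra\<close>

text \<open>The real tangent space of \<open>\<complex>\<^sup>n\<close> at a point is \<open>\<complex>\<^sup>n\<close> itself. A complex-valued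
  \<open>k\<close>-covector is a function of \<open>k\<close> tangent vectors, given as a list; its values on lists of
  any other length are irrelevant.\<close>

type_synonym 'n covector = "(complex^'n) list \<Rightarrow> complex"

text \<open>Normalised so that \<open>\<alpha> \<and> \<beta>\<close> takes the value \<open>\<alpha> v * \<beta> w - \<alpha> w * \<beta> v\<close> on \<open>(v, w)\<close>
  if \<open>\<alpha>\<close> and \<open>\<beta>\<close> have degree 1.\<close>

definition wedge :: "nat \<Rightarrow> nat \<Rightarrow> 'n covector \<Rightarrow> 'n covector \<Rightarrow> 'n covector" where
  "wedge k l \<alpha> \<beta> vs =
     (\<Sum>\<sigma> | \<sigma> permutes {..<k + l}.
        of_int (sign \<sigma>) * \<alpha> (take k (permute_list \<sigma> vs)) * \<beta> (drop k (permute_list \<sigma> vs)))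
     / (fact k * fact l)"

definition dz :: "'n::finite \<Rightarrow> 'n covector" where
  "dz j vs = hd vs $ j"

definition dzbar :: "'n::finite \<Rightarrow> 'n covector" where
  "dzbar j vs = cnj (hd vs $ j)"

text \<open>A covector of bidegree \<open>(1,0)\<close> is a complex-linear functional \<open>\<eta>\<close> on the tangent space.
  A real form of top degree is nonnegative if its value on the positively oriented basis
  \<open>\<partial>/\<partial>x\<^sub>1, \<partial>/\<partial>y\<^sub>1, \<partial>/\<partial>x\<^sub>2, \<partial>/\<partial>y\<^sub>2, \<partial>/\<partial>x\<^sub>3, \<partial>/\<partial>y\<^sub>3\<close> is.\<close>

definition nonneg_22 :: "3 covector \<Rightarrow> bool" where
  "nonneg_22 \<Theta> \<longleftrightarrow>
     (\<forall>\<eta>. Vector_Spaces.linear (*s) (*) \<eta> \<longrightarrow>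
        wedge 4 2 \<Theta> (\<lambda>us. \<i> * wedge 1 1 (\<lambda>vs. \<eta> (hd vs)) (\<lambda>vs. cnj (\<eta> (hd vs))) us)
          [axis 1 1, axis 1 \<i>, axis 2 1, axis 2 \<i>, axis 3 1, axis 3 \<i>] \<in> \<real>\<^sub>\<ge>\<^sub>0)"


section \<open>Differential forms on open subsets of \<open>\<complex>\<^sup>n\<close>\<close>

type_synonym 'n local_form = "complex^'n \<Rightarrow> 'n covector"

definition pullback :: "(complex^'n \<Rightarrow> complex^'n) \<Rightarrow> 'n local_form \<Rightarrow> 'n local_form" where
  "pullback f \<alpha> x vs = \<alpha> (f x) (map (frechet_derivative f (at x)) vs)"

text \<open>The complex-linear and complex-antilinear parts of the derivative of a function \<open>f\<close> in the
  direction \<open>v\<close>, i.e. \<open>\<Sum>j. v\<^sub>j * \<partial>f/\<partial>z\<^sub>j\<close> and \<open>\<Sum>j. cnj v\<^sub>j * \<partial>f/\<partial>zbar\<^sub>j\<close>.\<close>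

definition D10 :: "(complex^'n \<Rightarrow> complex) \<Rightarrow> complex^'n \<Rightarrow> complex^'n \<Rightarrow> complex" where
  "D10 f x v =
     (frechet_derivative f (at x) v - \<i> * frechet_derivative f (at x) (\<i> *s v)) / 2"

definition D01 :: "(complex^'n \<Rightarrow> complex) \<Rightarrow> complex^'n \<Rightarrow> complex^'n \<Rightarrow> complex" where
  "D01 f x v =
     (frechet_derivative f (at x) v + \<i> * frechet_derivative f (at x) (\<i> *s v)) / 2"

text \<open>These are \<open>\<partial>\<alpha> = \<Sum>j. dz\<^sub>j \<and> \<partial>\<alpha>/\<partial>z\<^sub>j\<close> and its conjugate counterpart, evaluated on
  \<open>(v\<^sub>0, \<dots>, v\<^sub>k)\<close>; the terms are those of the exterior derivative
  \<open>d\<alpha> (v\<^sub>0, \<dots>, v\<^sub>k) = \<Sum>i. (-1)\<^sup>i D\<alpha>(v\<^sub>i) (v\<^sub>0, \<dots>, v\<^sub>k without v\<^sub>i)\<close>,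
  so that \<open>d = del + delbar\<close>.\<close>

definition del :: "'n::finite local_form \<Rightarrow> 'n local_form" where
  "del \<alpha> x vs =
     (\<Sum>i<length vs. (- 1) ^ i * D10 (\<lambda>y. \<alpha> y (take i vs @ drop (Suc i) vs)) x (vs ! i))"

definition delbar :: "'n::finite local_form \<Rightarrow> 'n local_form" where
  "delbar \<alpha> x vs =
     (\<Sum>i<length vs. (- 1) ^ i * D01 (\<lambda>y. \<alpha> y (take i vs @ drop (Suc i) vs)) x (vs ! i))"

definition smooth_11_form_on :: "(complex^'n::finite) set \<Rightarrow> 'n local_form \<Rightarrow> bool" where
  "smooth_11_form_on S \<omega> \<longleftrightarrow>
     (\<exists>h. (\<forall>j k. smooth_on S (h j k)) \<and>
        (\<forall>x\<in>S. \<forall>v w. \<omega> x [v, w] =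
           (\<Sum>j\<in>UNIV. \<Sum>k\<in>UNIV. h j k x * wedge 1 1 (dz j) (dzbar k) [v, w])))"


section \<open>Forms on complex manifolds\<close>

text \<open>A differential form on a manifold is given by its coordinate representations in all
  charts of the atlas; these have to be related by pullback along the transition maps. The
  representation in a chart \<open>c\<close> is only relevant on the image of \<open>c\<close>.\<close>

type_synonym ('a, 'n) mform = "('a, 'n) chart \<Rightarrow> 'n local_form"

definition smooth_11_form :: "('a, 'n::finite) chart set \<Rightarrow> ('a, 'n) mform \<Rightarrow> bool" where
  "smooth_11_form A \<omega> \<longleftrightarrow>
     (\<forall>c\<in>A. smooth_11_form_on (chart_image c) (\<omega> c)) \<and>
     (\<forall>c\<in>A. \<forall>d\<in>A. \<forall>x\<in>overlap_image c d. \<forall>v w.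
        \<omega> c x [v, w] = pullback (transition c d) (\<omega> d) x [v, w])"

text \<open>A real \<open>(1,1)\<close>-form \<open>\<omega>\<close> is positive definite if \<open>\<omega> (v, J v) > 0\<close> for every nonzero real
  tangent vector \<open>v\<close>. For \<open>\<omega> = \<i> \<Sum>j k. h\<^sub>j\<^sub>k dz\<^sub>j \<and> dzbar\<^sub>k\<close> this says that \<open>h\<close> is a positive
  definite hermitian matrix.\<close>

definition hermitian_metric :: "('a, 'n::finite) chart set \<Rightarrow> ('a, 'n) mform \<Rightarrow> bool" where
  "hermitian_metric A \<omega> \<longleftrightarrow>
     smooth_11_form A \<omega> \<and>
     (\<forall>c\<in>A. \<forall>x\<in>chart_image c.
        (\<forall>v w. \<omega> c x [v, w] \<in> \<real>) \<and> (\<forall>v. v \<noteq> 0 \<longrightarrow> Re (\<omega> c x [v, \<i> *s v]) > 0))"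

definition ddc :: "('a, 'n::finite) mform \<Rightarrow> ('a, 'n) mform" where
  "ddc \<omega> c x vs = \<i> * del (delbar (\<omega> c)) x vs"

definition form_zero :: "nat \<Rightarrow> ('a, 'n::finite) chart set \<Rightarrow> ('a, 'n) mform \<Rightarrow> bool" where
  "form_zero k A \<Theta> \<longleftrightarrow>
     (\<forall>c\<in>A. \<forall>x\<in>chart_image c. \<forall>vs. length vs = k \<longrightarrow> \<Theta> c x vs = 0)"

definition form_nonneg_22 :: "('a, 3) chart set \<Rightarrow> ('a, 3) mform \<Rightarrow> bool" where
  "form_nonneg_22 A \<Theta> \<longleftrightarrow> (\<forall>c\<in>A. \<forall>x\<in>chart_image c. nonneg_22 (\<Theta> c x))"

definition form_nonpos_22 :: "('a, 3) chart set \<Rightarrow> ('a, 3) mform \<Rightarrow> bool" where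
  "form_nonpos_22 A \<Theta> \<longleftrightarrow> form_nonneg_22 A (\<lambda>c x vs. - \<Theta> c x vs)"


section \<open>Mutually exclusive conditions\<close>

definition mutually_exclusive :: "bool list \<Rightarrow> bool" where
  "mutually_exclusive Ps \<longleftrightarrow>
     (\<forall>i<length Ps. \<forall>j<length Ps. i \<noteq> j \<longrightarrow> \<not> (Ps ! i \<and> Ps ! j))"

end

(* Let dd^c w1 >= 0 and dd^c w2 <= 0. By Stokes' theorem the integrals of dd^c w1 /\ w2 and of
   w1 /\ dd^c w2 agree; the first is nonnegative and the second nonpositive, so both vanish. A
   nonnegative (2,2)-form whose product with a positive definite (1,1)-form is zero vanishes
   itself, hence dd^c w1 = dd^c w2 = 0. This separates (1), (2) and (3); (4) is the negation of
   their disjunction.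

   Stokes' theorem comes from a C^1 partition of unity (f_c): in a chart, integration by parts of
   f_c (dd^c w1 /\ w2 - w1 /\ dd^c w2) leaves boundary terms that are linear in the derivatives of
   f_c. These terms transform like a form of top degree, because the real Jacobian of a holomorphic
   map is |det|^2, so they can all be moved to one chart, where they cancel since the f_c sum to 1.
   The transition maps are only given as complex differentiable; that they are C^2 follows from
   Cauchy's integral formula in one variable. *)
theory Submission
  imports Defs "HOL-Complex_Analysis.Cauchy_Integral_Formula"
begin

section \<open>Alternating sums and determinants\<close>

text \<open>\<open>wedge\<close> into degree 6 is a sum over 720 permutations of real vectors. All
  forms here are built from dz and dzbar, so the alternation splits into one over three holomorphic
  and one over three antiholomorphic indices, see \<open>Alt6_coords\<close>; afterwards each
  top-degree density is a nested \<open>alt3\<close>, the contraction with the sign of a permutation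
  of 1, 2, 3. No integral over the manifold is formed, only integrals over coordinate space. The
  boundary term of a partition function lives in its own chart and cannot be moved as it stands: it
  is first weighted by a second copy of the partition. The piece with weight
  \<open>\<theta> q\<close> is supported in both charts and is transported to the chart of q; there
  the sum over the differentiated functions leaves the boundary term of the constant 1. The
  transport law involves second derivatives of the transition maps, since differentiating metric
  coefficients also differentiates the Jacobian; this is why those maps have to be C^2. Integration
  by parts takes one derivative of the partition, so an explicit C^1 bump serves.\<close>

definition alt3 :: "(3 \<Rightarrow> 3 \<Rightarrow> 3 \<Rightarrow> complex) \<Rightarrow> complex" where
  "alt3 f = f 1 2 3 + f 2 3 1 + f 3 1 2 - f 2 1 3 - f 3 2 1 - f 1 3 2"

definition sum3 :: "(3 \<Rightarrow> 3 \<Rightarrow> 3 \<Rightarrow> complex) \<Rightarrow> complex" where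
  "sum3 f = (\<Sum>i\<in>UNIV. \<Sum>j\<in>UNIV. \<Sum>k\<in>UNIV. f i j k)"

lemma sum3_product:
  "sum3 (\<lambda>p q r. sum3 (\<lambda>s t u. X p * Y q * Z r * (X' s * Y' t * Z' u))) =
    sum X UNIV * sum Y UNIV * sum Z UNIV * (sum X' UNIV * sum Y' UNIV * sum Z' UNIV)"
  by (simp add: sum3_def sum_distrib_left[symmetric] sum_distrib_right[symmetric] mult.assoc)

text \<open>The two adjacent swaps generate all permutations of three indices, so \<open>F\<close>
  vanishes on repeated indices and on the six distinct triples is the sign times
  \<open>F 1 2 3\<close>.\<close>

lemma sum3_mult_antisymmetric:
  assumes "\<And>i j k. F j i k = - F i j k" "\<And>i j k. F i k j = - F i j k"
  shows "sum3 (\<lambda>i j k. f i j k * F i j k) = F 1 2 3 * alt3 f"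
proof -
  have eq_neg: "z = 0" if "z = - z" for z :: complex
    using that by (simp add: complex_eq_iff)
  have 1: "F i i k = 0" "F i k k = 0" for i k
    using assms(1)[of i i k] assms(2)[of i k k] eq_neg by auto
  moreover have "F k i k = 0" for i k
    using assms(1)[of i k k] 1 by simp
  moreover have "F 2 1 3 = - F 1 2 3" "F 1 3 2 = - F 1 2 3"
    using assms(1)[of 1 2 3] assms(2)[of 1 2 3] by auto
  moreover have "F 3 1 2 = F 1 2 3" "F 2 3 1 = F 1 2 3"
    using assms(1)[of 1 3 2] assms(2)[of 1 2 3] assms(2)[of 2 1 3] assms(1)[of 1 2 3]
    by simp_all
  moreover from this(2) have "F 3 2 1 = - F 1 2 3"
    using assms(1)[of 3 2 1] by simp
  ultimately show ?thesis
    by (simp add: sum3_def alt3_def sum_3 algebra_simps)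
qed

lemma alt3_symmetric_eq_0:
  assumes "\<And>i j k. f j i k = f i j k" shows "alt3 f = 0"
  using assms[of 1 2 3] assms[of 2 3 1] assms[of 3 1 2] by (simp add: alt3_def)

text \<open>Alternating in i, j, k can be carried out on the product of matrix entries instead. The
  result is antisymmetric in the row indices p, q, r, with value \<open>det M\<close> at (1, 2, 3),
  so \<open>sum3_mult_antisymmetric\<close> collects it.\<close>

lemma alt3_det:
  fixes M :: "complex^3^3"
  shows "alt3 (\<lambda>i j k. sum3 (\<lambda>p q r. M $ p $ i * M $ q $ j * M $ r $ k * f p q r)) = det M * alt3 f"
proof -
  let ?F = "\<lambda>p q r. alt3 (\<lambda>i j k. M $ p $ i * M $ q $ j * M $ r $ k)"
  have "alt3 (\<lambda>i j k. sum3 (\<lambda>p q r. M $ p $ i * M $ q $ j * M $ r $ k * f p q r)) =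
    sum3 (\<lambda>p q r. f p q r * ?F p q r)"
    by (simp add: alt3_def sum3_def sum.distrib sum_subtractf algebra_simps)
  also have "\<dots> = ?F 1 2 3 * alt3 f"
    by (rule sum3_mult_antisymmetric) (simp_all add: alt3_def algebra_simps)
  also have "?F 1 2 3 = det M"
    by (simp add: alt3_def det_3 algebra_simps)
  finally show ?thesis .
qed

lemma alt3_linear:
  "alt3 (\<lambda>i j k. f i j k + g i j k) = alt3 f + alt3 g"
  "alt3 (\<lambda>i j k. f i j k - g i j k) = alt3 f - alt3 g"
  "alt3 (\<lambda>i j k. c * f i j k) = c * alt3 f"
  "alt3 (\<lambda>i j k. - f i j k) = - alt3 f"
  "alt3 (\<lambda>i j k. 0) = 0"
  by (simp_all add: alt3_def algebra_simps)

section \<open>Alternation over the real basis of complex 3-space\<close>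

definition std_basis :: "(complex^3) list" where
  "std_basis = [axis 1 1, axis 1 \<i>, axis 2 1, axis 2 \<i>, axis 3 1, axis 3 \<i>]"

type_synonym vec3 = "complex^3"

text \<open>An alternation without normalising factor, evaluated on the oriented real basis.
  \<open>G\<close> is curried rather than a function of lists, so that exchanging two slots is a
  renaming of bound variables.\<close>

definition Alt6 :: "(vec3 \<Rightarrow> vec3 \<Rightarrow> vec3 \<Rightarrow> vec3 \<Rightarrow> vec3 \<Rightarrow> vec3 \<Rightarrow> complex) \<Rightarrow> complex" where
  "Alt6 G = (\<Sum>\<sigma> | \<sigma> permutes {..<6}. of_int (sign \<sigma>) *
     G (std_basis ! \<sigma> 0) (std_basis ! \<sigma> 1) (std_basis ! \<sigma> 2)
       (std_basis ! \<sigma> 3) (std_basis ! \<sigma> 4) (std_basis ! \<sigma> 5))"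

text \<open>Composing with a transposition on the right permutes the index set of the sum and
  reverses every sign.\<close>

lemma Alt6_transpose:
  assumes "i < (6::nat)" "j < 6" "i \<noteq> j"
  shows "(\<Sum>\<sigma> | \<sigma> permutes {..<6}. of_int (sign \<sigma>) * H (\<sigma> \<circ> Transposition.transpose i j)) =
    - (\<Sum>\<sigma> | \<sigma> permutes {..<6}. of_int (sign \<sigma>) * (H \<sigma> :: complex))"
proof -
  have t: "Transposition.transpose i j permutes {..<6}"
    using assms by (simp add: permutes_swap_id)
  have "(\<Sum>\<sigma> | \<sigma> permutes {..<6}. of_int (sign \<sigma>) * (H \<sigma> :: complex)) =
    (\<Sum>\<sigma> | \<sigma> permutes {..<6}. of_int (sign (\<sigma> \<circ> Transposition.transpose i j)) * H (\<sigma> \<circ> Transposition.transpose i j))"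
    by (rule sum_permutations_compose_right[OF t])
  also have "\<dots> = (\<Sum>\<sigma> | \<sigma> permutes {..<6}. - (of_int (sign \<sigma>) * H (\<sigma> \<circ> Transposition.transpose i j)))"
    using assms
    by (intro sum.cong refl)
       (simp add: sign_compose permutation_swap_id sign_swap_id comp_def[symmetric] permutes_imp_permutation[of "{..<6}"])
  finally show ?thesis by (simp add: sum_negf)
qed

lemma Alt6_swap:
  "Alt6 (\<lambda>a b c d e f. G b a c d e f) = - Alt6 G"
  "Alt6 (\<lambda>a b c d e f. G a c b d e f) = - Alt6 G"
  "Alt6 (\<lambda>a b c d e f. G a b d c e f) = - Alt6 G"
  "Alt6 (\<lambda>a b c d e f. G a b c e d f) = - Alt6 G"
  "Alt6 (\<lambda>a b c d e f. G a b c d f e) = - Alt6 G"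
  using Alt6_transpose[of 0 1 "\<lambda>s. G (std_basis ! s 0) (std_basis ! s 1) (std_basis ! s 2)
       (std_basis ! s 3) (std_basis ! s 4) (std_basis ! s 5)"]
   Alt6_transpose[of 1 2 "\<lambda>s. G (std_basis ! s 0) (std_basis ! s 1) (std_basis ! s 2)
       (std_basis ! s 3) (std_basis ! s 4) (std_basis ! s 5)"]
   Alt6_transpose[of 2 3 "\<lambda>s. G (std_basis ! s 0) (std_basis ! s 1) (std_basis ! s 2)
       (std_basis ! s 3) (std_basis ! s 4) (std_basis ! s 5)"]
   Alt6_transpose[of 3 4 "\<lambda>s. G (std_basis ! s 0) (std_basis ! s 1) (std_basis ! s 2)
       (std_basis ! s 3) (std_basis ! s 4) (std_basis ! s 5)"]
   Alt6_transpose[of 4 5 "\<lambda>s. G (std_basis ! s 0) (std_basis ! s 1) (std_basis ! s 2)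
       (std_basis ! s 3) (std_basis ! s 4) (std_basis ! s 5)"]
  by (simp_all add: Alt6_def Transposition.transpose_def)

lemma Alt6_linear:
  "Alt6 (\<lambda>a b c d e f. G a b c d e f + H a b c d e f) = Alt6 G + Alt6 H"
  "Alt6 (\<lambda>a b c d e f. G a b c d e f - H a b c d e f) = Alt6 G - Alt6 H"
  "Alt6 (\<lambda>a b c d e f. z * G a b c d e f) = z * Alt6 G"
  "Alt6 (\<lambda>a b c d e f. - G a b c d e f) = - Alt6 G"
  by (simp_all add: Alt6_def algebra_simps sum.distrib sum_subtractf sum_distrib_left sum_negf)

lemma Alt6_sum:
  "Alt6 (\<lambda>a b c d e f. \<Sum>i\<in>I. G i a b c d e f) = (\<Sum>i\<in>I. Alt6 (G i))"
  unfolding Alt6_def sum_distrib_left by (rule sum.swap)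

lemma Alt6_sum3:
  "Alt6 (\<lambda>a b c d e f. sum3 (\<lambda>i j k. G i j k a b c d e f)) = sum3 (\<lambda>i j k. Alt6 (G i j k))"
  by (simp add: sum3_def Alt6_sum)

text \<open>The denominator 48 is 4! * 2!, the normalisation of \<open>wedge\<close>.\<close>

lemma wedge_4_2_eq_Alt6:
  "wedge 4 2 \<Theta> \<rho> std_basis = Alt6 (\<lambda>a b c d e f. \<Theta> [a, b, c, d] * \<rho> [e, f]) / 48"
proof -
  have "[0..<6] = [0,1,2,3,4,5::nat]" by (simp add: upt_rec)
  then show ?thesis
    by (simp add: wedge_def Alt6_def permute_list_def std_basis_def mult.assoc fact_numeral numeral_eq_Suc)
qed

text \<open>A swap across one slot is three adjacent swaps. In the products below, holomorphic and
  antiholomorphic slots alternate, so these are the exchanges within one type.\<close>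

lemma Alt6_swap_skip:
  "Alt6 (\<lambda>a b c d e f. G c b a d e f) = - Alt6 G"
  "Alt6 (\<lambda>a b c d e f. G a d c b e f) = - Alt6 G"
  "Alt6 (\<lambda>a b c d e f. G a b e d c f) = - Alt6 G"
  "Alt6 (\<lambda>a b c d e f. G a b c f e d) = - Alt6 G"
  using Alt6_swap(1)[of "\<lambda>a b c d e f. G c a b d e f"] Alt6_swap(2)[of "\<lambda>a b c d e f. G b a c d e f"] Alt6_swap(1)[of G]
    Alt6_swap(2)[of "\<lambda>a b c d e f. G a d b c e f"] Alt6_swap(3)[of "\<lambda>a b c d e f. G a c b d e f"] Alt6_swap(2)[of G]
    Alt6_swap(3)[of "\<lambda>a b c d e f. G a b e c d f"] Alt6_swap(4)[of "\<lambda>a b c d e f. G a b d c e f"] Alt6_swap(3)[of G]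
    Alt6_swap(4)[of "\<lambda>a b c d e f. G a b c f d e"] Alt6_swap(5)[of "\<lambda>a b c d e f. G a b c e d f"] Alt6_swap(4)[of G]
  by simp_all

text \<open>Each of the three differences contributes two equal terms, because swapping the
  arguments of one factor reverses the sign of \<open>Alt6\<close>; hence 8 = 2^3.\<close>

lemma Alt6_antisymmetrize:
  "8 * Alt6 (\<lambda>a b c d e f. P a b * Q c d * R e f) =
    Alt6 (\<lambda>a b c d e f. (P a b - P b a) * (Q c d - Q d c) * (R e f - R f e))"
proof -
  have 1: "Alt6 (\<lambda>a b c d e f. P b a * Q' c d * R' e f) = - Alt6 (\<lambda>a b c d e f. P a b * Q' c d * R' e f)"
    for P Q' R' by (rule Alt6_swap)
  have 2: "Alt6 (\<lambda>a b c d e f. P a b * Q d c * R' e f) = - Alt6 (\<lambda>a b c d e f. P a b * Q c d * R' e f)"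
    for P Q R' by (rule Alt6_swap)
  have 3: "Alt6 (\<lambda>a b c d e f. P a b * Q c d * R f e) = - Alt6 (\<lambda>a b c d e f. P a b * Q c d * R e f)"
    for P Q R by (rule Alt6_swap)
  show ?thesis
    by (simp add: left_diff_distrib right_diff_distrib Alt6_linear 1[of P] 2[of _ Q] 3[of _ _ R])
qed

section \<open>Real coordinates and determinants\<close>

definition basis_index :: "6 \<Rightarrow> nat" where
  "basis_index = (SOME f. bij_betw f UNIV {..<6})"

lemma bij_betw_basis_index: "bij_betw basis_index UNIV {..<6}"
  unfolding basis_index_def
  by (rule someI_ex[where P = "\<lambda>f. bij_betw f UNIV {..<6}"], rule finite_same_card_bij) simp_all

definition basis6 :: "6 \<Rightarrow> complex^3" where
  "basis6 i = std_basis ! basis_index i"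

lemma Basis_eq_set_std_basis: "Basis = set std_basis"
  by (auto simp: Basis_vec_def Basis_complex_def std_basis_def UNIV_3)

lemma bij_betw_basis6: "bij_betw basis6 UNIV Basis"
proof -
  have "distinct std_basis" by (simp add: std_basis_def axis_eq_axis)
  then have "bij_betw ((!) std_basis) {..<6} (set std_basis)"
    by (rule bij_betw_nth) (simp_all add: std_basis_def)
  then show ?thesis
    using bij_betw_trans[OF bij_betw_basis_index, of "(!) std_basis"]
    by (simp add: Basis_eq_set_std_basis basis6_def[abs_def] comp_def)
qed

text \<open>\<open>det\<close> is indexed by the type \<open>6\<close>, \<open>Alt6\<close> by the
  naturals below 6. Conjugating a permutation by the bijection \<open>basis_index\<close> preserves
  its sign, and the same bijection labels rows and columns, so the arbitrary choice in
  \<open>basis_index\<close> does not affect the value.\<close>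

lemma sum_permutations_eq_det:
  fixes m :: "nat \<Rightarrow> nat \<Rightarrow> real"
  shows "(\<Sum>\<sigma> | \<sigma> permutes {..<6}. of_int (sign \<sigma>) * (\<Prod>i<6. m i (\<sigma> i))) =
    det (\<chi> i j :: 6. m (basis_index i) (basis_index j))"
proof -
  let ?g = "map_permutation UNIV basis_index"
  have inj: "inj basis_index" using bij_betw_basis_index by (rule bij_betw_imp_inj_on)
  have "?g = (\<lambda>p x. if x \<in> {..<6} then basis_index (p (inv basis_index x)) else x)"
    using bij_betw_imp_surj_on[OF bij_betw_basis_index]
    by (auto simp: map_permutation_def restrict_id_def fun_eq_iff)
  then have bij: "bij_betw ?g {p. p permutes (UNIV :: 6 set)} {p. p permutes {..<6}}"
    using bij_betw_permutations[OF bij_betw_basis_index] by simp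
  have "(\<Sum>\<sigma> | \<sigma> permutes {..<6}. of_int (sign \<sigma>) * (\<Prod>i<6. m i (\<sigma> i))) =
    (\<Sum>p | p permutes (UNIV :: 6 set). of_int (sign (?g p)) * (\<Prod>i<6. m i (?g p i)))"
    by (rule sum.reindex_bij_betw[OF bij, symmetric])
  also have "\<dots> = (\<Sum>p | p permutes (UNIV :: 6 set). of_int (sign p) * (\<Prod>i\<in>UNIV. m (basis_index i) (basis_index (p i))))"
  proof (intro sum.cong refl arg_cong2[where f="(*)"])
    fix p :: "6 \<Rightarrow> 6" assume "p \<in> {p. p permutes UNIV}"
    then have "p permutes UNIV" by simp
    then show "(of_int (sign (?g p)) :: real) = of_int (sign p)"
      using inj by (simp add: sign_map_permutation)
    have "(\<Prod>i<6. m i (?g p i)) = (\<Prod>i\<in>UNIV. m (basis_index i) (?g p (basis_index i)))"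
      by (rule prod.reindex_bij_betw[OF bij_betw_basis_index, symmetric])
    then show "(\<Prod>i<6. m i (?g p i)) = (\<Prod>i\<in>UNIV. m (basis_index i) (basis_index (p i)))"
      using inj by (simp add: map_permutation_apply)
  qed
  finally show ?thesis by (simp add: det_def)
qed

text \<open>\<open>det\<close>, \<open>matrix\<close> and the change of variables theorem are for
  \<open>real^6\<close>; this map and the next identify that space with
  \<open>complex^3\<close>.\<close>

definition real_coords :: "complex^3 \<Rightarrow> real^6" where
  "real_coords v = (\<chi> i. v \<bullet> basis6 i)"

definition complex_coords :: "real^6 \<Rightarrow> complex^3" where
  "complex_coords u = (\<Sum>i\<in>UNIV. (u $ i) *\<^sub>R basis6 i)"

lemma complex_coords_axis: "complex_coords (axis i 1) = basis6 i"
  by (simp add: complex_coords_def axis_def if_distrib[of "\<lambda>r. r *\<^sub>R _"] cong: if_cong)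

text \<open>The real and imaginary parts of the three coordinates, in the order of
  \<open>std_basis\<close>, are the real coordinates, so the sum is the Leibniz expansion of the
  determinant.\<close>

lemma Alt6_real_coords:
  "Alt6 (\<lambda>a b c d e f. of_real (Re (L a $ 1) * Im (L b $ 1) * (Re (L c $ 2) * Im (L d $ 2)) * (Re (L e $ 3) * Im (L f $ 3)))) =
    of_real (det (matrix (real_coords \<circ> L \<circ> complex_coords)))"
proof -
  have eq: "{..<6} = {0,1,2,3,4,5::nat}" by auto
  have "matrix (real_coords \<circ> L \<circ> complex_coords) =
    (\<chi> i j. L (std_basis ! basis_index j) \<bullet> (std_basis ! basis_index i))"
    by (simp add: matrix_def complex_coords_axis) (simp add: real_coords_def basis6_def)
  then have "det (matrix (real_coords \<circ> L \<circ> complex_coords)) =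
     (\<Sum>\<sigma> | \<sigma> permutes {..<6}. of_int (sign \<sigma>) * (\<Prod>i<6. L (std_basis ! \<sigma> i) \<bullet> (std_basis ! i)))"
    by (simp add: sum_permutations_eq_det[of "\<lambda>i j. L (std_basis ! j) \<bullet> std_basis ! i"])
  moreover have "(\<Prod>i<6. L (std_basis ! \<sigma> i) \<bullet> (std_basis ! i)) =
    Re (L (std_basis ! \<sigma> 0) $ 1) * Im (L (std_basis ! \<sigma> 1) $ 1) * (Re (L (std_basis ! \<sigma> 2) $ 2) *
    Im (L (std_basis ! \<sigma> 3) $ 2)) * (Re (L (std_basis ! \<sigma> 4) $ 3) * Im (L (std_basis ! \<sigma> 5) $ 3))" for \<sigma>
    unfolding eq by (simp add: inner_axis inner_complex_def) (simp add: std_basis_def inner_axis inner_complex_def)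
  ultimately show ?thesis
    by (simp add: Alt6_def)
qed

text \<open>In each coordinate dz \<and> dzbar = -2i dx \<and> dy, and (-2i)^3 = 8i.
  Antisymmetrising both sides first turns this identity of 2-forms into one of integrands; the
  factors 8 from \<open>Alt6_antisymmetrize\<close> cancel.\<close>

lemma Alt6_coords_1:
  "Alt6 (\<lambda>a b c d e f. L a $ 1 * cnj (L b $ 1) * (L c $ 2 * cnj (L d $ 2)) * (L e $ 3 * cnj (L f $ 3))) =
   8 * \<i> * of_real (det (matrix (real_coords \<circ> L \<circ> complex_coords)))"
proof -
  let ?P = "\<lambda>i u v. complex_of_real (Re (L u $ i) * Im (L v $ i))"
  have *: "L u $ i * cnj (L v $ i) - L v $ i * cnj (L u $ i) = - 2 * \<i> * (?P i u v - ?P i v u)" for u v i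
    by (simp add: complex_eq_iff algebra_simps)
  have "8 * Alt6 (\<lambda>a b c d e f. L a $ 1 * cnj (L b $ 1) * (L c $ 2 * cnj (L d $ 2)) * (L e $ 3 * cnj (L f $ 3))) =
    Alt6 (\<lambda>a b c d e f. (8 * \<i>) * ((?P 1 a b - ?P 1 b a) * (?P 2 c d - ?P 2 d c) * (?P 3 e f - ?P 3 f e)))"
    unfolding Alt6_antisymmetrize[of "\<lambda>a b. L a $ 1 * cnj (L b $ 1)" "\<lambda>a b. L a $ 2 * cnj (L b $ 2)"] *
    by (rule arg_cong[where f=Alt6]) (simp add: fun_eq_iff)
  also have "\<dots> = 8 * \<i> * (8 * Alt6 (\<lambda>a b c d e f. ?P 1 a b * ?P 2 c d * ?P 3 e f))"
    unfolding Alt6_linear by (subst Alt6_antisymmetrize) simp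
  also have "Alt6 (\<lambda>a b c d e f. ?P 1 a b * ?P 2 c d * ?P 3 e f) =
     of_real (det (matrix (real_coords \<circ> L \<circ> complex_coords)))"
    unfolding Alt6_real_coords[symmetric] by simp
  finally show ?thesis by simp
qed

lemma matrix_real_coords_id: "det (matrix (real_coords \<circ> id \<circ> complex_coords)) = 1"
proof -
  have "basis6 i \<bullet> basis6 j = (if i = j then 1 else 0)" for i j
    using bij_betwE[OF bij_betw_basis6] bij_betw_imp_inj_on[OF bij_betw_basis6]
    by (simp add: inner_Basis inj_eq)
  then have "matrix (real_coords \<circ> id \<circ> complex_coords) = mat 1"
    by (simp add: matrix_def complex_coords_axis mat_def vec_eq_iff) (auto simp: real_coords_def)
  then show ?thesis by simp
qed

text \<open>Exchanging two indices within p, q, r or within s, t, u amounts to exchanging two slots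
  of the same type, so the alternated product is antisymmetric in each group. Two applications of
  \<open>sum3_mult_antisymmetric\<close> leave its single value at (1, 2, 3; 1, 2, 3), which is 8i
  by \<open>Alt6_coords_1\<close> for the identity.\<close>

lemma Alt6_coords:
  "sum3 (\<lambda>p q r. sum3 (\<lambda>s t u. f p q r s t u *
     Alt6 (\<lambda>a b c d e f. a $ p * cnj (b $ s) * (c $ q * cnj (d $ t)) * (e $ r * cnj (f $ u))))) =
   8 * \<i> * alt3 (\<lambda>p q r. alt3 (\<lambda>s t u. f p q r s t u))"
proof -
  let ?G = "\<lambda>p q r s t u a b c d e f. (a::complex^3) $ p * cnj ((b::complex^3) $ s) * (c $ q * cnj (d $ t)) * (e $ r * cnj (f $ u))"
  let ?K = "\<lambda>p q r s t u. Alt6 (?G p q r s t u)"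
  have 1: "?K q p r s t u = - ?K p q r s t u" "?K p r q s t u = - ?K p q r s t u"
    "?K p q r t s u = - ?K p q r s t u" "?K p q r s u t = - ?K p q r s t u" for p q r s t u
    using Alt6_swap_skip(1)[of "?G p q r s t u"] Alt6_swap_skip(3)[of "?G p q r s t u"]
     Alt6_swap_skip(2)[of "?G p q r s t u"] Alt6_swap_skip(4)[of "?G p q r s t u"]
    by (simp_all add: mult_ac)
  have "sum3 (\<lambda>p q r. sum3 (\<lambda>s t u. f p q r s t u * ?K p q r s t u)) =
     sum3 (\<lambda>p q r. alt3 (\<lambda>s t u. f p q r s t u) * ?K p q r 1 2 3)"
  proof -
    have "sum3 (\<lambda>s t u. f p q r s t u * ?K p q r s t u) = ?K p q r 1 2 3 * alt3 (\<lambda>s t u. f p q r s t u)" for p q r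
      by (rule sum3_mult_antisymmetric) (rule 1)+
    then show ?thesis by (simp only: mult.commute)
  qed
  also have "\<dots> = ?K 1 2 3 1 2 3 * alt3 (\<lambda>p q r. alt3 (\<lambda>s t u. f p q r s t u))"
    by (rule sum3_mult_antisymmetric) (rule 1)+
  also have "?K 1 2 3 1 2 3 = 8 * \<i>"
    using Alt6_coords_1[of id] matrix_real_coords_id by simp
  finally show ?thesis by simp
qed

text \<open>A complex linear map multiplies \<open>dz\<^sub>1 \<and> dzbar\<^sub>1 \<and> dz\<^sub>2 \<and> dzbar\<^sub>2 \<and> dz\<^sub>3 \<and> dzbar\<^sub>3\<close>, which is
  a multiple of the volume form, by both sides of this equation.\<close>

lemma det_real_coords_complex_linear:
  fixes M :: "complex^3^3"
  shows "of_real (det (matrix (real_coords \<circ> (*v) M \<circ> complex_coords))) = det M * cnj (det M)"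
proof -
  let ?e = "\<lambda>p q r s t u. of_bool (p = 1 \<and> q = 2 \<and> r = 3) * of_bool (s = 1 \<and> t = 2 \<and> u = 3) :: complex"
  let ?N = "\<chi> i j. cnj (M $ i $ j)"
  have "8 * \<i> * of_real (det (matrix (real_coords \<circ> (*v) M \<circ> complex_coords))) =
    Alt6 (\<lambda>a b c d e f. (M *v a) $ 1 * cnj ((M *v b) $ 1) * ((M *v c) $ 2 * cnj ((M *v d) $ 2)) * ((M *v e) $ 3 * cnj ((M *v f) $ 3)))"
    by (rule Alt6_coords_1[symmetric])
  also have "\<dots> = Alt6 (\<lambda>a b c d e f. sum3 (\<lambda>p q r. sum3 (\<lambda>s t u.
      (M$1$p * M$2$q * M$3$r * (?N$1$s * ?N$2$t * ?N$3$u)) *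
     (a $ p * cnj (b $ s) * (c $ q * cnj (d $ t)) * (e $ r * cnj (f $ u))))))"
  proof (rule arg_cong[where f=Alt6], intro ext)
    fix a b c d e f :: "complex^3"
    show "(M *v a) $ 1 * cnj ((M *v b) $ 1) * ((M *v c) $ 2 * cnj ((M *v d) $ 2)) * ((M *v e) $ 3 * cnj ((M *v f) $ 3)) =
      sum3 (\<lambda>p q r. sum3 (\<lambda>s t u.
      (M$1$p * M$2$q * M$3$r * (?N$1$s * ?N$2$t * ?N$3$u)) *
     (a $ p * cnj (b $ s) * (c $ q * cnj (d $ t)) * (e $ r * cnj (f $ u)))))"
      using sum3_product[of "\<lambda>p. M$1$p * a$p" "\<lambda>p. M$2$p * c$p" "\<lambda>p. M$3$p * e$p"
         "\<lambda>p. ?N$1$p * cnj (b$p)" "\<lambda>p. ?N$2$p * cnj (d$p)" "\<lambda>p. ?N$3$p * cnj (f$p)"]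
      by (simp add: matrix_vector_mult_def mult_ac)
  qed
  also have "\<dots> = sum3 (\<lambda>p q r. sum3 (\<lambda>s t u. (M$1$p * M$2$q * M$3$r * (?N$1$s * ?N$2$t * ?N$3$u)) *
     Alt6 (\<lambda>a b c d e f. a $ p * cnj (b $ s) * (c $ q * cnj (d $ t)) * (e $ r * cnj (f $ u)))))"
    by (simp only: Alt6_sum3 Alt6_linear)
  also have "\<dots> = 8 * \<i> * alt3 (\<lambda>p q r. alt3 (\<lambda>s t u. (M$1$p * M$2$q * M$3$r) * (?N$1$s * ?N$2$t * ?N$3$u)))"
    by (rule Alt6_coords)
  also have "alt3 (\<lambda>p q r. alt3 (\<lambda>s t u. (M$1$p * M$2$q * M$3$r) * (?N$1$s * ?N$2$t * ?N$3$u))) =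
      alt3 (\<lambda>p q r. M$1$p * M$2$q * M$3$r) * alt3 (\<lambda>s t u. ?N$1$s * ?N$2$t * ?N$3$u)"
    unfolding alt3_linear by (simp add: alt3_def algebra_simps)
  also have "alt3 (\<lambda>p q r. M$1$p * M$2$q * M$3$r) = det M"
    by (simp add: alt3_def det_3 algebra_simps)
  also have "alt3 (\<lambda>s t u. ?N$1$s * ?N$2$t * ?N$3$u) = cnj (det M)"
    by (simp add: alt3_def det_3 algebra_simps)
  finally show ?thesis by (simp add: comp_def)
qed

section \<open>Complex derivatives of local forms\<close>

lemma D10_has_derivative:
  "(f has_derivative L) (at x) \<Longrightarrow> D10 f x v = (L v - \<i> * L (\<i> *s v)) / 2"
  by (simp add: D10_def frechet_derivative_at[symmetric])

lemma D01_has_derivative: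
  "(f has_derivative L) (at x) \<Longrightarrow> D01 f x v = (L v + \<i> * L (\<i> *s v)) / 2"
  by (simp add: D01_def frechet_derivative_at[symmetric])

text \<open>Forms are meaningful only on chart images, so every derivative has to be local.
  \<open>frechet_derivative\<close> is a choice operator; equal sets of derivatives give equal
  choices, which covers functions that are not differentiable as well.\<close>

lemma frechet_derivative_cong_open:
  assumes "open S" "x \<in> S" "\<And>y. y \<in> S \<Longrightarrow> f y = g y"
  shows "frechet_derivative f (at x) = frechet_derivative g (at x)"
proof -
  have "(f has_derivative L) (at x) \<longleftrightarrow> (g has_derivative L) (at x)" for L
    using has_derivative_transform_within_open[OF _ assms(1,2), of f L UNIV g]
      has_derivative_transform_within_open[OF _ assms(1,2), of g L UNIV f] assms(3) by auto
  then show ?thesis unfolding frechet_derivative_def by simp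
qed

lemma D10_cong_open:
  assumes "open S" "x \<in> S" "\<And>y. y \<in> S \<Longrightarrow> f y = g y"
  shows "D10 f x = D10 g x"
  by (simp add: D10_def[abs_def] frechet_derivative_cong_open[OF assms])

lemma D01_cong_open:
  assumes "open S" "x \<in> S" "\<And>y. y \<in> S \<Longrightarrow> f y = g y"
  shows "D01 f x = D01 g x"
  by (simp add: D01_def[abs_def] frechet_derivative_cong_open[OF assms])

lemma differentiable_has_frechet:
  "f differentiable (at x) \<Longrightarrow> (f has_derivative frechet_derivative f (at x)) (at x)"
  by (simp add: frechet_derivative_works)

context
  fixes f g :: "complex^'n::finite \<Rightarrow> complex" and x :: "complex^'n"
  assumes f: "f differentiable (at x)" and g: "g differentiable (at x)"
begin

private lemmas hf = differentiable_has_frechet[OF f] and hg = differentiable_has_frechet[OF g]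

lemma D10_add: "D10 (\<lambda>y. f y + g y) x v = D10 f x v + D10 g x v"
  using D10_has_derivative[OF has_derivative_add[OF hf hg]] by (simp add: D10_def algebra_simps add_divide_distrib diff_divide_distrib)

lemma D01_add: "D01 (\<lambda>y. f y + g y) x v = D01 f x v + D01 g x v"
  using D01_has_derivative[OF has_derivative_add[OF hf hg]] by (simp add: D01_def algebra_simps add_divide_distrib diff_divide_distrib)

lemma D10_diff: "D10 (\<lambda>y. f y - g y) x v = D10 f x v - D10 g x v"
  using D10_has_derivative[OF has_derivative_diff[OF hf hg]] by (simp add: D10_def algebra_simps add_divide_distrib diff_divide_distrib)

lemma D10_mult: "D10 (\<lambda>y. f y * g y) x v = f x * D10 g x v + D10 f x v * g x"
  unfolding D10_has_derivative[OF has_derivative_mult[OF hf hg]]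
  by (simp add: D10_def add_divide_distrib diff_divide_distrib algebra_simps)

lemma D01_mult: "D01 (\<lambda>y. f y * g y) x v = f x * D01 g x v + D01 f x v * g x"
  unfolding D01_has_derivative[OF has_derivative_mult[OF hf hg]]
  by (simp add: D01_def add_divide_distrib diff_divide_distrib algebra_simps)

lemma D01_cnj: "D01 (\<lambda>y. cnj (f y)) x v = cnj (D10 f x v)"
  using D01_has_derivative[OF has_derivative_cnj[OF hf]] by (simp add: D10_def)

end

lemma D10_const: "D10 (\<lambda>y. c) x v = 0"
  using D10_has_derivative[OF has_derivative_const, of c] by simp

lemma D01_const: "D01 (\<lambda>y. c) x v = 0"
  using D01_has_derivative[OF has_derivative_const, of c] by simp

lemma D10_multc: "f differentiable (at x) \<Longrightarrow> D10 (\<lambda>y. f y * c) x v = D10 f x v * c"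
  by (simp add: D10_mult D10_const)

lemma D01_multc: "f differentiable (at x) \<Longrightarrow> D01 (\<lambda>y. f y * c) x v = D01 f x v * c"
  by (simp add: D01_mult D01_const)

lemma D10_sum:
  assumes "\<And>i. i \<in> I \<Longrightarrow> f i differentiable (at x)"
  shows "D10 (\<lambda>y. \<Sum>i\<in>I. f i y) x v = (\<Sum>i\<in>I. D10 (f i) x v)"
  using assms by (induction I rule: infinite_finite_induct) (simp_all add: D10_const D10_add)

lemma D01_sum:
  assumes "\<And>i. i \<in> I \<Longrightarrow> f i differentiable (at x)"
  shows "D01 (\<lambda>y. \<Sum>i\<in>I. f i y) x v = (\<Sum>i\<in>I. D01 (f i) x v)"
  using assms by (induction I rule: infinite_finite_induct) (simp_all add: D01_const D01_add)

lemma scaleC_eq: "(c *s v :: complex^'n) = Re c *\<^sub>R v + Im c *\<^sub>R (\<i> *s v)"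
  by (simp add: vec_eq_iff complex_eq_iff)

lemma complex_linear_real:
  assumes "linear L" "\<And>v. L (\<i> *s v) = \<i> * L v"
  shows "L (c *s v) = c * (L v :: complex)"
  by (subst scaleC_eq) (simp add: assms linear_add linear_scale, simp add: scaleR_conv_of_real complex_eq_iff)

lemma complex_linear_expand:
  assumes "linear L" "\<And>v. L (\<i> *s v) = \<i> * (L v :: complex)"
  shows "L v = (\<Sum>j\<in>UNIV. v $ j * L (axis j 1))"
proof -
  have "v = (\<Sum>j\<in>UNIV. v $ j *s axis j 1)" by (simp add: basis_expansion)
  then have "L v = (\<Sum>j\<in>UNIV. L (v $ j *s axis j 1))"
    using linear_sum[OF assms(1)] by metis
  then show ?thesis by (simp add: complex_linear_real[OF assms])
qed

lemma D10_expand: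
  fixes f :: "complex^'n::finite \<Rightarrow> complex"
  assumes "f differentiable (at x)"
  shows "D10 f x v = (\<Sum>j\<in>UNIV. v $ j * D10 f x (axis j 1))"
proof (rule complex_linear_expand)
  let ?L = "frechet_derivative f (at x)"
  have L: "linear ?L" using assms by (rule linear_frechet_derivative)
  have i: "\<i> *s (r *\<^sub>R v) = r *\<^sub>R (\<i> *s v)" for r and v :: "complex^'n"
    by (simp add: vec_eq_iff)
  show "linear (D10 f x)"
    unfolding D10_def[abs_def]
  proof (rule linearI)
    fix v w :: "complex^'n" and r :: real
    show "(?L (v + w) - \<i> * ?L (\<i> *s (v + w))) / 2 = (?L v - \<i> * ?L (\<i> *s v)) / 2 + (?L w - \<i> * ?L (\<i> *s w)) / 2"
      by (simp add: vector_add_ldistrib linear_add[OF L] distrib_left diff_divide_distrib add_divide_distrib)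
    show "(?L (r *\<^sub>R v) - \<i> * ?L (\<i> *s (r *\<^sub>R v))) / 2 = r *\<^sub>R ((?L v - \<i> * ?L (\<i> *s v)) / 2)"
      unfolding i linear_scale[OF L] by (simp add: scaleR_conv_of_real diff_divide_distrib algebra_simps)
  qed
  have "\<i> *s (\<i> *s v) = - v" for v :: "complex^'n" by (simp add: vec_eq_iff)
  then show "D10 f x (\<i> *s v) = \<i> * D10 f x v" for v
    by (simp add: D10_def linear_neg[OF L] algebra_simps)
qed

lemma D01_expand:
  fixes f :: "complex^'n::finite \<Rightarrow> complex"
  assumes "f differentiable (at x)"
  shows "D01 f x v = (\<Sum>j\<in>UNIV. cnj (v $ j) * D01 f x (axis j 1))"
proof -
  have 1: "(\<lambda>y. cnj (f y)) differentiable (at x)"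
    using has_derivative_cnj[OF differentiable_has_frechet[OF assms]] differentiable_def by blast
  \<comment> \<open>\<open>D01 f\<close> is antilinear; conjugating the function turns it into a
    \<open>D10\<close>, to which the complex-linear expansion applies.\<close>
  have 2: "D01 f x v = cnj (D10 (\<lambda>y. cnj (f y)) x v)" for v
    using D01_cnj[OF 1 1] by simp
  show ?thesis unfolding 2 by (subst D10_expand[OF 1]) simp
qed

lemma Ck2_D:
  assumes "Ck_on 2 S f" "x \<in> S"
  shows "f differentiable (at x)" "(\<lambda>y. frechet_derivative f (at y) v) differentiable (at x)"
  using assms by (auto simp: numeral_2_eq_2)

lemma Ck2_D01:
  assumes "Ck_on 2 S f" "x \<in> S"
  shows "(\<lambda>y. D01 f y v) differentiable (at x)" "(\<lambda>y. D10 f y v) differentiable (at x)"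
  unfolding D01_def D10_def divide_inverse
  by (intro differentiable_mult differentiable_add differentiable_diff differentiable_const Ck2_D[OF assms])+

section \<open>Coefficients of \<open>ddc\<close>\<close>

definition ddbar_coeff :: "(3 \<Rightarrow> 3 \<Rightarrow> complex^3 \<Rightarrow> complex) \<Rightarrow> complex^3 \<Rightarrow> 3 \<Rightarrow> 3 \<Rightarrow> 3 \<Rightarrow> 3 \<Rightarrow> complex" where
  "ddbar_coeff h x a b c d = D10 (\<lambda>y. D01 (h c d) y (axis b 1)) x (axis a 1)"

text \<open>The slots follow dz_a, dzbar_b, dz_c, dzbar_d, the order in which the two derivatives
  and the indices of \<open>h c d\<close> occur in \<open>ddbar_coeff\<close>. No alternation is
  built in; it is left to \<open>Alt6\<close>.\<close>

definition tensor4 :: "(3 \<Rightarrow> 3 \<Rightarrow> 3 \<Rightarrow> 3 \<Rightarrow> complex) \<Rightarrow> vec3 \<Rightarrow> vec3 \<Rightarrow> vec3 \<Rightarrow> vec3 \<Rightarrow> complex" where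
  "tensor4 T t u v w =
    (\<Sum>a\<in>UNIV. \<Sum>b\<in>UNIV. \<Sum>c\<in>UNIV. \<Sum>d\<in>UNIV. T a b c d * (t $ a * cnj (u $ b) * v $ c * cnj (w $ d)))"

text \<open>The interchanges of sums bring the three holomorphic indices in front of the three
  antiholomorphic ones, the shape of \<open>Alt6_coords\<close>. The alternating slots account for
  the order p, s, q, t in \<open>T\<close>.\<close>

lemma Alt6_tensor4:
  "Alt6 (\<lambda>a b c d e f. tensor4 T a b c d * ((\<Sum>r\<in>UNIV. e $ r * y r) * (\<Sum>u\<in>UNIV. cnj (f $ u) * z u))) =
    8 * \<i> * alt3 (\<lambda>p q r. alt3 (\<lambda>s t u. T p s q t * (y r * z u)))"
proof -
  have "tensor4 T a b c d * ((\<Sum>r\<in>UNIV. e $ r * y r) * (\<Sum>u\<in>UNIV. cnj (f $ u) * z u)) =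
    sum3 (\<lambda>p q r. sum3 (\<lambda>s t u. (T p s q t * (y r * z u)) *
      (a $ p * cnj (b $ s) * (c $ q * cnj (d $ t)) * (e $ r * cnj (f $ u)))))" for a b c d e f
  proof -
    let ?F = "\<lambda>p q r s t u. (T p s q t * (y r * z u)) *
      (a $ p * cnj (b $ s) * (c $ q * cnj (d $ t)) * (e $ r * cnj (f $ u)))"
    have "tensor4 T a b c d * ((\<Sum>r\<in>UNIV. e $ r * y r) * (\<Sum>u\<in>UNIV. cnj (f $ u) * z u)) =
      (\<Sum>p\<in>UNIV. \<Sum>s\<in>UNIV. \<Sum>q\<in>UNIV. \<Sum>t\<in>UNIV. \<Sum>r\<in>UNIV. \<Sum>u\<in>UNIV. ?F p q r s t u)"
      unfolding tensor4_def sum_product sum_distrib_right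
      unfolding sum_distrib_left by (simp only: mult_ac)
    also have "\<dots> = (\<Sum>p\<in>UNIV. \<Sum>q\<in>UNIV. \<Sum>s\<in>UNIV. \<Sum>t\<in>UNIV. \<Sum>r\<in>UNIV. \<Sum>u\<in>UNIV. ?F p q r s t u)"
      by (rule sum.cong[OF refl], rule sum.swap)
    also have "\<dots> = (\<Sum>p\<in>UNIV. \<Sum>q\<in>UNIV. \<Sum>s\<in>UNIV. \<Sum>r\<in>UNIV. \<Sum>t\<in>UNIV. \<Sum>u\<in>UNIV. ?F p q r s t u)"
      by (rule sum.cong[OF refl], rule sum.cong[OF refl], rule sum.cong[OF refl], rule sum.swap)
    also have "\<dots> = (\<Sum>p\<in>UNIV. \<Sum>q\<in>UNIV. \<Sum>r\<in>UNIV. \<Sum>s\<in>UNIV. \<Sum>t\<in>UNIV. \<Sum>u\<in>UNIV. ?F p q r s t u)"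
      by (rule sum.cong[OF refl], rule sum.cong[OF refl], rule sum.swap)
    finally show ?thesis by (simp add: sum3_def)
  qed
  then show ?thesis
    by (simp only: Alt6_sum3 Alt6_linear Alt6_coords)
qed

lemma wedge_1_1:
  "wedge 1 1 \<alpha> \<beta> [v, w] = \<alpha> [v] * \<beta> [w] - \<alpha> [w] * \<beta> [v]"
proof -
  have eq: "{..<Suc (Suc 0)} = insert 0 {1}" by auto
  have "Transposition.transpose 0 (Suc 0) \<noteq> id"
    by (metis Transposition.transpose_apply_first id_apply nat.distinct(1))
  then show ?thesis
    by (simp add: wedge_def eq permutes_doubleton_iff permute_list_def Collect_disj_eq sign_swap_id)
qed

locale local_11_form =
  fixes S :: "(complex^3) set" and \<omega> :: "3 local_form" and h :: "3 \<Rightarrow> 3 \<Rightarrow> complex^3 \<Rightarrow> complex"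
  assumes open_S: "open S" and C2: "\<And>j k. Ck_on 2 S (h j k)"
    and form_eq: "\<And>x v w. x \<in> S \<Longrightarrow>
      \<omega> x [v, w] = (\<Sum>j\<in>UNIV. \<Sum>k\<in>UNIV. h j k x * (v $ j * cnj (w $ k) - w $ j * cnj (v $ k)))"
begin

abbreviation "Q x \<equiv> tensor4 (ddbar_coeff h x)"

lemma D01_form:
  assumes "x \<in> S"
  shows "D01 (\<lambda>y. \<omega> y [v, w]) x u = (\<Sum>c\<in>UNIV. \<Sum>d\<in>UNIV. \<Sum>b\<in>UNIV.
    D01 (h c d) x (axis b 1) * (cnj (u $ b) * (v $ c * cnj (w $ d) - w $ c * cnj (v $ d))))"
proof -
  note diff = Ck2_D(1)[OF C2 assms]
  have "D01 (\<lambda>y. \<omega> y [v, w]) x u =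
    D01 (\<lambda>y. \<Sum>j\<in>UNIV. \<Sum>k\<in>UNIV. h j k y * (v $ j * cnj (w $ k) - w $ j * cnj (v $ k))) x u"
    by (subst D01_cong_open[OF open_S assms form_eq]) simp_all
  also have "\<dots> = (\<Sum>c\<in>UNIV. \<Sum>d\<in>UNIV. D01 (h c d) x u * (v $ c * cnj (w $ d) - w $ c * cnj (v $ d)))"
    by (simp add: D01_sum D01_multc diff differentiable_mult)
  also have "\<dots> = (\<Sum>c\<in>UNIV. \<Sum>d\<in>UNIV. \<Sum>b\<in>UNIV.
    D01 (h c d) x (axis b 1) * (cnj (u $ b) * (v $ c * cnj (w $ d) - w $ c * cnj (v $ d))))"
    by (subst D01_expand[OF diff]) (simp add: sum_distrib_left sum_distrib_right mult_ac)
  finally show ?thesis .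
qed

lemma D01_form_differentiable:
  assumes "x \<in> S"
  shows "(\<lambda>y. D01 (\<lambda>z. \<omega> z [v, w]) y u) differentiable (at x)"
proof -
  have "(\<lambda>y. \<Sum>c\<in>UNIV. \<Sum>d\<in>UNIV. \<Sum>b\<in>UNIV.
    D01 (h c d) y (axis b 1) * (cnj (u $ b) * (v $ c * cnj (w $ d) - w $ c * cnj (v $ d)))) differentiable (at x)"
    by (intro differentiable_sum differentiable_mult differentiable_const Ck2_D01[OF C2 assms] ballI) simp_all
  then show ?thesis
    using has_derivative_transform_within_open[OF _ open_S assms] D01_form unfolding differentiable_def
    by (metis (no_types, lifting))
qed

lemma D10_D01_form:
  assumes "x \<in> S"
  shows "D10 (\<lambda>y. D01 (\<lambda>z. \<omega> z [v, w]) y u) x t = Q x t u v w - Q x t u w v"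
proof -
  note diff = Ck2_D01(1)[OF C2 assms]
  have "D10 (\<lambda>y. D01 (\<lambda>z. \<omega> z [v, w]) y u) x t = D10 (\<lambda>y. \<Sum>c\<in>UNIV. \<Sum>d\<in>UNIV. \<Sum>b\<in>UNIV.
    D01 (h c d) y (axis b 1) * (cnj (u $ b) * (v $ c * cnj (w $ d) - w $ c * cnj (v $ d)))) x t"
    by (subst D10_cong_open[OF open_S assms D01_form]) simp_all
  also have "\<dots> = (\<Sum>c\<in>UNIV. \<Sum>d\<in>UNIV. \<Sum>b\<in>UNIV.
     D10 (\<lambda>y. D01 (h c d) y (axis b 1)) x t * (cnj (u $ b) * (v $ c * cnj (w $ d) - w $ c * cnj (v $ d))))"
    by (simp add: D10_sum D10_multc diff differentiable_mult differentiable_sum)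
  also have "\<dots> = (\<Sum>c\<in>UNIV. \<Sum>d\<in>UNIV. \<Sum>b\<in>UNIV. \<Sum>a\<in>UNIV.
     ddbar_coeff h x a b c d * (t $ a * cnj (u $ b) * (v $ c * cnj (w $ d) - w $ c * cnj (v $ d))))"
    by (subst D10_expand[OF diff]) (simp add: ddbar_coeff_def sum_distrib_left sum_distrib_right mult_ac)
  also have "\<dots> = Q x t u v w - Q x t u w v"
    by (simp add: tensor4_def sum_3 algebra_simps)
  finally show ?thesis .
qed

text \<open>For x in \<open>S\<close> this is the derivative \<open>D10\<close> at x, in direction
  t, of the value of \<open>delbar \<omega>\<close> on (u, v, w).\<close>

definition nested :: "complex^3 \<Rightarrow> vec3 \<Rightarrow> vec3 \<Rightarrow> vec3 \<Rightarrow> vec3 \<Rightarrow> complex" where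
  "nested x t u v w = (Q x t u v w - Q x t u w v) - (Q x t v u w - Q x t v w u) + (Q x t w u v - Q x t w v u)"

lemma del_delbar_eq:
  assumes "x \<in> S"
  shows "del (delbar \<omega>) x [a, b, c, d] =
    nested x a b c d - nested x b a c d + nested x c a b d - nested x d a b c"
proof -
  have "delbar \<omega> y [u, v, w] = D01 (\<lambda>z. \<omega> z [v, w]) y u - D01 (\<lambda>z. \<omega> z [u, w]) y v + D01 (\<lambda>z. \<omega> z [u, v]) y w" for y u v w
    by (simp add: delbar_def lessThan_Suc numeral_3_eq_3 atLeast0LessThan[symmetric] eval_nat_numeral)
  then have "D10 (\<lambda>y. delbar \<omega> y [u, v, w]) x t = nested x t u v w" for t u v w
    using assms by (simp add: D10_add D10_diff D01_form_differentiable D10_D01_form nested_def differentiable_diff)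
  then show ?thesis
    by (simp add: del_def lessThan_Suc eval_nat_numeral)
qed

text \<open>There are four terms in \<open>del_delbar_eq\<close> and six in \<open>nested\<close>.
  Reordering the slots of any of them produces exactly its own sign, so under \<open>Alt6\<close>
  all 24 are equal.\<close>

lemma Alt6_del_delbar:
  assumes "x \<in> S"
  shows "Alt6 (\<lambda>a b c d e f. del (delbar \<omega>) x [a, b, c, d] * R e f) =
    24 * Alt6 (\<lambda>a b c d e f. Q x a b c d * R e f)"
proof -
  let ?N = "\<lambda>a b c d e f. nested x a b c d * R e f" and ?Q = "\<lambda>a b c d e f. Q x a b c d * R e f"
  have "Alt6 (\<lambda>a b c d e f. del (delbar \<omega>) x [a, b, c, d] * R e f) =
    Alt6 ?N - Alt6 (\<lambda>a b c d e f. nested x b a c d * R e f) +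
    Alt6 (\<lambda>a b c d e f. nested x c a b d * R e f) - Alt6 (\<lambda>a b c d e f. nested x d a b c * R e f)"
    by (simp only: del_delbar_eq[OF assms] distrib_right left_diff_distrib Alt6_linear(1,2))
  also have "\<dots> = 4 * Alt6 ?N"
    using Alt6_swap(1)[of ?N]
      Alt6_swap(2)[of "\<lambda>a b c d e f. nested x b a c d * R e f"]
      Alt6_swap(3)[of "\<lambda>a b c d e f. nested x c a b d * R e f"] by simp
  also have "Alt6 ?N = Alt6 ?Q - Alt6 (\<lambda>a b c d e f. Q x a b d c * R e f)
     - (Alt6 (\<lambda>a b c d e f. Q x a c b d * R e f) - Alt6 (\<lambda>a b c d e f. Q x a c d b * R e f))
     + (Alt6 (\<lambda>a b c d e f. Q x a d b c * R e f) - Alt6 (\<lambda>a b c d e f. Q x a d c b * R e f))"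
    by (simp only: nested_def distrib_right left_diff_distrib Alt6_linear(1,2))
  also have "\<dots> = 6 * Alt6 ?Q"
    using Alt6_swap(2)[of ?Q] Alt6_swap(3)[of ?Q]
      Alt6_swap(2)[of "\<lambda>a b c d e f. Q x a b d c * R e f"]
      Alt6_swap(3)[of "\<lambda>a b c d e f. Q x a c b d * R e f"]
      Alt6_swap(2)[of "\<lambda>a b c d e f. Q x a d b c * R e f"] by simp
  finally show ?thesis by simp
qed

text \<open>The covector here has coefficients y. The two factors i give -1; the 24 of
  \<open>Alt6_del_delbar\<close> and the two equal terms in the wedge of the covector with its
  conjugate cancel the 48; the remaining 8i is the constant of \<open>Alt6_coords\<close>.\<close>

lemma wedge_ddc:
  assumes "x \<in> S"
  shows "wedge 4 2 (\<lambda>vs. \<i> * del (delbar \<omega>) x vs)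
      (\<lambda>us. \<i> * wedge 1 1 (\<lambda>vs. \<Sum>r\<in>UNIV. hd vs $ r * y r) (\<lambda>vs. cnj (\<Sum>r\<in>UNIV. hd vs $ r * y r)) us) std_basis =
    - 8 * \<i> * alt3 (\<lambda>p q r. alt3 (\<lambda>s t u. ddbar_coeff h x p s q t * (y r * cnj (y u))))"
proof -
  let ?e = "\<lambda>v :: vec3. \<Sum>r\<in>UNIV. v $ r * y r"
  let ?D = "\<lambda>a b c d. del (delbar \<omega>) x [a, b, c, d]"
  have i_mult_i: "(\<i> * z) * (\<i> * w) = - 1 * (z * w)" for z w
    by (simp add: algebra_simps)
  have "wedge 4 2 (\<lambda>vs. \<i> * del (delbar \<omega>) x vs)
      (\<lambda>us. \<i> * wedge 1 1 (\<lambda>vs. ?e (hd vs)) (\<lambda>vs. cnj (?e (hd vs))) us) std_basis =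
    Alt6 (\<lambda>a b c d e f. - 1 * (?D a b c d * (?e e * cnj (?e f) - ?e f * cnj (?e e)))) / 48"
    unfolding wedge_4_2_eq_Alt6 wedge_1_1
    by (rule arg_cong[where f="\<lambda>G. Alt6 G / 48"]) (intro ext, simp only: list.sel, rule i_mult_i)
  also have "\<dots> = - Alt6 (\<lambda>a b c d e f. ?D a b c d * (?e e * cnj (?e f) - ?e f * cnj (?e e))) / 48"
    unfolding Alt6_linear by simp
  also have "Alt6 (\<lambda>a b c d e f. ?D a b c d * (?e e * cnj (?e f) - ?e f * cnj (?e e))) =
    24 * (Alt6 (\<lambda>a b c d e f. Q x a b c d * (?e e * cnj (?e f))) - Alt6 (\<lambda>a b c d e f. Q x a b c d * (?e f * cnj (?e e))))"
    unfolding Alt6_del_delbar[OF assms] right_diff_distrib Alt6_linear ..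
  also have "Alt6 (\<lambda>a b c d e f. Q x a b c d * (?e f * cnj (?e e))) = - Alt6 (\<lambda>a b c d e f. Q x a b c d * (?e e * cnj (?e f)))"
    by (rule Alt6_swap)
  also have "Alt6 (\<lambda>a b c d e f. Q x a b c d * (?e e * cnj (?e f))) =
     8 * \<i> * alt3 (\<lambda>p q r. alt3 (\<lambda>s t u. ddbar_coeff h x p s q t * (y r * cnj (y u))))"
    using Alt6_tensor4[of "ddbar_coeff h x" y "\<lambda>u. cnj (y u)"] by simp
  finally show ?thesis by simp
qed

text \<open>In dimension 3 a pair of distinct indices is determined by the index it omits. Taking
  the nine elementary matrices for \<open>g\<close> therefore isolates all nine coefficients
  antisymmetrised in both pairs, and \<open>del (delbar \<omega>)\<close> depends on these
  alone.\<close>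

lemma del_delbar_eq_0:
  assumes x: "x \<in> S" and 0: "\<And>g. alt3 (\<lambda>p q r. alt3 (\<lambda>s t u. ddbar_coeff h x p s q t * g r u)) = 0"
  shows "del (delbar \<omega>) x [a, b, c, d] = 0"
proof -
  let ?T = "ddbar_coeff h x"
  have zero: "?T p s q t - ?T q s p t - ?T p t q s + ?T q t p s = 0" for p q s t
  proof -
    have *: "alt3 (\<lambda>p q r. alt3 (\<lambda>s t u. ?T p s q t * of_bool (r = i \<and> u = j))) = 0" for i j by (rule 0)
    define R where "R p q s t = ?T p s q t - ?T q s p t - ?T p t q s + ?T q t p s" for p q s t
    have R_1: "R 2 3 2 3 = 0" "R 2 3 3 1 = 0" "R 2 3 1 2 = 0"
      subgoal using *[of 1 1] by (simp add: R_def alt3_def algebra_simps)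
      subgoal using *[of 1 2] by (simp add: R_def alt3_def algebra_simps)
      subgoal using *[of 1 3] by (simp add: R_def alt3_def algebra_simps)
      done
    have R_2: "R 3 1 2 3 = 0" "R 3 1 3 1 = 0" "R 3 1 1 2 = 0"
      subgoal using *[of 2 1] by (simp add: R_def alt3_def algebra_simps)
      subgoal using *[of 2 2] by (simp add: R_def alt3_def algebra_simps)
      subgoal using *[of 2 3] by (simp add: R_def alt3_def algebra_simps)
      done
    have R_3: "R 1 2 2 3 = 0" "R 1 2 3 1 = 0" "R 1 2 1 2 = 0"
      subgoal using *[of 3 1] by (simp add: R_def alt3_def algebra_simps)
      subgoal using *[of 3 2] by (simp add: R_def alt3_def algebra_simps)
      subgoal using *[of 3 3] by (simp add: R_def alt3_def algebra_simps)
      done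
    have R1: "R q p s t = - R p q s t" and R2: "R p q t s = - R p q s t" and R3: "R p p s t = 0" and R4: "R p q s s = 0" for p q s t
      by (simp_all add: R_def)
    have swap: "R 3 2 s t = - R 2 3 s t" "R 1 3 s t = - R 3 1 s t" "R 2 1 s t = - R 1 2 s t"
      "R p q 3 2 = - R p q 2 3" "R p q 1 3 = - R p q 3 1" "R p q 2 1 = - R p q 1 2" for p q s t
      using R1[of 3 2] R1[of 1 3] R1[of 2 1] R2[of p q 3 2] R2[of p q 1 3] R2[of p q 2 1] by simp_all
    have "R p q s t = 0"
      using UNIV_I[of p] UNIV_I[of q] UNIV_I[of s] UNIV_I[of t]
      unfolding UNIV_3 insert_iff empty_iff simp_thms by (elim disjE) (simp_all add: swap R_1 R_2 R_3 R3 R4)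
    then show ?thesis by (simp add: R_def)
  qed
  have sum_swap3: "(\<Sum>a\<in>A. \<Sum>b\<in>B. \<Sum>c\<in>C. F a b c) = (\<Sum>c\<in>C. \<Sum>b\<in>B. \<Sum>a\<in>A. F a b c)"
    for A B C :: "3 set" and F :: "3 \<Rightarrow> 3 \<Rightarrow> 3 \<Rightarrow> complex"
  proof -
    have "(\<Sum>a\<in>A. \<Sum>b\<in>B. \<Sum>c\<in>C. F a b c) = (\<Sum>b\<in>B. \<Sum>a\<in>A. \<Sum>c\<in>C. F a b c)" by (rule sum.swap)
    also have "\<dots> = (\<Sum>b\<in>B. \<Sum>c\<in>C. \<Sum>a\<in>A. F a b c)" by (rule sum.cong[OF refl], rule sum.swap)
    also have "\<dots> = (\<Sum>c\<in>C. \<Sum>b\<in>B. \<Sum>a\<in>A. F a b c)" by (rule sum.swap)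
    finally show ?thesis .
  qed
  have swap13: "tensor4 T v u t w = tensor4 (\<lambda>a b c d. T c b a d) t u v w" for T t u v w
    unfolding tensor4_def by (subst sum_swap3) (simp only: mult_ac)
  have swap24: "tensor4 T t w v u = tensor4 (\<lambda>a b c d. T a d c b) t u v w" for T t u v w
    unfolding tensor4_def by (rule sum.cong[OF refl], subst sum_swap3) (simp only: mult_ac)
  have "Q x t u v w - Q x v u t w - Q x t w v u + Q x v w t u =
      tensor4 (\<lambda>a b c d. ?T a b c d - ?T c b a d - ?T a d c b + ?T c d a b) t u v w" for t u v w
    unfolding swap13[of _ v] swap24[of _ t w]
    by (simp add: tensor4_def sum_subtractf sum.distrib left_diff_distrib distrib_right)
  \<comment> \<open>The vanishing antisymmetrised coefficients, contracted with four vectors. The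
    six instances used below correspond to the six choices of two holomorphic slots among a, b, c,
    d, and each removes four of the 24 terms.\<close>
  then have Q: "Q x t u v w = Q x v u t w + Q x t w v u - Q x v w t u" for t u v w
    by (simp add: zero tensor4_def) (simp add: algebra_simps)
  show ?thesis
    unfolding del_delbar_eq[OF x] nested_def
    by (simp add: Q[of a b c d] Q[of a c b d] Q[of a b d c] Q[of b a c d] Q[of b a d c] Q[of c a d b])
qed

end

section \<open>Positivity of forms\<close>

lemma mult_of_bool_if:
  "of_bool b * (z :: complex) = (if b then z else 0)" "z * of_bool b = (if b then z else 0)"
  by simp_all

text \<open>Gaussian elimination: splitting off the rank-one part of \<open>H\<close> through an
  index i leaves the Schur complement, which is supported on one index fewer. The rank-one part
  pairs with \<open>P\<close> to a value of the form of \<open>P\<close>, hence nonnegatively.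
  Positivity of \<open>H\<close> is asked on vectors supported in \<open>I\<close>, a condition that
  passes to the Schur complement.\<close>

lemma psd_pairing_nonneg_aux:
  fixes P H :: "'n::finite \<Rightarrow> 'n \<Rightarrow> complex"
  assumes P: "\<And>y. (\<Sum>r\<in>UNIV. \<Sum>u\<in>UNIV. P r u * (y r * cnj (y u))) \<in> \<real>\<^sub>\<ge>\<^sub>0"
    and "finite I" and "\<And>r u. H u r = cnj (H r u)" and "\<And>r u. r \<notin> I \<Longrightarrow> H r u = 0"
    and "\<And>v. \<exists>r\<in>I. v r \<noteq> 0 \<Longrightarrow> (\<And>r. r \<notin> I \<Longrightarrow> v r = 0) \<Longrightarrow>
      Re (\<Sum>r\<in>UNIV. \<Sum>u\<in>UNIV. H r u * (v r * cnj (v u))) > 0"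
  shows "(\<Sum>r\<in>UNIV. \<Sum>u\<in>UNIV. P r u * H r u) \<in> \<real>\<^sub>\<ge>\<^sub>0"
  using assms(2-)
proof (induction I arbitrary: H rule: finite_induct)
  case empty
  then show ?case by simp
next
  case (insert i I)
  note herm = insert.prems(1) and supp = insert.prems(2) and pos = insert.prems(3)
  have sum_delta: "(\<Sum>r\<in>UNIV. \<Sum>u\<in>UNIV. f r u * (of_bool (r = i) * of_bool (u = i))) = f i i"
    for f :: "'n \<Rightarrow> 'n \<Rightarrow> complex"
  proof -
    have "f r u * (of_bool (r = i) * of_bool (u = i)) = (if u = i then if r = i then f i i else 0 else 0)" for r u
      by simp
    then show ?thesis by simp
  qed
  define d where "d = Re (H i i)"
  have "d > 0"
  proof -
    have "Re (\<Sum>r\<in>UNIV. \<Sum>u\<in>UNIV. H r u * (of_bool (r = i) * cnj (of_bool (u = i)))) > 0"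
      by (rule pos) auto
    also have "(\<lambda>u. cnj (of_bool (u = i))) = (\<lambda>u. of_bool (u = i))" by auto
    finally show ?thesis by (simp only: sum_delta d_def)
  qed
  have Hii: "H i i = of_real d"
    using herm[of i i] by (simp add: complex_eq_iff d_def)
  define H' where "H' r u = H r u - H r i * H i u / of_real d" for r u
  define y where "y r = H r i / of_real (sqrt d)" for r
  have y: "y r * cnj (y u) = H r i * H i u / of_real d" for r u
    using \<open>d > 0\<close> herm[of i u] by (simp add: y_def flip: of_real_mult)
  have supp2: "H u r = 0" if "r \<notin> insert i I" for r u
    using supp[OF that, of u] herm[of r u] by simp
  have "(\<Sum>r\<in>UNIV. \<Sum>u\<in>UNIV. P r u * H' r u) \<in> \<real>\<^sub>\<ge>\<^sub>0"
  proof (rule insert.IH)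
    show "H' u r = cnj (H' r u)" for r u
      by (simp add: H'_def herm[of r u] herm[of i u] herm[of r i] mult.commute)
    show "H' r u = 0" if "r \<notin> I" for r u
      using that supp[of r u] supp[of r i] \<open>d > 0\<close> by (cases "r = i") (simp_all add: H'_def Hii)
    fix v :: "'n \<Rightarrow> complex"
    assume nz: "\<exists>r\<in>I. v r \<noteq> 0" and v0: "\<And>r. r \<notin> I \<Longrightarrow> v r = 0"
    define s where "s = (\<Sum>r\<in>UNIV. H r i * v r)"
    have cs: "(\<Sum>u\<in>UNIV. H i u * cnj (v u)) = cnj s"
      by (simp add: s_def herm[of _ i])
    \<comment> \<open>Completing the square: \<open>t\<close> is chosen so that the form of
      \<open>H\<close> at v - t e_i equals the form of the Schur complement \<open>H'\<close> at
      v.\<close>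
    define t where "t = s / of_real d"
    define w where "w r = v r - of_bool (r = i) * t" for r
    have "Re (\<Sum>r\<in>UNIV. \<Sum>u\<in>UNIV. H r u * (w r * cnj (w u))) > 0"
    proof (rule pos)
      show "\<exists>r\<in>insert i I. w r \<noteq> 0"
        using nz insert.hyps(2) by (auto simp: w_def)
      show "w r = 0" if "r \<notin> insert i I" for r using that v0 by (simp add: w_def)
    qed
    also have "(\<Sum>r\<in>UNIV. \<Sum>u\<in>UNIV. H r u * (w r * cnj (w u))) =
      (\<Sum>r\<in>UNIV. \<Sum>u\<in>UNIV. H r u * (v r * cnj (v u)))
      - t * (\<Sum>r\<in>UNIV. \<Sum>u\<in>UNIV. of_bool (r = i) * (H r u * cnj (v u)))
      - cnj t * (\<Sum>r\<in>UNIV. \<Sum>u\<in>UNIV. of_bool (u = i) * (H r u * v r))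
      + t * cnj t * (\<Sum>r\<in>UNIV. \<Sum>u\<in>UNIV. H r u * (of_bool (r = i) * of_bool (u = i)))"
      unfolding sum_distrib_left sum_subtractf[symmetric] sum.distrib[symmetric]
      by (intro sum.cong refl) (simp add: w_def algebra_simps)
    also have "(\<Sum>r\<in>UNIV. \<Sum>u\<in>UNIV. of_bool (r = i) * (H r u * cnj (v u))) = cnj s"
      unfolding cs[symmetric] sum_distrib_left[symmetric] by (simp add: mult_of_bool_if)
    also have "(\<Sum>r\<in>UNIV. \<Sum>u\<in>UNIV. of_bool (u = i) * (H r u * v r)) = s"
      by (simp add: s_def mult_of_bool_if)
    also have "(\<Sum>r\<in>UNIV. \<Sum>u\<in>UNIV. H r u * (of_bool (r = i) * of_bool (u = i))) = of_real d"
      by (simp add: sum_delta Hii)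
    also have "(\<Sum>r\<in>UNIV. \<Sum>u\<in>UNIV. H r u * (v r * cnj (v u))) - t * cnj s - cnj t * s + t * cnj t * of_real d =
      (\<Sum>r\<in>UNIV. \<Sum>u\<in>UNIV. H r u * (v r * cnj (v u))) - s * cnj s / of_real d"
      using \<open>d > 0\<close> by (simp add: t_def field_simps)
    also have "\<dots> = (\<Sum>r\<in>UNIV. \<Sum>u\<in>UNIV. H' r u * (v r * cnj (v u)))"
    proof -
      have "s * cnj s / of_real d = (\<Sum>r\<in>UNIV. \<Sum>u\<in>UNIV. H r i * H i u / of_real d * (v r * cnj (v u)))"
        unfolding cs[symmetric] unfolding s_def sum_product sum_divide_distrib by (simp add: mult_ac)
      then show ?thesis
        by (simp add: H'_def left_diff_distrib sum_subtractf)
    qed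
    finally show "Re (\<Sum>r\<in>UNIV. \<Sum>u\<in>UNIV. H' r u * (v r * cnj (v u))) > 0" .
  qed
  moreover have "(\<Sum>r\<in>UNIV. \<Sum>u\<in>UNIV. P r u * H r u) =
    (\<Sum>r\<in>UNIV. \<Sum>u\<in>UNIV. P r u * H' r u) + (\<Sum>r\<in>UNIV. \<Sum>u\<in>UNIV. P r u * (y r * cnj (y u)))"
    by (simp add: y H'_def right_diff_distrib sum_subtractf)
  ultimately show ?case using P[of y] by (simp add: nonneg_Reals_add_I)
qed

locale psd_pd_pairing =
  fixes P H :: "'n::finite \<Rightarrow> 'n \<Rightarrow> complex"
  assumes P: "\<And>y. (\<Sum>r\<in>UNIV. \<Sum>u\<in>UNIV. P r u * (y r * cnj (y u))) \<in> \<real>\<^sub>\<ge>\<^sub>0"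
    and hermitian: "\<And>r u. H u r = cnj (H r u)"
    and positive: "\<And>v. \<exists>r. v r \<noteq> 0 \<Longrightarrow> Re (\<Sum>r\<in>UNIV. \<Sum>u\<in>UNIV. H r u * (v r * cnj (v u))) > 0"
begin

lemma pairing_nonneg: "(\<Sum>r\<in>UNIV. \<Sum>u\<in>UNIV. P r u * H r u) \<in> \<real>\<^sub>\<ge>\<^sub>0"
proof (rule psd_pairing_nonneg_aux[of P UNIV H])
  show "H r u = cnj (H u r)" for r u by (rule hermitian)
qed (use P positive in auto)

text \<open>\<open>H - \<epsilon>\<close> is still positive definite for small \<open>\<epsilon> > 0\<close>, which bounds the trace of \<open>P\<close>.\<close>

lemma pairing_eq_0:
  assumes 0: "(\<Sum>r\<in>UNIV. \<Sum>u\<in>UNIV. P r u * H r u) = 0"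
  shows "P r u = 0"
proof -
  define f where "f v = Re (\<Sum>r\<in>UNIV. \<Sum>u\<in>UNIV. H r u * (v $ r * cnj (v $ u)))" for v :: "complex^'n"
  have "continuous_on (sphere 0 1) f"
    unfolding f_def by (intro continuous_intros)
  moreover have "sphere (0 :: complex^'n) 1 \<noteq> {}" by simp
  ultimately obtain v0 where v0: "norm v0 = 1" "\<And>v. norm v = 1 \<Longrightarrow> f v0 \<le> f v"
    using continuous_attains_inf[of "sphere (0 :: complex^'n) 1" f] by auto
  \<comment> \<open>Half the minimum of the form of \<open>H\<close> on the unit sphere, so that
    subtracting \<open>m\<close> times the identity leaves a strictly positive form.\<close>
  define m where "m = f v0 / 2"
  have "m > 0"
  proof -
    have "v0 \<noteq> 0" using v0(1) by auto
    then have "\<exists>r. v0 $ r \<noteq> 0" by (simp add: vec_eq_iff)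
    then show ?thesis unfolding m_def f_def by (simp only: half_gt_zero_iff positive)
  qed
  have scale: "f (c *\<^sub>R w) = c\<^sup>2 * f w" for c w
  proof -
    have "(\<Sum>r\<in>UNIV. \<Sum>u\<in>UNIV. H r u * ((c *\<^sub>R w) $ r * cnj ((c *\<^sub>R w) $ u))) =
      of_real (c\<^sup>2) * (\<Sum>r\<in>UNIV. \<Sum>u\<in>UNIV. H r u * (w $ r * cnj (w $ u)))"
      unfolding vector_scaleR_component unfolding scaleR_conv_of_real
      by (simp add: sum_distrib_left power2_eq_square mult_ac)
    then show ?thesis unfolding f_def by simp
  qed
  have "psd_pd_pairing P (\<lambda>r u. H r u - of_bool (r = u) * of_real m)"
  proof
    show "(\<Sum>r\<in>UNIV. \<Sum>u\<in>UNIV. P r u * (y r * cnj (y u))) \<in> \<real>\<^sub>\<ge>\<^sub>0" for y by (rule P)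
    show "H u r - of_bool (u = r) * of_real m = cnj (H r u - of_bool (r = u) * of_real m)" for r u
      by (subst hermitian, cases "r = u") simp_all
    fix v :: "'n \<Rightarrow> complex" assume v: "\<exists>r. v r \<noteq> 0"
    define w where "w = (\<chi> r. v r)"
    have "w \<noteq> 0" using v by (auto simp: w_def vec_eq_iff)
    have "f w = (norm w)\<^sup>2 * f (inverse (norm w) *\<^sub>R w)"
      using \<open>w \<noteq> 0\<close> by (simp add: scale power_inverse)
    also have "\<dots> \<ge> (norm w)\<^sup>2 * (2 * m)"
      using v0(2)[of "inverse (norm w) *\<^sub>R w"] \<open>w \<noteq> 0\<close> by (intro mult_left_mono) (simp_all add: m_def)
    finally have "f w \<ge> 2 * (m * (norm w)\<^sup>2)" by (simp add: mult_ac)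
    moreover have "m * (norm w)\<^sup>2 > 0" using \<open>w \<noteq> 0\<close> \<open>m > 0\<close> by simp
    ultimately have "f w > m * (norm w)\<^sup>2" by linarith
    moreover have "Re (\<Sum>r\<in>UNIV. \<Sum>u\<in>UNIV. (H r u - of_bool (r = u) * of_real m) * (v r * cnj (v u))) = f w - m * (norm w)\<^sup>2"
    proof -
      have "(\<Sum>r\<in>UNIV. \<Sum>u\<in>UNIV. of_bool (r = u) * of_real m * (v r * cnj (v u))) = (\<Sum>r\<in>UNIV. of_real m * (v r * cnj (v r)))"
      proof -
        have "of_bool (r = u) * of_real m * (v r * cnj (v u)) = (if u = r then of_real m * (v r * cnj (v r)) else 0)" for r u
          by auto
        then show ?thesis by (simp only: sum.delta finite_class.finite_UNIV UNIV_I if_True)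
      qed
      also have "\<dots> = of_real (m * (norm w)\<^sup>2)"
        by (simp add: norm_vec_def L2_set_def w_def sum_nonneg sum_distrib_left complex_norm_square flip: of_real_power)
      finally show ?thesis
        by (simp add: f_def w_def left_diff_distrib sum_subtractf)
    qed
    ultimately show "Re (\<Sum>r\<in>UNIV. \<Sum>u\<in>UNIV. (H r u - of_bool (r = u) * of_real m) * (v r * cnj (v u))) > 0" by simp
  qed
  then have "(\<Sum>r\<in>UNIV. \<Sum>u\<in>UNIV. P r u * (H r u - of_bool (r = u) * of_real m)) \<in> \<real>\<^sub>\<ge>\<^sub>0"
    by (rule psd_pd_pairing.pairing_nonneg)
  moreover have "(\<Sum>r\<in>UNIV. \<Sum>u\<in>UNIV. P r u * (H r u - of_bool (r = u) * of_real m)) = - (of_real m * (\<Sum>r\<in>UNIV. P r r))"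
  proof -
    have "P r u * (of_bool (r = u) * of_real m) = (if u = r then of_real m * P r r else 0)" for r u
      by auto
    then show ?thesis
      using 0 by (simp add: right_diff_distrib sum_subtractf sum_distrib_left)
  qed
  ultimately have trace: "m * Re (\<Sum>r\<in>UNIV. P r r) \<le> 0"
    by (simp add: complex_nonneg_Reals_iff)
  have ev: "a * cnj a * P r r + a * cnj b * P r u + b * cnj a * P u r + b * cnj b * P u u \<in> \<real>\<^sub>\<ge>\<^sub>0" for a b r u
  proof -
    have delta: "(\<Sum>p\<in>UNIV. \<Sum>q\<in>UNIV. P p q * ((of_bool (p = i) * z) * cnj (of_bool (q = j) * w))) = z * cnj w * P i j" for i j z w
    proof -
      have "P p q * ((of_bool (p = i) * z) * cnj (of_bool (q = j) * w)) = (if q = j then if p = i then z * cnj w * P i j else 0 else 0)" for p q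
        by auto
      then show ?thesis by simp
    qed
    have "(\<Sum>p\<in>UNIV. \<Sum>q\<in>UNIV. P p q * ((of_bool (p = r) * a + of_bool (p = u) * b) * cnj (of_bool (q = r) * a + of_bool (q = u) * b))) =
      a * cnj a * P r r + a * cnj b * P r u + b * cnj a * P u r + b * cnj b * P u u"
      unfolding complex_cnj_add distrib_left distrib_right sum.distrib delta by simp
    then show ?thesis using P[of "\<lambda>p. of_bool (p = r) * a + of_bool (p = u) * b"] by simp
  qed
  have diag: "Re (P r r) \<ge> 0" "Im (P r r) = 0" for r
    using ev[of 1 r 0 r] by (auto simp: complex_nonneg_Reals_iff)
  have "Re (\<Sum>r\<in>UNIV. P r r) = 0"
    using trace \<open>m > 0\<close> diag(1) by (simp add: mult_le_0_iff sum_nonneg order_antisym)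
  then have "Re (P r r) = 0" for r
    using diag(1) by (simp add: sum_nonneg_eq_0_iff)
  then have zero: "P r r = 0" for r
    using diag(2) by (simp add: complex_eq_iff)
  \<comment> \<open>With zero diagonal, the values of the form at e_r + b e_u for b and -b are
    opposite and both nonnegative, so they vanish; b = 1 and b = i then force both off-diagonal
    entries to be 0.\<close>
  show ?thesis
    using ev[of 1 r 1 u] ev[of 1 r "-1" u] ev[of 1 r \<i> u] ev[of 1 r "-\<i>" u]
    by (auto simp: zero complex_nonneg_Reals_iff complex_eq_iff)
qed

end

section \<open>Coefficients of (1,1)-forms\<close>

definition form_coeff :: "'n::finite covector \<Rightarrow> 'n \<Rightarrow> 'n \<Rightarrow> complex" where
  "form_coeff \<alpha> j k = (\<alpha> [axis j 1, axis k 1] + \<i> * \<alpha> [axis j 1, axis k \<i>]) / 2"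

text \<open>The value on (e_j, z e_k) is conj(z) H_jk - z H_kj; the combination of z = 1 and z = i
  in \<open>form_coeff\<close> cancels H_kj. Coefficients thus become functions of the form itself,
  in place of those that \<open>smooth_11_form_on\<close> asserts to exist.\<close>

lemma form_coeff_unique:
  fixes H :: "'n::finite \<Rightarrow> 'n \<Rightarrow> complex"
  assumes "\<And>v w. \<alpha> [v, w] = (\<Sum>j\<in>UNIV. \<Sum>k\<in>UNIV. H j k * (v $ j * cnj (w $ k) - w $ j * cnj (v $ k)))"
  shows "form_coeff \<alpha> j k = H j k" and "\<alpha> [axis j 1, axis k 1] = H j k - H k j"
proof -
  have *: "\<alpha> [axis j 1, axis k z] = cnj z * H j k - z * H k j" for z
  proof -
    have "(\<Sum>p\<in>UNIV. \<Sum>q\<in>UNIV. H p q * (axis r x $ p * cnj (axis s y $ q))) = x * cnj y * H r s" for r s x y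
    proof -
      have "H p q * (axis r x $ p * cnj (axis s y $ q)) = (if q = s then if p = r then x * cnj y * H r s else 0 else 0)" for p q
        by (auto simp: axis_def)
      then show ?thesis by simp
    qed
    then show ?thesis unfolding assms right_diff_distrib sum_subtractf by simp
  qed
  show "form_coeff \<alpha> j k = H j k" "\<alpha> [axis j 1, axis k 1] = H j k - H k j"
    by (simp_all add: form_coeff_def * algebra_simps)
qed

text \<open>A metric is i times its hermitian matrix, whence the factor -i in front of
  \<open>h\<close>. The form at (v, i v) is twice the quadratic form of that matrix at v.\<close>

lemma positive_form_coeff:
  fixes h :: "'n::finite \<Rightarrow> 'n \<Rightarrow> complex"
  assumes form: "\<And>v w. \<alpha> [v, w] = (\<Sum>j\<in>UNIV. \<Sum>k\<in>UNIV. h j k * (v $ j * cnj (w $ k) - w $ j * cnj (v $ k)))"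
    and real: "\<And>v w. \<alpha> [v, w] \<in> \<real>" and pos: "\<And>v. v \<noteq> 0 \<Longrightarrow> Re (\<alpha> [v, \<i> *s v]) > 0"
  shows "- \<i> * h k j = cnj (- \<i> * h j k)"
    and "\<exists>r. v r \<noteq> 0 \<Longrightarrow> Re (\<Sum>r\<in>UNIV. \<Sum>u\<in>UNIV. - \<i> * h r u * (v r * cnj (v u))) > 0"
proof -
  have "h j k + h k j = \<i> * \<alpha> [axis j 1, axis k \<i>]"
    using form_coeff_unique[of \<alpha> h j k, OF form] by (simp add: form_coeff_def field_simps)
  moreover have "h j k - h k j \<in> \<real>"
    using real[of "axis j 1" "axis k 1"] form_coeff_unique(2)[of \<alpha> h j k, OF form] by simp
  ultimately show "- \<i> * h k j = cnj (- \<i> * h j k)"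
    using real[of "axis j 1" "axis k \<i>"] by (simp add: complex_is_Real_iff complex_eq_iff)
  assume "\<exists>r. v r \<noteq> 0"
  define w where "w = (\<chi> r. v r)"
  have "w \<noteq> 0" using \<open>\<exists>r. v r \<noteq> 0\<close> by (auto simp: w_def vec_eq_iff)
  have "\<alpha> [w, \<i> *s w] = 2 * (\<Sum>r\<in>UNIV. \<Sum>u\<in>UNIV. - \<i> * h r u * (v r * cnj (v u)))"
    unfolding form sum_distrib_left by (intro sum.cong refl) (simp add: w_def)
  then show "Re (\<Sum>r\<in>UNIV. \<Sum>u\<in>UNIV. - \<i> * h r u * (v r * cnj (v u))) > 0"
    using pos[OF \<open>w \<noteq> 0\<close>] by simp
qed

text \<open>In coordinates, the density of \<open>\<Theta> \<and> \<omega>\<close> up to a constant, for a \<open>(2,2)\<close>-form \<open>\<Theta>\<close> with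
  coefficients \<open>T\<close> and a \<open>(1,1)\<close>-form \<open>\<omega>\<close> with coefficients \<open>g\<close>.\<close>

definition top_coeff :: "(3 \<Rightarrow> 3 \<Rightarrow> 3 \<Rightarrow> 3 \<Rightarrow> complex) \<Rightarrow> (3 \<Rightarrow> 3 \<Rightarrow> complex) \<Rightarrow> complex" where
  "top_coeff T g = alt3 (\<lambda>p q r. alt3 (\<lambda>s t u. T p s q t * g r u))"

lemma top_coeff_eq_sum:
  "top_coeff T g = (\<Sum>i\<in>UNIV. \<Sum>j\<in>UNIV. top_coeff T (\<lambda>r u. of_bool (r = i \<and> u = j)) * g i j)"
  by (simp add: top_coeff_def alt3_def sum_3 algebra_simps)

lemma top_coeff_uminus: "top_coeff (\<lambda>a b c d. - T a b c d) g = - top_coeff T g"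
  by (simp add: top_coeff_def alt3_linear)

text \<open>\<open>P\<close> is the hermitian form on covectors that tests the sign of
  \<open>\<Theta>\<close>, and its pairing with the positive definite matrix
  \<open>- \<i> * h\<close> is -8 times \<open>top_coeff T h\<close>; a vanishing product forces
  \<open>P\<close> to be 0 by \<open>pairing_eq_0\<close>. The formula for \<open>wedge\<close> is a
  hypothesis so that the lemma serves for \<open>ddc\<close> and for its negative.\<close>

lemma nonneg_22_top_coeff:
  assumes wedge: "\<And>y. wedge 4 2 \<Theta>
      (\<lambda>us. \<i> * wedge 1 1 (\<lambda>vs. \<Sum>r\<in>UNIV. hd vs $ r * y r) (\<lambda>vs. cnj (\<Sum>r\<in>UNIV. hd vs $ r * y r)) us) std_basis =
    - 8 * \<i> * top_coeff T (\<lambda>r u. y r * cnj (y u))"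
    and nonneg: "nonneg_22 \<Theta>"
    and form: "\<And>v w. \<alpha> [v, w] = (\<Sum>j\<in>UNIV. \<Sum>k\<in>UNIV. h j k * (v $ j * cnj (w $ k) - w $ j * cnj (v $ k)))"
    and real: "\<And>v w. \<alpha> [v, w] \<in> \<real>" and pos: "\<And>v. v \<noteq> 0 \<Longrightarrow> Re (\<alpha> [v, \<i> *s v]) > 0"
  shows "- top_coeff T h \<in> \<real>\<^sub>\<ge>\<^sub>0" and "top_coeff T h = 0 \<Longrightarrow> top_coeff T g = 0"
proof -
  define P where "P i j = - 8 * \<i> * top_coeff T (\<lambda>r u. of_bool (r = i \<and> u = j))" for i j
  have PT: "(\<Sum>i\<in>UNIV. \<Sum>j\<in>UNIV. P i j * g i j) = - 8 * \<i> * top_coeff T g" for g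
    unfolding P_def top_coeff_eq_sum[of T g] sum_distrib_left by (simp add: mult_ac)
  have linear: "Vector_Spaces.linear (*s) (*) (\<lambda>v :: complex^3. \<Sum>r\<in>UNIV. v $ r * y r)" for y
    by unfold_locales (simp_all add: algebra_simps sum.distrib sum_distrib_left)
  interpret psd_pd_pairing P "\<lambda>r u. - \<i> * h r u"
  proof
    show "(\<Sum>r\<in>UNIV. \<Sum>u\<in>UNIV. P r u * (y r * cnj (y u))) \<in> \<real>\<^sub>\<ge>\<^sub>0" for y
      unfolding PT wedge[symmetric]
      using nonneg[unfolded nonneg_22_def, rule_format, OF linear[of y]] by (simp only: std_basis_def)
  qed (rule positive_form_coeff[of \<alpha> h, OF form real pos]; assumption)+
  have eq: "(\<Sum>r\<in>UNIV. \<Sum>u\<in>UNIV. P r u * (- \<i> * h r u)) = - 8 * top_coeff T h"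
  proof -
    have "top_coeff T (\<lambda>r u. - \<i> * h r u) = - \<i> * top_coeff T h"
      by (simp add: top_coeff_def alt3_def algebra_simps)
    then show ?thesis unfolding PT by simp
  qed
  show "- top_coeff T h \<in> \<real>\<^sub>\<ge>\<^sub>0"
    using pairing_nonneg unfolding eq complex_nonneg_Reals_iff by simp
  assume "top_coeff T h = 0"
  then have "P i j = 0" for i j using pairing_eq_0 eq by simp
  then show "top_coeff T g = 0" using PT[of g] by simp
qed

section \<open>Regularity of complex differentiable functions\<close>

text \<open>Complex linearity of the derivative is recorded as commuting with i; real linearity
  comes with differentiability.\<close>

definition complex_differentiable_on :: "(complex^'n::finite) set \<Rightarrow> (complex^'n \<Rightarrow> complex) \<Rightarrow> bool" where
  "complex_differentiable_on S f \<longleftrightarrow> (\<forall>x\<in>S. f differentiable (at x) \<and>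
     (\<forall>v. frechet_derivative f (at x) (\<i> *s v) = \<i> * frechet_derivative f (at x) v))"

lemma complex_differentiable_on_scale:
  assumes "complex_differentiable_on S f" "x \<in> S"
  shows "frechet_derivative f (at x) (c *s v) = c * frechet_derivative f (at x) v"
proof (rule complex_linear_real)
  show "linear (frechet_derivative f (at x))"
    using assms by (intro linear_frechet_derivative) (simp add: complex_differentiable_on_def)
qed (use assms in \<open>simp add: complex_differentiable_on_def\<close>)

lemma bounded_linear_vector_scalar_mult: "bounded_linear (\<lambda>z. z *s (v :: complex^'n::finite))"
  by (rule linear_conv_bounded_linear[THEN iffD1], rule linearI)
    (simp_all add: vec_eq_iff algebra_simps)

lemma continuous_on_vector_scalar_mult:
  "continuous_on A g \<Longrightarrow> continuous_on A (\<lambda>x. g x *s (v :: complex^'n::finite))"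
  by (rule bounded_linear.continuous_on[OF bounded_linear_vector_scalar_mult])

text \<open>One-variable Cauchy formula for F(\<zeta>) = f(x + \<zeta> v), whose derivative at 0 is
  the derivative of f along v. The integrand contains values of f but no derivatives, so regularity
  in x can be read off from it.\<close>

lemma directional_Cauchy_formula:
  fixes f :: "complex^'n::finite \<Rightarrow> complex"
  assumes f: "complex_differentiable_on S f" and "r > 0"
    and disc: "\<And>\<zeta>. norm \<zeta> \<le> r \<Longrightarrow> x + \<zeta> *s v \<in> S"
  shows "((\<lambda>t. f (x + (of_real r * exp (2 * of_real pi * \<i> * of_real t)) *s v) / (of_real r * exp (2 * of_real pi * \<i> * of_real t)))
    has_integral frechet_derivative f (at x) v) {0..1}"
proof -
  define F where "F \<zeta> = f (x + \<zeta> *s v)" for \<zeta>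
  have F: "(F has_field_derivative frechet_derivative f (at (x + \<zeta> *s v)) v) (at \<zeta>)" if "norm \<zeta> \<le> r" for \<zeta>
  proof -
    have y: "x + \<zeta> *s v \<in> S" using disc[OF that] .
    have "((\<lambda>z. x + z *s v) has_derivative (\<lambda>z. z *s v)) (at \<zeta>)"
      using has_derivative_add[OF has_derivative_const bounded_linear_imp_has_derivative[OF bounded_linear_vector_scalar_mult], of x v]
      by simp
    moreover have "(f has_derivative frechet_derivative f (at (x + \<zeta> *s v))) (at (x + \<zeta> *s v))"
      using f y by (simp add: complex_differentiable_on_def differentiable_has_frechet)
    ultimately have "((\<lambda>z. f (x + z *s v)) has_derivative (\<lambda>z. frechet_derivative f (at (x + \<zeta> *s v)) (z *s v))) (at \<zeta>)"
      by (rule has_derivative_compose)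
    then show ?thesis
      unfolding has_field_derivative_def F_def[abs_def] complex_differentiable_on_scale[OF f y]
      by (simp add: mult_commute_abs)
  qed
  have cont: "continuous_on (cball 0 r) F"
    by (intro continuous_at_imp_continuous_on ballI DERIV_isCont[OF F]) simp
  have hol: "F holomorphic_on ball 0 r"
    unfolding holomorphic_on_open[OF open_ball]
  proof
    fix \<zeta> :: complex assume "\<zeta> \<in> ball 0 r"
    then have "norm \<zeta> \<le> r" by simp
    then show "\<exists>f'. (F has_field_derivative f') (at \<zeta>)"
      using F by blast
  qed
  have deriv: "deriv F 0 = frechet_derivative f (at x) v"
    using DERIV_imp_deriv[OF F[of 0]] \<open>r > 0\<close> by simp
  have "((\<lambda>u. F u / u\<^sup>2) has_contour_integral 2 * pi * \<i> * frechet_derivative f (at x) v) (circlepath 0 r)"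
    using Cauchy_has_contour_integral_higher_derivative_circlepath[OF cont hol, of 0 1] \<open>r > 0\<close> deriv
    by (simp add: numeral_2_eq_2)
  then have "((\<lambda>t. F (circlepath 0 r t) / (circlepath 0 r t)\<^sup>2 * (2 * pi * \<i> * r * exp (2 * of_real pi * \<i> * t)))
      has_integral 2 * pi * \<i> * frechet_derivative f (at x) v) {0..1}"
    unfolding has_contour_integral_def
    by (rule has_integral_eq[rotated]) (simp add: vector_derivative_circlepath01)
  from has_integral_mult_right[OF this, of "1 / (2 * pi * \<i>)"]
  have "((\<lambda>t. 1 / (2 * pi * \<i>) * (F (circlepath 0 r t) / (circlepath 0 r t)\<^sup>2 * (2 * pi * \<i> * r * exp (2 * of_real pi * \<i> * t))))
      has_integral frechet_derivative f (at x) v) {0..1}"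
    by simp
  moreover have "1 / (2 * pi * \<i>) * (F (circlepath 0 r t) / (circlepath 0 r t)\<^sup>2 * (2 * pi * \<i> * r * exp (2 * of_real pi * \<i> * t))) =
    f (x + (of_real r * exp (2 * of_real pi * \<i> * of_real t)) *s v) / (of_real r * exp (2 * of_real pi * \<i> * of_real t))" for t
  proof -
    have "1 / (2 * pi * \<i>) * (z / (of_real r * w)\<^sup>2 * (2 * pi * \<i> * r * w)) = z / (of_real r * w)" if "w \<noteq> 0" for z w
      using \<open>r > 0\<close> that by (simp add: power2_eq_square)
    then show ?thesis by (simp add: F_def circlepath)
  qed
  ultimately show ?thesis by simp
qed

lemma directional_Cauchy_formula_local:
  fixes f :: "complex^'n::finite \<Rightarrow> complex"
  assumes f: "complex_differentiable_on S f" and "open S" "x0 \<in> S"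
  obtains e r where "e > 0" "r > 0" "\<And>x \<zeta>. x \<in> ball x0 e \<Longrightarrow> norm \<zeta> \<le> r \<Longrightarrow> x + \<zeta> *s v \<in> S"
    "\<And>x. x \<in> ball x0 e \<Longrightarrow> frechet_derivative f (at x) v = integral (cbox 0 1)
      (\<lambda>t. f (x + (of_real r * exp (2 * of_real pi * \<i> * of_real t)) *s v) / (of_real r * exp (2 * of_real pi * \<i> * of_real t)))"
proof -
  obtain d where d: "d > 0" "ball x0 d \<subseteq> S"
    using \<open>open S\<close> \<open>x0 \<in> S\<close> by (auto simp: open_contains_ball)
  \<comment> \<open>The summand 1 keeps the denominator positive when v = 0; the radius serves all
    centres in the ball of half the size at once.\<close>
  define r where "r = d / (2 * (norm v + 1))"
  have "r > 0" using d(1) by (simp add: r_def add_nonneg_pos)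
  have norm: "norm (\<zeta> *s v) = norm \<zeta> * norm v" for \<zeta> :: complex
    by (simp add: norm_vec_def L2_set_def norm_mult power_mult_distrib real_sqrt_mult flip: sum_distrib_left)
  have in_S: "x + \<zeta> *s v \<in> S" if "x \<in> ball x0 (d/2)" "norm \<zeta> \<le> r" for x \<zeta>
  proof -
    have "norm \<zeta> * norm v \<le> r * (norm v + 1)"
      using that(2) \<open>r > 0\<close> by (intro mult_mono) auto
    also have "\<dots> = d / 2"
    proof -
      have "d / (2 * a) * a = d / 2" if "a \<noteq> 0" for a using that by simp
      moreover have "norm v + 1 \<noteq> 0" using norm_ge_zero[of v] by linarith
      ultimately show ?thesis unfolding r_def .
    qed
    finally have "norm (\<zeta> *s v) \<le> d/2" by (simp add: norm)
    then have "dist x0 (x + \<zeta> *s v) < d"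
      using that(1) dist_triangle[of x0 "x + \<zeta> *s v" x] by (simp add: dist_norm)
    then show ?thesis using d(2) by auto
  qed
  show ?thesis
  proof
    show "d/2 > 0" using d by simp
    show "frechet_derivative f (at x) v = integral (cbox 0 1)
      (\<lambda>t. f (x + (of_real r * exp (2 * of_real pi * \<i> * of_real t)) *s v) / (of_real r * exp (2 * of_real pi * \<i> * of_real t)))"
      if "x \<in> ball x0 (d/2)" for x
      using directional_Cauchy_formula[OF f \<open>r > 0\<close> in_S, OF that] by (simp add: integral_unique)
  qed (use \<open>r > 0\<close> in_S in auto)
qed

text \<open>The local Cauchy formula presents the derivative as the integral of a function that is
  jointly continuous in x and the angle.\<close>

lemma complex_differentiable_on_imp_continuous_derivative:
  fixes f :: "complex^'n::finite \<Rightarrow> complex"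
  assumes f: "complex_differentiable_on S f" and S: "open S"
  shows "continuous_on S (\<lambda>x. frechet_derivative f (at x) v)"
proof (rule continuous_at_imp_continuous_on, intro ballI)
  fix x0 assume "x0 \<in> S"
  have cont: "continuous_on S f"
    using f by (intro continuous_at_imp_continuous_on) (auto simp: complex_differentiable_on_def differentiable_imp_continuous_within)
  obtain e r where er: "e > 0" "r > 0" "\<And>x \<zeta>. x \<in> ball x0 e \<Longrightarrow> norm \<zeta> \<le> r \<Longrightarrow> x + \<zeta> *s v \<in> S"
    and eq: "\<And>x. x \<in> ball x0 e \<Longrightarrow> frechet_derivative f (at x) v = integral (cbox 0 1)
      (\<lambda>t. f (x + (of_real r * exp (2 * of_real pi * \<i> * of_real t)) *s v) / (of_real r * exp (2 * of_real pi * \<i> * of_real t)))"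
    by (rule directional_Cauchy_formula_local[OF f S \<open>x0 \<in> S\<close>]) blast
  have mem: "x + (of_real r * exp (2 * of_real pi * \<i> * of_real t)) *s v \<in> S" if "x \<in> ball x0 e" for x t
    using that er(2) by (intro er(3)) (auto simp: norm_mult)
  have "continuous_on (ball x0 e) (\<lambda>x. integral (cbox 0 1)
      (\<lambda>t. f (x + (of_real r * exp (2 * of_real pi * \<i> * of_real t)) *s v) / (of_real r * exp (2 * of_real pi * \<i> * of_real t))))"
  proof (rule integral_continuous_on_param, unfold case_prod_unfold)
    show "continuous_on (ball x0 e \<times> cbox 0 1) (\<lambda>p. f (fst p + (of_real r * exp (2 * of_real pi * \<i> * of_real (snd p))) *s v) /
       (of_real r * exp (2 * of_real pi * \<i> * of_real (snd p))))"
      by (intro continuous_on_divide continuous_on_compose2[OF cont] continuous_on_add continuous_on_vector_scalar_mult continuous_intros)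
        (use mem \<open>r > 0\<close> in auto)
  qed
  then have "continuous_on (ball x0 e) (\<lambda>x. frechet_derivative f (at x) v)"
    by (rule continuous_on_eq) (simp add: eq)
  then show "isCont (\<lambda>x. frechet_derivative f (at x) v) x0"
    using er(1) by (simp add: continuous_on_eq_continuous_at)
qed

text \<open>Differentiation under the Cauchy integral, whose integrand has a continuous derivative
  in x by the preceding lemma. The class is closed under directional derivatives, so the Jacobian
  entries of a transition map are themselves complex differentiable.\<close>

lemma complex_differentiable_on_derivative:
  fixes f :: "complex^'n::finite \<Rightarrow> complex"
  assumes f: "complex_differentiable_on S f" and S: "open S"
  shows "complex_differentiable_on S (\<lambda>x. frechet_derivative f (at x) v)"
  unfolding complex_differentiable_on_def
proof
  fix x0 assume "x0 \<in> S"
  have cont: "continuous_on S f"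
    using f by (intro continuous_at_imp_continuous_on) (auto simp: complex_differentiable_on_def differentiable_imp_continuous_within)
  obtain e r where er: "e > 0" "r > 0" "\<And>x \<zeta>. x \<in> ball x0 e \<Longrightarrow> norm \<zeta> \<le> r \<Longrightarrow> x + \<zeta> *s v \<in> S"
    and eq: "\<And>x. x \<in> ball x0 e \<Longrightarrow> frechet_derivative f (at x) v = integral (cbox 0 1)
      (\<lambda>t. f (x + (of_real r * exp (2 * of_real pi * \<i> * of_real t)) *s v) / (of_real r * exp (2 * of_real pi * \<i> * of_real t)))"
    by (rule directional_Cauchy_formula_local[OF f S \<open>x0 \<in> S\<close>]) blast
  define c where "c t = of_real r * exp (2 * of_real pi * \<i> * of_real t)" for t :: real
  have mem: "x + c t *s v \<in> S" if "x \<in> ball x0 e" for x t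
    using that er(2) unfolding c_def by (intro er(3)) (auto simp: norm_mult)
  have c: "c t \<noteq> 0" "continuous_on A c" for t A
    using er(2) by (auto simp: c_def[abs_def] intro!: continuous_intros)
  let ?L = "\<lambda>x t w. frechet_derivative f (at (x + c t *s v)) w / c t"
  have L: "((\<lambda>x. f (x + c t *s v) / c t) has_derivative ?L x t) (at x within U)" if "x \<in> ball x0 e" for x t U
  proof -
    have 1: "(f has_derivative frechet_derivative f (at (x + c t *s v))) (at (x + c t *s v))"
      using f mem[OF that] by (simp add: complex_differentiable_on_def differentiable_has_frechet)
    have 2: "((\<lambda>x. x + c t *s v) has_derivative (\<lambda>w. w)) (at x)"
      by (auto intro!: derivative_eq_intros)
    show ?thesis
      using bounded_linear.has_derivative[OF bounded_linear_divide has_derivative_compose[OF 2 1]]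
      by (rule has_derivative_at_withinI)
  qed
  have bl: "bounded_linear (?L x t)" if "x \<in> ball x0 e" for x t
    using L[OF that] by (rule has_derivative_bounded_linear)
  \<comment> \<open>In finite dimension, continuity of an operator-valued map may be checked vector
    by vector, in the form that the preceding lemma supplies.\<close>
  have contB: "continuous_on (ball x0 e \<times> cbox 0 1) (\<lambda>(x, t). Blinfun (?L x t))"
    proof (rule continuous_on_blinfun_componentwise)
      fix i :: "complex^'n"
      have "continuous_on (ball x0 e \<times> cbox 0 1) (\<lambda>p. ?L (fst p) (snd p) i)"
        by (intro continuous_on_divide continuous_on_compose2[OF complex_differentiable_on_imp_continuous_derivative[OF f S]]
             continuous_on_add continuous_on_vector_scalar_mult continuous_on_fst continuous_on_compose2[OF c(2)[of UNIV]]
             continuous_on_snd continuous_on_id)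
          (use mem c in auto)
      then show "continuous_on (ball x0 e \<times> cbox 0 1) (\<lambda>p. blinfun_apply (case p of (x, t) \<Rightarrow> Blinfun (?L x t)) i)"
        by (rule continuous_on_eq) (auto simp: bounded_linear_Blinfun_apply[OF bl])
    qed
  have "((\<lambda>x. integral (cbox 0 1) (\<lambda>t. f (x + c t *s v) / c t)) has_derivative
      integral (cbox 0 1) (\<lambda>t. Blinfun (?L x0 t))) (at x0 within ball x0 e)"
  proof (rule leibniz_rule[where fx = "\<lambda>x t. Blinfun (?L x t)"])
    show "((\<lambda>x. f (x + c t *s v) / c t) has_derivative blinfun_apply (Blinfun (?L x t))) (at x within ball x0 e)"
      if "x \<in> ball x0 e" for x t
      unfolding bounded_linear_Blinfun_apply[OF bl[OF that]] by (rule L[OF that])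
    show "(\<lambda>t. f (x + c t *s v) / c t) integrable_on cbox 0 1" if "x \<in> ball x0 e" for x
      by (intro integrable_continuous continuous_on_divide continuous_on_compose2[OF cont] continuous_on_add
           continuous_on_vector_scalar_mult continuous_on_const c(2))
        (use mem[OF that] c in auto)
    show "continuous_on (ball x0 e \<times> cbox 0 1) (\<lambda>(x, t). Blinfun (?L x t))" by (rule contB)
  qed (use er(1) in auto)
  then have "((\<lambda>x. integral (cbox 0 1) (\<lambda>t. f (x + c t *s v) / c t)) has_derivative
      integral (cbox 0 1) (\<lambda>t. Blinfun (?L x0 t))) (at x0)"
    using at_within_open[of x0 "ball x0 e"] er(1) by simp
  then have D: "((\<lambda>x. frechet_derivative f (at x) v) has_derivative
      integral (cbox 0 1) (\<lambda>t. Blinfun (?L x0 t))) (at x0)"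
  proof (rule has_derivative_transform_within_open[OF _ open_ball])
    show "integral (cbox 0 1) (\<lambda>t. f (x + c t *s v) / c t) = frechet_derivative f (at x) v" if "x \<in> ball x0 e" for x
      unfolding c_def eq[OF that] ..
  qed (use er(1) in simp)
  have "(\<lambda>t. Blinfun (?L x0 t)) integrable_on cbox 0 1"
  proof (rule integrable_continuous)
    have 1: "continuous_on (cbox 0 1) (\<lambda>t :: real. (x0, t))"
      by (intro continuous_on_Pair continuous_on_const continuous_on_id)
    have 2: "(\<lambda>t. (x0, t)) ` cbox 0 1 \<subseteq> ball x0 e \<times> cbox 0 (1 :: real)"
      using er(1) by auto
    from continuous_on_compose2[OF contB 1 2] show "continuous_on (cbox 0 1) (\<lambda>t. Blinfun (?L x0 t))"
      unfolding prod.case .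
  qed
  then have int: "integral (cbox 0 1) (\<lambda>t. Blinfun (?L x0 t)) w = integral (cbox 0 1) (\<lambda>t. ?L x0 t w)" for w
    using er(1) bounded_linear_Blinfun_apply[OF bl, of x0] by (simp only: blinfun_apply_integral centre_in_ball)
  have Li: "?L x0 t (\<i> *s w) = \<i> * ?L x0 t w" for t w
    using er(1) by (subst complex_differentiable_on_scale[OF f mem]) simp_all
  have "integral (cbox 0 1) (\<lambda>t. Blinfun (?L x0 t)) (\<i> *s w) = \<i> * integral (cbox 0 1) (\<lambda>t. Blinfun (?L x0 t)) w" for w
    unfolding int Li by (rule integral_mult_right)
  then show "(\<lambda>x. frechet_derivative f (at x) v) differentiable at x0 \<and>
    (\<forall>w. frechet_derivative (\<lambda>x. frechet_derivative f (at x) v) (at x0) (\<i> *s w) =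
      \<i> * frechet_derivative (\<lambda>x. frechet_derivative f (at x) v) (at x0) w)"
    unfolding frechet_derivative_at[OF D, symmetric] using differentiableI[OF D] by blast
qed

section \<open>Symmetry of second derivatives\<close>

lemma has_vector_derivative_line:
  fixes g :: "'a::real_normed_vector \<Rightarrow> 'b::real_normed_vector"
  assumes "g differentiable (at (y + s *\<^sub>R w))"
  shows "((\<lambda>s. g (y + s *\<^sub>R w)) has_vector_derivative frechet_derivative g (at (y + s *\<^sub>R w)) w) (at s within A)"
proof -
  have "((\<lambda>s. y + s *\<^sub>R w) has_derivative (\<lambda>h. h *\<^sub>R w)) (at s within A)"
    by (auto intro!: derivative_eq_intros)
  from has_derivative_compose[OF this differentiable_has_frechet[OF assms]]
  show ?thesis
    unfolding has_vector_derivative_def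
    by (simp add: linear_scale[OF linear_frechet_derivative[OF assms]])
qed

text \<open>Let K = D_u D_v f. The difference f(x + s u + t v) - f(x + s u) is the integral of D_v f
  along the segment in direction v; differentiating in s at 0 shows that D_u f(x + t v) - D_u f(x)
  is the integral of K(x + r v) over r in [0, t]. Differentiating this at t = 0 identifies K(x) with
  D_v D_u f(x).\<close>

lemma mixed_derivatives_commute:
  fixes f :: "'a::euclidean_space \<Rightarrow> 'b::euclidean_space"
  assumes S: "open S" and x: "x \<in> S"
    and f: "\<And>y. y \<in> S \<Longrightarrow> f differentiable (at y)"
    and u: "(\<lambda>y. frechet_derivative f (at y) u) differentiable (at x)"
    and v: "\<And>y. y \<in> S \<Longrightarrow> (\<lambda>y. frechet_derivative f (at y) v) differentiable (at y)"
    and cont: "continuous_on S (\<lambda>y. frechet_derivative (\<lambda>z. frechet_derivative f (at z) v) (at y) u)"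
  shows "frechet_derivative (\<lambda>y. frechet_derivative f (at y) v) (at x) u =
    frechet_derivative (\<lambda>y. frechet_derivative f (at y) u) (at x) v"
proof -
  define Gu where "Gu y = frechet_derivative f (at y) u" for y
  define Gv where "Gv y = frechet_derivative f (at y) v" for y
  define K where "K y = frechet_derivative Gv (at y) u" for y
  have contK: "continuous_on S K"
    using cont by (simp add: K_def[abs_def] Gv_def[abs_def])
  have Gv: "Gv differentiable (at y)" if "y \<in> S" for y
    using v[OF that] by (simp add: Gv_def[abs_def])
  note line = has_vector_derivative_line
  obtain e where e: "e > 0" "ball x e \<subseteq> S" using S x by (auto simp: open_contains_ball)
  \<comment> \<open>Small enough that the parallelogram spanned by multiples of u and v up to d
    stays in the ball, also when u = v = 0.\<close>
  define d where "d = e / (2 * (norm u + norm v + 1))"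
  have "norm u + norm v + 1 > 0" using norm_ge_zero[of u] norm_ge_zero[of v] by linarith
  then have "d > 0" using e by (simp add: d_def)
  have in_S: "x + s *\<^sub>R u + t *\<^sub>R v \<in> S" if "\<bar>s\<bar> \<le> d" "\<bar>t\<bar> \<le> d" for s t
  proof -
    have "norm (s *\<^sub>R u + t *\<^sub>R v) \<le> \<bar>s\<bar> * norm u + \<bar>t\<bar> * norm v"
      using norm_triangle_ineq[of "s *\<^sub>R u" "t *\<^sub>R v"] by simp
    also have "\<dots> \<le> d * norm u + d * norm v" using that by (intro add_mono mult_right_mono) auto
    also have "\<dots> < d * (2 * (norm u + norm v + 1))"
    proof -
      have "norm u + norm v < 2 * (norm u + norm v + 1)"
        using norm_ge_zero[of u] norm_ge_zero[of v] unfolding distrib_left by linarith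
      from mult_strict_left_mono[OF this \<open>d > 0\<close>] show ?thesis by (simp only: distrib_left)
    qed
    also have "\<dots> = e" using \<open>norm u + norm v + 1 > 0\<close> by (simp only: d_def) simp
    finally have "dist x (x + s *\<^sub>R u + t *\<^sub>R v) < e"
      using norm_minus_cancel[of "s *\<^sub>R u + t *\<^sub>R v"] by (simp add: dist_norm add.assoc)
    then show ?thesis using e by auto
  qed
  have int: "((\<lambda>t. Gv (x + s *\<^sub>R u + t *\<^sub>R v)) has_integral f (x + s *\<^sub>R u + t *\<^sub>R v) - f (x + s *\<^sub>R u)) {0..t}"
    if "\<bar>s\<bar> \<le> d" "0 \<le> t" "t \<le> d" for s t
    using fundamental_theorem_of_calculus[OF that(2), of "\<lambda>t. f (x + s *\<^sub>R u + t *\<^sub>R v)" "\<lambda>t. Gv (x + s *\<^sub>R u + t *\<^sub>R v)"]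
      line[of f "x + s *\<^sub>R u" _ v] f[OF in_S] that
    by (simp add: Gv_def)
  have contK2: "continuous_on ({- d..d} \<times> cbox 0 t) (\<lambda>(s, t). K (x + s *\<^sub>R u + t *\<^sub>R v))" if "t \<le> d" for t
    unfolding case_prod_unfold
    by (intro continuous_on_compose2[OF contK] continuous_intros) (use that in \<open>auto intro!: in_S\<close>)
  have main: "Gu (x + t *\<^sub>R v) - Gu x = integral {0..t} (\<lambda>t. K (x + t *\<^sub>R v))" if t: "0 \<le> t" "t \<le> d" for t
  proof -
    have "((\<lambda>s. integral (cbox 0 t) (\<lambda>t. Gv (x + s *\<^sub>R u + t *\<^sub>R v))) has_vector_derivative
       integral (cbox 0 t) (\<lambda>t. K (x + 0 *\<^sub>R u + t *\<^sub>R v))) (at 0 within {- d..d})"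
    proof (rule leibniz_rule_vector_derivative[where fx = "\<lambda>s t. K (x + s *\<^sub>R u + t *\<^sub>R v)"])
      fix s r assume sr: "s \<in> {- d..d}" "r \<in> cbox 0 t"
      have "(x + r *\<^sub>R v) + s *\<^sub>R u \<in> S"
      proof -
        have "\<bar>s\<bar> \<le> d" "\<bar>r\<bar> \<le> d" using sr t by auto
        from in_S[OF this] show ?thesis by (simp add: add_ac)
      qed
      from line[OF Gv[OF this]]
      show "((\<lambda>s. Gv (x + s *\<^sub>R u + r *\<^sub>R v)) has_vector_derivative K (x + s *\<^sub>R u + r *\<^sub>R v)) (at s within {- d..d})"
        by (simp add: K_def add_ac)
    next
      show "(\<lambda>r. Gv (x + s *\<^sub>R u + r *\<^sub>R v)) integrable_on cbox 0 t" if "s \<in> {- d..d}" for s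
        using has_integral_integrable[OF int[of s t]] that t by (simp add: abs_le_iff)
    qed (use contK2[OF t(2)] \<open>d > 0\<close> in auto)
    moreover have "((\<lambda>s. integral (cbox 0 t) (\<lambda>t. Gv (x + s *\<^sub>R u + t *\<^sub>R v))) has_vector_derivative
       Gu (x + t *\<^sub>R v) - Gu x) (at 0 within {- d..d})"
    proof (rule has_vector_derivative_transform)
      show "integral (cbox 0 t) (\<lambda>t. Gv (x + s *\<^sub>R u + t *\<^sub>R v)) = f ((x + t *\<^sub>R v) + s *\<^sub>R u) - f (x + s *\<^sub>R u)"
        if "s \<in> {- d..d}" for s
        using integral_unique[OF int[of s t]] that t by (simp add: abs_le_iff add_ac)
      show "((\<lambda>s. f ((x + t *\<^sub>R v) + s *\<^sub>R u) - f (x + s *\<^sub>R u)) has_vector_derivative Gu (x + t *\<^sub>R v) - Gu x) (at 0 within {- d..d})"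
        using has_vector_derivative_diff[OF line[of f "x + t *\<^sub>R v" 0 u] line[of f x 0 u]] f[OF in_S[of 0 t]] f[OF x] t \<open>d > 0\<close>
        by (simp add: Gu_def)
    qed (use \<open>d > 0\<close> in auto)
    moreover have "at 0 within {- d..d} \<noteq> bot"
      using \<open>d > 0\<close> by (simp add: trivial_limit_within islimpt_Icc)
    ultimately show ?thesis
      using vector_derivative_unique_within by fastforce
  qed
  have "((\<lambda>t. integral {0..t} (\<lambda>t. K (x + t *\<^sub>R v))) has_vector_derivative K (x + 0 *\<^sub>R v)) (at 0 within {0..d})"
    using \<open>d > 0\<close> in_S[of 0]
    by (intro integral_has_vector_derivative continuous_on_compose2[OF contK] continuous_intros) auto
  moreover have "((\<lambda>t. integral {0..t} (\<lambda>t. K (x + t *\<^sub>R v))) has_vector_derivative frechet_derivative Gu (at x) v) (at 0 within {0..d})"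
  proof (rule has_vector_derivative_transform)
    show "integral {0..t} (\<lambda>t. K (x + t *\<^sub>R v)) = Gu (x + t *\<^sub>R v) - Gu x" if "t \<in> {0..d}" for t
      using main[of t] that by simp
    have "Gu differentiable (at x)" using u by (simp add: Gu_def[abs_def])
    then show "((\<lambda>t. Gu (x + t *\<^sub>R v) - Gu x) has_vector_derivative frechet_derivative Gu (at x) v) (at 0 within {0..d})"
      using has_vector_derivative_diff[OF line[of Gu x 0 v] has_vector_derivative_const] by simp
  qed (use \<open>d > 0\<close> in auto)
  moreover have "at 0 within {0..d} \<noteq> bot"
    using \<open>d > 0\<close> by (simp add: trivial_limit_within islimpt_Icc)
  ultimately have "K x = frechet_derivative Gu (at x) v"
    using vector_derivative_unique_within by fastforce
  then show ?thesis by (simp add: K_def Gu_def[abs_def] Gv_def[abs_def])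
qed

section \<open>Integrals of compactly supported functions\<close>

definition compact_supp :: "('a::topological_space \<Rightarrow> 'b::zero) \<Rightarrow> bool" where
  "compact_supp f \<longleftrightarrow> (\<exists>K. compact K \<and> (\<forall>x. x \<notin> K \<longrightarrow> f x = 0))"

lemma compact_supp_cbox:
  fixes f :: "'a::euclidean_space \<Rightarrow> 'b::zero"
  assumes "compact_supp f"
  obtains a where "\<And>x. x \<notin> cbox (- a) a \<Longrightarrow> f x = 0"
proof -
  obtain K where K: "compact K" "\<And>x. x \<notin> K \<Longrightarrow> f x = 0"
    using assms by (auto simp: compact_supp_def)
  obtain a where "K \<subseteq> cbox (- a) a"
    using bounded_subset_cbox_symmetric[OF compact_imp_bounded[OF K(1)]] .
  then show ?thesis using that[of a] K(2) by blast
qed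

lemma has_integral_superset_cbox:
  fixes f :: "'a::euclidean_space \<Rightarrow> 'b::euclidean_space"
  assumes "continuous_on UNIV f" "\<And>x. x \<notin> cbox a b \<Longrightarrow> f x = 0"
  shows "(f has_integral integral (cbox a b) f) UNIV"
proof (rule has_integral_on_superset[OF integrable_integral])
  show "f integrable_on cbox a b"
    by (rule integrable_continuous) (rule continuous_on_subset[OF assms(1)], simp)
qed (use assms(2) in auto)

lemma absolutely_integrable_compact_supp:
  fixes f :: "'a::euclidean_space \<Rightarrow> 'b::euclidean_space"
  assumes "continuous_on UNIV f" "compact_supp f"
  shows "f absolutely_integrable_on UNIV"
proof -
  obtain a where a: "\<And>x. x \<notin> cbox (- a) a \<Longrightarrow> f x = 0"
    by (rule compact_supp_cbox[OF assms(2)]) blast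
  have "f absolutely_integrable_on cbox (- a) a"
    by (rule absolutely_integrable_continuous) (rule continuous_on_subset[OF assms(1)], simp)
  moreover have "(\<lambda>x. if x \<in> cbox (- a) a then f x else 0) = f"
    using a by auto
  ultimately show ?thesis
    using absolutely_integrable_restrict_UNIV[of "cbox (- a) a" f] by simp
qed

lemma integrable_compact_supp:
  fixes f :: "'a::euclidean_space \<Rightarrow> 'b::euclidean_space"
  assumes "continuous_on UNIV f" "compact_supp f"
  shows "f integrable_on UNIV"
  using absolutely_integrable_compact_supp[OF assms] by (simp add: absolutely_integrable_on_def)

lemma integral_translate_compact_supp:
  fixes f :: "'a::euclidean_space \<Rightarrow> 'b::euclidean_space"
  assumes f: "continuous_on UNIV f" "compact_supp f"
  shows "integral UNIV (\<lambda>x. f (x + c)) = integral UNIV f"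
proof -
  obtain a where a: "\<And>x. x \<notin> cbox (- a) a \<Longrightarrow> f x = 0"
    by (rule compact_supp_cbox[OF f(2)]) blast
  have "integral UNIV (\<lambda>x. f (x + c)) = integral (cbox (- a - c) (a - c)) (\<lambda>x. f (x + c))"
  proof (rule integral_unique, rule has_integral_superset_cbox)
    show "continuous_on UNIV (\<lambda>x. f (x + c))"
      by (intro continuous_on_compose2[OF f(1)] continuous_intros) auto
    show "f (x + c) = 0" if "x \<notin> cbox (- a - c) (a - c)" for x
      using that by (intro a) (auto simp: mem_box inner_simps algebra_simps)
  qed
  also have "\<dots> = integral (cbox (- a) a) f" by (rule integral_shift_cbox)
  also have "\<dots> = integral UNIV f"
    by (rule integral_unique[symmetric], rule has_integral_superset_cbox[OF f(1) a])
  finally show ?thesis .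
qed

text \<open>Write \<open>f (x + v) - f x\<close> as the integral of the derivative along the segment and integrate over
  \<open>x\<close>: by translation invariance every translate of the derivative has the same integral.\<close>

lemma integral_derivative_compact_supp:
  fixes f :: "'a::euclidean_space \<Rightarrow> 'b::euclidean_space"
  assumes f: "Ck_on 1 UNIV f" and supp: "compact_supp f"
  shows "integral UNIV (\<lambda>x. frechet_derivative f (at x) v) = 0"
proof -
  let ?g = "\<lambda>x. frechet_derivative f (at x) v"
  have diff: "f differentiable (at x)" for x using f by simp
  have cont_f: "continuous_on UNIV f"
    by (intro continuous_at_imp_continuous_on ballI differentiable_imp_continuous_within diff)
  have cont_g: "continuous_on UNIV ?g" using f by simp
  obtain K where K: "compact K" "\<And>x. x \<notin> K \<Longrightarrow> f x = 0"
    using supp by (auto simp: compact_supp_def)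
  have g0: "?g x = 0" if "x \<notin> K" for x
  proof -
    have "frechet_derivative f (at x) = frechet_derivative (\<lambda>y. 0) (at x)"
      using that K by (intro frechet_derivative_cong_open[of "- K"]) (auto intro: compact_imp_closed)
    then show ?thesis by (simp add: frechet_derivative_const)
  qed
  have supp_g: "compact_supp ?g" using K(1) g0 by (auto simp: compact_supp_def)
  define J where "J = integral UNIV ?g"
  \<comment> \<open>This image contains every point from which the segment in direction v meets
    \<open>K\<close>, so one box serves all translates by t v with t in [0, 1].\<close>
  have "compact ((\<lambda>(x, t). x - t *\<^sub>R v) ` (K \<times> {0..1}))"
    unfolding case_prod_unfold
    by (intro compact_continuous_image compact_Times K(1) continuous_intros) auto
  then obtain a where a: "(\<lambda>(x, t). x - t *\<^sub>R v) ` (K \<times> {0..1}) \<subseteq> cbox (- a) a"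
    by (rule bounded_subset_cbox_symmetric[OF compact_imp_bounded]) blast
  have outside: "x + t *\<^sub>R v \<notin> K" if "x \<notin> cbox (- a) a" "0 \<le> t" "t \<le> 1" for x t
  proof
    assume "x + t *\<^sub>R v \<in> K"
    then have "(\<lambda>(x, t). x - t *\<^sub>R v) (x + t *\<^sub>R v, t) \<in> cbox (- a) a"
      using that by (intro subsetD[OF a] imageI) simp
    then show False using that by simp
  qed
  have J: "integral (cbox (- a) a) (\<lambda>x. ?g (x + t *\<^sub>R v)) = J" if "t \<in> cbox 0 1" for t
  proof -
    have "(\<lambda>x. ?g (x + t *\<^sub>R v)) integrable_on cbox (- a) a"
      by (intro integrable_continuous continuous_on_compose2[OF cont_g] continuous_intros) auto
    moreover have "?g (x + t *\<^sub>R v) = 0" if "x \<notin> cbox (- a) a" for x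
      using g0[OF outside[OF that]] \<open>t \<in> cbox 0 1\<close> by simp
    ultimately have "((\<lambda>x. ?g (x + t *\<^sub>R v)) has_integral integral (cbox (- a) a) (\<lambda>x. ?g (x + t *\<^sub>R v))) UNIV"
      by (intro has_integral_on_superset[OF integrable_integral]) auto
    then show ?thesis
      using integral_translate_compact_supp[OF cont_g supp_g, of "t *\<^sub>R v"] by (simp add: J_def integral_unique)
  qed
  have 0: "integral (cbox (- a) a) f = integral UNIV f"
  proof (rule integral_unique[symmetric], rule has_integral_superset_cbox[OF cont_f])
    show "f x = 0" if "x \<notin> cbox (- a) a" for x
      using K(2)[OF outside[OF that, of 0]] K(2)[of x] by simp
  qed
  have 1: "integral (cbox (- a) a) (\<lambda>x. f (x + v)) = integral UNIV (\<lambda>x. f (x + v))"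
  proof (rule integral_unique[symmetric], rule has_integral_superset_cbox)
    show "continuous_on UNIV (\<lambda>x. f (x + v))"
      by (intro continuous_on_compose2[OF cont_f] continuous_intros) auto
    show "f (x + v) = 0" if "x \<notin> cbox (- a) a" for x
      using K(2)[OF outside[OF that, of 1]] by simp
  qed
  have "integral (cbox 0 1) (\<lambda>t. integral (cbox (- a) a) (\<lambda>x. ?g (x + t *\<^sub>R v))) =
    integral (cbox (- a) a) (\<lambda>x. integral (cbox 0 (1::real)) (\<lambda>t. ?g (x + t *\<^sub>R v)))"
    by (rule integral_swap_continuous, unfold case_prod_unfold)
      (intro continuous_on_compose2[OF cont_g] continuous_intros, auto)
  also have "\<dots> = integral (cbox (- a) a) (\<lambda>x. f (x + v) - f x)"
  proof (rule integral_cong)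
    fix x
    have "((\<lambda>t. ?g (x + t *\<^sub>R v)) has_integral f (x + 1 *\<^sub>R v) - f (x + 0 *\<^sub>R v)) {0..1}"
      by (rule fundamental_theorem_of_calculus) (auto intro: has_vector_derivative_line diff)
    then show "integral (cbox 0 1) (\<lambda>t. ?g (x + t *\<^sub>R v)) = f (x + v) - f x"
      by (simp add: integral_unique)
  qed
  also have "\<dots> = integral (cbox (- a) a) (\<lambda>x. f (x + v)) - integral (cbox (- a) a) f"
    by (intro integral_diff integrable_continuous continuous_on_compose2[OF cont_f] continuous_intros) auto
  also have "\<dots> = 0"
    using integral_translate_compact_supp[OF cont_f supp, of v] by (simp add: 0 1)
  finally have "integral (cbox 0 (1::real)) (\<lambda>t. J) = 0"
    using integral_cong[of "cbox 0 (1::real)", OF J] by simp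
  then show ?thesis by (simp add: J_def)
qed

lemma nonneg_integral_eq_0_compact_supp:
  fixes f :: "'a::euclidean_space \<Rightarrow> real"
  assumes f: "continuous_on UNIV f" "compact_supp f" and nonneg: "\<And>x. f x \<ge> 0" and 0: "integral UNIV f = 0"
  shows "f x = 0"
proof (rule ccontr)
  assume "f x \<noteq> 0"
  obtain K where K: "compact K" "\<And>x. x \<notin> K \<Longrightarrow> f x = 0"
    using f(2) by (auto simp: compact_supp_def)
  \<comment> \<open>Including x - One and x + One gives a box that contains x and has nonempty
    interior, as the vanishing criterion for the integral over a box demands.\<close>
  have "bounded (K \<union> {x - One, x, x + One})" using K(1) by (simp add: compact_imp_bounded)
  then obtain a where a: "K \<union> {x - One, x, x + One} \<subseteq> cbox (- a) a"
    using bounded_subset_cbox_symmetric by blast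
  have "integral (cbox (- a) a) f = 0"
    using integral_unique[OF has_integral_superset_cbox[OF f(1), of "- a" a]] a K(2) 0 by auto
  moreover have "(- a) \<bullet> i < a \<bullet> i" if "i \<in> Basis" for i
  proof -
    have "x - One \<in> cbox (- a) a" "x + One \<in> cbox (- a) a" using a by auto
    then have "(- a) \<bullet> i \<le> (x - One) \<bullet> i" "(x + One) \<bullet> i \<le> a \<bullet> i" using that by (auto simp: mem_box)
    then show ?thesis using that by (simp add: inner_simps)
  qed
  then have "box (- a) a \<noteq> {}" by (simp add: box_ne_empty)
  ultimately show False
    using integral_cbox_eq_0_iff[of "- a" a f] continuous_on_subset[OF f(1)] a nonneg \<open>f x \<noteq> 0\<close> by auto
qed

section \<open>Functions of class C^1 and C^2\<close>

lemma Ck_on_1: "Ck_on 1 S f \<longleftrightarrow> (\<forall>x\<in>S. f differentiable (at x)) \<and>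
     (\<forall>v. continuous_on S (\<lambda>x. frechet_derivative f (at x) v))"
  by simp

lemma Ck_on_1_imp_continuous_on: "Ck_on 1 S f \<Longrightarrow> continuous_on S f"
  by (intro continuous_at_imp_continuous_on ballI differentiable_imp_continuous_within) (simp add: Ck_on_1)

lemma Ck_on_cong:
  assumes "Ck_on k S f" "open S" "\<And>x. x \<in> S \<Longrightarrow> f x = g x"
  shows "Ck_on k S g"
  using assms(1,3)
proof (induction k arbitrary: f g)
  case 0
  then show ?case using continuous_on_cong[of S S f g] by simp
next
  case (Suc k)
  have "Ck_on k S (\<lambda>x. frechet_derivative g (at x) v)" for v
  proof (rule Suc.IH)
    show "Ck_on k S (\<lambda>x. frechet_derivative f (at x) v)"
      using Suc.prems(1) unfolding Ck_on.simps by blast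
    show "frechet_derivative f (at x) v = frechet_derivative g (at x) v" if "x \<in> S" for x
      using frechet_derivative_cong_open[of S x f g, OF assms(2) that Suc.prems(2)] by simp
  qed
  moreover have "g differentiable (at x)" if x: "x \<in> S" for x
  proof -
    obtain D where "(f has_derivative D) (at x)"
      using Suc.prems(1) x unfolding differentiable_def Ck_on.simps by blast
    then have "(g has_derivative D) (at x)"
      by (rule has_derivative_transform_within_open[OF _ assms(2) x Suc.prems(2)])
    then show ?thesis by (rule differentiableI)
  qed
  ultimately show ?case unfolding Ck_on.simps by blast
qed

lemma Ck_on_1_Un:
  assumes "Ck_on 1 S f" "Ck_on 1 T f" "open S" "open T"
  shows "Ck_on 1 (S \<union> T) f"
  using assms unfolding Ck_on_1 by (auto intro!: continuous_on_open_Un)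

lemma Ck_on_1_subset: "Ck_on 1 T f \<Longrightarrow> S \<subseteq> T \<Longrightarrow> Ck_on 1 S f"
  unfolding Ck_on_1 by (blast intro: continuous_on_subset)

lemma Ck_on_1_const: "Ck_on 1 S (\<lambda>x. c)"
  by (simp add: Ck_on_1)

lemma Ck_on_1_add:
  assumes "Ck_on 1 S f" "Ck_on 1 S g" shows "Ck_on 1 S (\<lambda>x. f x + g x)"
proof -
  have "frechet_derivative (\<lambda>x. f x + g x) (at x) v = frechet_derivative f (at x) v + frechet_derivative g (at x) v"
    if "x \<in> S" for x v
    using frechet_derivative_at[OF has_derivative_add[OF differentiable_has_frechet differentiable_has_frechet], of f x g] assms that
    by (simp add: Ck_on_1 fun_eq_iff)
  then show ?thesis
    using assms unfolding Ck_on_1 by (auto intro!: continuous_intros cong: continuous_on_cong)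
qed

lemma Ck_on_1_sum:
  assumes "\<And>i. i \<in> I \<Longrightarrow> Ck_on 1 S (f i)" shows "Ck_on 1 S (\<lambda>x. \<Sum>i\<in>I. f i x)"
  using assms
  by (induction I rule: infinite_finite_induct) (simp_all only: sum.infinite sum.empty sum.insert Ck_on_1_const Ck_on_1_add insert_iff simp_thms)

lemma Ck_on_1_mult:
  fixes f g :: "'a::euclidean_space \<Rightarrow> complex"
  assumes "Ck_on 1 S f" "Ck_on 1 S g" shows "Ck_on 1 S (\<lambda>x. f x * g x)"
proof -
  have "frechet_derivative (\<lambda>x. f x * g x) (at x) v = f x * frechet_derivative g (at x) v + frechet_derivative f (at x) v * g x"
    if "x \<in> S" for x v
    using frechet_derivative_at[OF has_derivative_mult[OF differentiable_has_frechet differentiable_has_frechet], of f x g] assms that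
    by (simp add: Ck_on_1 fun_eq_iff)
  then show ?thesis
    using assms Ck_on_1_imp_continuous_on[OF assms(1)] Ck_on_1_imp_continuous_on[OF assms(2)]
    unfolding Ck_on_1 by (auto intro!: continuous_intros cong: continuous_on_cong)
qed

lemma Ck_on_1_inverse:
  fixes f :: "'a::euclidean_space \<Rightarrow> complex"
  assumes "Ck_on 1 S f" "\<And>x. x \<in> S \<Longrightarrow> f x \<noteq> 0" shows "Ck_on 1 S (\<lambda>x. inverse (f x))"
proof -
  have D: "((\<lambda>x. inverse (f x)) has_derivative (\<lambda>v. - (inverse (f x) * frechet_derivative f (at x) v * inverse (f x)))) (at x)"
    if "x \<in> S" for x
    using assms that by (intro Deriv.has_derivative_inverse differentiable_has_frechet) (auto simp: Ck_on_1)
  have "frechet_derivative (\<lambda>x. inverse (f x)) (at x) v = - (inverse (f x) * frechet_derivative f (at x) v * inverse (f x))"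
    if "x \<in> S" for x v
    unfolding frechet_derivative_at[OF D[OF that], symmetric] ..
  then show ?thesis
    using assms D Ck_on_1_imp_continuous_on[OF assms(1)]
    unfolding Ck_on_1 by (auto intro!: continuous_intros differentiableI cong: continuous_on_cong)
qed

lemma Ck_on_2_imp_1: "Ck_on 2 S f \<Longrightarrow> Ck_on 1 S f"
  unfolding numeral_2_eq_2 Ck_on_1 by (auto intro!: continuous_at_imp_continuous_on differentiable_imp_continuous_within)

lemma Ck_on_1_D:
  fixes f :: "complex^'n::finite \<Rightarrow> complex"
  assumes "Ck_on 2 S f"
  shows "Ck_on 1 S (\<lambda>x. D01 f x v)" "Ck_on 1 S (\<lambda>x. D10 f x v)"
proof -
  have 1: "Ck_on 1 S (\<lambda>x. frechet_derivative f (at x) w)" for w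
    using assms by (simp add: numeral_2_eq_2)
  have "D01 f x v = frechet_derivative f (at x) v * (1/2) + frechet_derivative f (at x) (\<i> *s v) * (\<i>/2)"
    "D10 f x v = frechet_derivative f (at x) v * (1/2) + frechet_derivative f (at x) (\<i> *s v) * (- \<i>/2)" for x
    by (simp_all add: D01_def D10_def add_divide_distrib diff_divide_distrib)
  then show "Ck_on 1 S (\<lambda>x. D01 f x v)" "Ck_on 1 S (\<lambda>x. D10 f x v)"
    by (simp_all only:) (intro Ck_on_1_add Ck_on_1_mult Ck_on_1_const 1)+
qed

lemma continuous_on_D:
  fixes f :: "complex^'n::finite \<Rightarrow> complex"
  assumes "Ck_on 1 S f"
  shows "continuous_on S (\<lambda>x. D01 f x v)" "continuous_on S (\<lambda>x. D10 f x v)"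
  using assms unfolding D01_def D10_def Ck_on_1 by (auto intro!: continuous_intros)

text \<open>Both operators combine the derivatives along a vector and along i times it, which
  reduces the claim to the symmetry of four real second derivatives.\<close>

lemma D01_D10_commute:
  fixes f :: "complex^'n::finite \<Rightarrow> complex"
  assumes S: "open S" "x \<in> S" and f: "Ck_on 2 S f"
  shows "D10 (\<lambda>y. D01 f y v) x u = D01 (\<lambda>y. D10 f y u) x v"
proof -
  let ?D = "\<lambda>w y. frechet_derivative f (at y) w"
  have diff: "?D w differentiable (at y)" if "y \<in> S" for w y
    using Ck2_D(2)[OF f that] .
  have sym: "frechet_derivative (?D a) (at x) b = frechet_derivative (?D b) (at x) a" for a b
  proof (rule mixed_derivatives_commute[OF S])
    show "continuous_on S (\<lambda>y. frechet_derivative (?D a) (at y) b)"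
      using f by (simp add: numeral_2_eq_2)
  qed (use S diff Ck2_D(1)[OF f] in auto)
  have h: "(?D w has_derivative frechet_derivative (?D w) (at x)) (at x)" for w
    using differentiable_has_frechet[OF diff[OF S(2)]] .
  have 1: "((\<lambda>y. D01 f y v) has_derivative (\<lambda>b. (frechet_derivative (?D v) (at x) b + \<i> * frechet_derivative (?D (\<i> *s v)) (at x) b) / 2)) (at x)"
    unfolding D01_def divide_inverse
    by (rule has_derivative_mult_left[OF has_derivative_add[OF h has_derivative_mult_right[OF h]]])
  have 2: "((\<lambda>y. D10 f y u) has_derivative (\<lambda>b. (frechet_derivative (?D u) (at x) b - \<i> * frechet_derivative (?D (\<i> *s u)) (at x) b) / 2)) (at x)"
    unfolding D10_def divide_inverse
    by (rule has_derivative_mult_left[OF has_derivative_diff[OF h has_derivative_mult_right[OF h]]])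
  show ?thesis
    unfolding D10_has_derivative[OF 1] D01_has_derivative[OF 2] sym[of v] sym[of "\<i> *s v"]
    by (simp add: add_divide_distrib diff_divide_distrib algebra_simps)
qed

section \<open>Extension by zero\<close>

definition zero_ext :: "'a set \<Rightarrow> ('a \<Rightarrow> 'b::zero) \<Rightarrow> 'a \<Rightarrow> 'b" where
  "zero_ext S f x = (if x \<in> S then f x else 0)"

text \<open>The open sets \<open>S\<close> and \<open>- K\<close> cover the space. A function on
  \<open>S\<close> that vanishes off \<open>K\<close> extends by 0 to the second set, and regularity
  is glued from the two pieces.\<close>

locale compact_in_open =
  fixes S K :: "'a::euclidean_space set"
  assumes open_S: "open S" and compact_K: "compact K" and K_subset: "K \<subseteq> S"
begin

lemma UNIV_eq: "UNIV = S \<union> - K" using K_subset by auto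

lemma compact_supp_zero_ext:
  assumes "\<And>x. x \<in> S - K \<Longrightarrow> f x = 0"
  shows "compact_supp (zero_ext S f)"
  using compact_K assms unfolding compact_supp_def zero_ext_def by (intro exI[of _ K]) auto

lemma continuous_zero_ext:
  fixes f :: "'a \<Rightarrow> 'b::euclidean_space"
  assumes "continuous_on S f" "\<And>x. x \<in> S - K \<Longrightarrow> f x = 0"
  shows "continuous_on UNIV (zero_ext S f)"
proof -
  have "continuous_on S (zero_ext S f)"
    using assms(1) by (rule continuous_on_eq) (simp add: zero_ext_def)
  moreover have "continuous_on (- K) (zero_ext S f)"
    using continuous_on_const[of "- K" 0] by (rule continuous_on_eq) (use assms(2) in \<open>auto simp: zero_ext_def\<close>)
  ultimately show ?thesis
    unfolding UNIV_eq using compact_K open_S by (intro continuous_on_open_Un) (auto intro: compact_imp_closed)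
qed

lemma Ck_on_1_zero_ext:
  fixes f :: "'a \<Rightarrow> 'b::euclidean_space"
  assumes "Ck_on 1 S f" "\<And>x. x \<in> S - K \<Longrightarrow> f x = 0"
  shows "Ck_on 1 UNIV (zero_ext S f)"
proof -
  have "open (- K)" using compact_K by (auto intro: compact_imp_closed)
  have "Ck_on 1 S (zero_ext S f)"
    by (rule Ck_on_cong[OF assms(1) open_S]) (simp add: zero_ext_def)
  moreover have "Ck_on 1 (- K) (zero_ext S f)"
    by (rule Ck_on_cong[OF Ck_on_1_const[of _ 0] \<open>open (- K)\<close>]) (use assms(2) in \<open>auto simp: zero_ext_def\<close>)
  ultimately show ?thesis
    unfolding UNIV_eq using open_S \<open>open (- K)\<close> by (rule Ck_on_1_Un)
qed

lemma frechet_derivative_zero_ext: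
  fixes f :: "'a \<Rightarrow> 'b::euclidean_space"
  assumes "\<And>x. x \<in> S - K \<Longrightarrow> f x = 0"
  shows "frechet_derivative (zero_ext S f) (at x) v = zero_ext S (\<lambda>x. frechet_derivative f (at x) v) x"
proof (cases "x \<in> S")
  case True
  then show ?thesis
    using frechet_derivative_cong_open[OF open_S True, of "zero_ext S f" f] by (simp add: zero_ext_def)
next
  case False
  have "frechet_derivative (zero_ext S f) (at x) = frechet_derivative (\<lambda>y. 0) (at x)"
    using False compact_K K_subset assms
    by (intro frechet_derivative_cong_open[of "- K"]) (auto intro: compact_imp_closed simp: zero_ext_def)
  then show ?thesis using False by (simp add: zero_ext_def)
qed

end

section \<open>Integration over complex 3-space\<close>

lemma complex_coords_real_coords: "complex_coords (real_coords v) = v"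
proof -
  have "complex_coords (real_coords v) = (\<Sum>b\<in>Basis. (v \<bullet> b) *\<^sub>R b)"
    using sum.reindex_bij_betw[OF bij_betw_basis6, of "\<lambda>b. (v \<bullet> b) *\<^sub>R b"]
    by (simp add: complex_coords_def real_coords_def)
  then show ?thesis by (simp add: euclidean_representation)
qed

lemma linear_coords: "linear complex_coords" "linear real_coords"
  by (rule linearI; simp add: complex_coords_def real_coords_def algebra_simps sum.distrib scaleR_sum_right vec_eq_iff inner_simps)+

lemma real_coords_complex_coords: "real_coords (complex_coords u) = u"
proof -
  have "basis6 i \<bullet> basis6 j = (if i = j then 1 else 0)" for i j
    using bij_betwE[OF bij_betw_basis6] bij_betw_imp_inj_on[OF bij_betw_basis6]
    by (simp add: inner_Basis inj_eq)
  then show ?thesis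
    by (simp add: real_coords_def complex_coords_def vec_eq_iff inner_sum_left if_distrib[of "(*) _"] cong: if_cong)
qed

lemma bounded_linear_coords: "bounded_linear complex_coords" "bounded_linear real_coords"
  using linear_coords by (simp_all add: linear_conv_bounded_linear)

lemma continuous_on_coords: "continuous_on A complex_coords" "continuous_on B real_coords"
  using bounded_linear_coords by (simp_all add: linear_continuous_on)

definition cint :: "(complex^3 \<Rightarrow> 'b::euclidean_space) \<Rightarrow> 'b" where
  "cint F = integral UNIV (\<lambda>u. F (complex_coords u))"

definition test_fun :: "(complex^3 \<Rightarrow> 'b::euclidean_space) \<Rightarrow> bool" where
  "test_fun F \<longleftrightarrow> continuous_on UNIV F \<and> compact_supp F"

lemma compact_supp_complex_coords:
  fixes F :: "complex^3 \<Rightarrow> 'b::zero"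
  assumes "compact_supp F" shows "compact_supp (\<lambda>u. F (complex_coords u))"
proof -
  obtain K where K: "compact K" "\<And>x. x \<notin> K \<Longrightarrow> F x = 0"
    using assms by (auto simp: compact_supp_def)
  have "complex_coords u \<notin> K" if "u \<notin> real_coords ` K" for u
    using that real_coords_complex_coords by (metis image_eqI)
  then show ?thesis
    unfolding compact_supp_def
    using K by (intro exI[of _ "real_coords ` K"]) (auto intro: compact_continuous_image continuous_on_coords)
qed

lemma test_fun_complex_coords:
  fixes F :: "complex^3 \<Rightarrow> 'b::euclidean_space"
  assumes "test_fun F"
  shows "continuous_on UNIV (\<lambda>u. F (complex_coords u))" "compact_supp (\<lambda>u. F (complex_coords u))"
  using assms unfolding test_fun_def
  by (auto intro: compact_supp_complex_coords continuous_on_compose2[OF _ continuous_on_coords(1)])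

lemma cint_has_integral:
  fixes F :: "complex^3 \<Rightarrow> 'b::euclidean_space"
  assumes "test_fun F"
  shows "((\<lambda>u. F (complex_coords u)) has_integral cint F) UNIV"
  unfolding cint_def by (rule integrable_integral integrable_compact_supp test_fun_complex_coords assms)+

lemma test_fun_bounded_linear:
  assumes "test_fun F" "bounded_linear h" shows "test_fun (\<lambda>x. h (F x))"
  using assms bounded_linear.linear[OF assms(2), THEN linear_0] unfolding test_fun_def compact_supp_def
  by (auto intro: bounded_linear.continuous_on)

lemma cint_bounded_linear:
  assumes "test_fun F" "bounded_linear h" shows "cint (\<lambda>x. h (F x)) = h (cint F)"
  using has_integral_linear[OF cint_has_integral[OF assms(1)] assms(2)] by (simp add: cint_def integral_unique comp_def)

lemma test_fun_add:
  assumes "test_fun F" "test_fun G" shows "test_fun (\<lambda>x. F x + G x)"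
proof -
  obtain K L where "compact K" "\<And>x. x \<notin> K \<Longrightarrow> F x = 0" "compact L" "\<And>x. x \<notin> L \<Longrightarrow> G x = 0"
    using assms by (auto simp: test_fun_def compact_supp_def)
  then have "compact_supp (\<lambda>x. F x + G x)"
    unfolding compact_supp_def by (intro exI[of _ "K \<union> L"]) auto
  then show ?thesis using assms by (auto simp: test_fun_def intro: continuous_on_add)
qed

lemma cint_add:
  assumes "test_fun F" "test_fun G" shows "cint (\<lambda>x. F x + G x) = cint F + cint G"
  using has_integral_add[OF cint_has_integral[OF assms(1)] cint_has_integral[OF assms(2)]]
  by (simp add: cint_def integral_unique)

lemma test_fun_0: "test_fun (\<lambda>x. 0)"
  by (auto simp: test_fun_def compact_supp_def)

lemma test_fun_sum:
  assumes "\<And>i. i \<in> I \<Longrightarrow> test_fun (F i)" shows "test_fun (\<lambda>x. \<Sum>i\<in>I. F i x)"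
  using assms by (induction I rule: infinite_finite_induct) (simp_all add: test_fun_0 test_fun_add)

lemma cint_sum:
  assumes "\<And>i. i \<in> I \<Longrightarrow> test_fun (F i)" shows "cint (\<lambda>x. \<Sum>i\<in>I. F i x) = (\<Sum>i\<in>I. cint (F i))"
  using assms
proof (induction I rule: infinite_finite_induct)
  case (insert i I)
  then have "cint (\<lambda>x. F i x + (\<Sum>i\<in>I. F i x)) = cint (F i) + cint (\<lambda>x. \<Sum>i\<in>I. F i x)"
    by (intro cint_add test_fun_sum) auto
  then show ?case using insert by simp
qed (simp_all add: cint_def)

lemma cint_derivative:
  fixes F :: "complex^3 \<Rightarrow> 'b::euclidean_space"
  assumes F: "Ck_on 1 UNIV F" and supp: "compact_supp F"
  shows "cint (\<lambda>x. frechet_derivative F (at x) v) = 0" "test_fun (\<lambda>x. frechet_derivative F (at x) v)"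
proof -
  let ?G = "\<lambda>u. F (complex_coords u)"
  have D: "(?G has_derivative (\<lambda>w. frechet_derivative F (at (complex_coords u)) (complex_coords w))) (at u)" for u
    using F by (intro has_derivative_compose[OF bounded_linear_imp_has_derivative[OF bounded_linear_coords(1)]]
      differentiable_has_frechet) (simp add: Ck_on_1)
  have eq: "frechet_derivative ?G (at u) w = frechet_derivative F (at (complex_coords u)) (complex_coords w)" for u w
    using frechet_derivative_at[OF D, of u] by (metis)
  have "Ck_on 1 UNIV ?G"
    unfolding Ck_on_1 eq using F D
    by (auto simp: Ck_on_1 intro!: differentiableI continuous_on_compose2[OF _ continuous_on_coords(1), of UNIV])
  from integral_derivative_compact_supp[OF this compact_supp_complex_coords[OF supp], of "real_coords v"]
  show "cint (\<lambda>x. frechet_derivative F (at x) v) = 0"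
    unfolding cint_def eq complex_coords_real_coords .
  obtain K where K: "compact K" "\<And>x. x \<notin> K \<Longrightarrow> F x = 0"
    using supp by (auto simp: compact_supp_def)
  have "frechet_derivative F (at x) v = 0" if "x \<notin> K" for x
    using frechet_derivative_cong_open[of "- K" x F "\<lambda>y. 0"] that K(2) compact_imp_closed[OF K(1)]
    by (simp add: open_Compl)
  then show "test_fun (\<lambda>x. frechet_derivative F (at x) v)"
    using F K(1) by (auto simp: test_fun_def Ck_on_1 compact_supp_def)
qed

lemma cint_D10_D01:
  fixes F :: "complex^3 \<Rightarrow> complex"
  assumes "Ck_on 1 UNIV F" "compact_supp F"
  shows "cint (\<lambda>x. D10 F x v) = 0" "cint (\<lambda>x. D01 F x v) = 0"
    "test_fun (\<lambda>x. D10 F x v)" "test_fun (\<lambda>x. D01 F x v)"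
proof -
  note D = cint_derivative[OF assms]
  have eq: "D10 F x v = frechet_derivative F (at x) v * (1/2) + frechet_derivative F (at x) (\<i> *s v) * (- \<i>/2)"
    "D01 F x v = frechet_derivative F (at x) v * (1/2) + frechet_derivative F (at x) (\<i> *s v) * (\<i>/2)" for x
    by (simp_all add: D01_def D10_def add_divide_distrib diff_divide_distrib)
  have c: "test_fun (\<lambda>x. frechet_derivative F (at x) w * c)" "cint (\<lambda>x. frechet_derivative F (at x) w * c) = 0" for w c
    using test_fun_bounded_linear[OF D(2) bounded_linear_mult_left[of c]]
      cint_bounded_linear[OF D(2) bounded_linear_mult_left[of c]] D(1) by simp_all
  show "cint (\<lambda>x. D10 F x v) = 0" "cint (\<lambda>x. D01 F x v) = 0"
    "test_fun (\<lambda>x. D10 F x v)" "test_fun (\<lambda>x. D01 F x v)"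
    unfolding eq by (simp_all only: cint_add test_fun_add c add_0)
qed

lemma cint_nonneg_eq_0:
  fixes F :: "complex^3 \<Rightarrow> real"
  assumes "test_fun F" "\<And>x. F x \<ge> 0" "cint F = 0"
  shows "F x = 0"
  using nonneg_integral_eq_0_compact_supp[OF test_fun_complex_coords[OF assms(1)], of "real_coords x"] assms(2,3)
  by (simp add: cint_def complex_coords_real_coords)

lemma cint_nonneg:
  fixes F :: "complex^3 \<Rightarrow> real"
  assumes "test_fun F" "\<And>x. F x \<ge> 0" shows "cint F \<ge> 0"
  using has_integral_nonneg[OF cint_has_integral[OF assms(1)]] assms(2) by simp

lemma cint_change_of_variables:
  fixes F :: "complex^3 \<Rightarrow> real" and M :: "complex^3 \<Rightarrow> complex^3^3"
  assumes U: "open U" and inj: "inj_on g U"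
    and der: "\<And>x. x \<in> U \<Longrightarrow> (g has_derivative (*v) (M x)) (at x)"
    and F: "test_fun F" and supp: "\<And>y. y \<notin> g ` U \<Longrightarrow> F y = 0"
  shows "cint (zero_ext U (\<lambda>x. (cmod (det (M x)))\<^sup>2 * F (g x))) = cint F"
proof -
  define S where "S = complex_coords -` U"
  define g' where "g' = real_coords \<circ> g \<circ> complex_coords"
  \<comment> \<open>The change of variables theorem is applied to a map between real vector types,
    hence the values in \<open>real^1\<close>. Complex densities later pass through it by their real
    parts.\<close>
  define f :: "real^6 \<Rightarrow> real^1" where "f u = vec (F (complex_coords u))" for u
  define D where "D u = real_coords \<circ> (*v) (M (complex_coords u)) \<circ> complex_coords" for u
  have "open S"
    unfolding S_def using open_vimage[OF U] continuous_on_coords(1) by blast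
  have D: "(g' has_derivative D u) (at u within S)" if "u \<in> S" for u
  proof -
    have "(g has_derivative (*v) (M (complex_coords u))) (at (complex_coords u))"
      using that by (intro der) (simp add: S_def)
    from has_derivative_compose[OF bounded_linear_imp_has_derivative[OF bounded_linear_coords(1)] this]
    have "((\<lambda>u. g (complex_coords u)) has_derivative (\<lambda>w. M (complex_coords u) *v complex_coords w)) (at u)" .
    from bounded_linear.has_derivative[OF bounded_linear_coords(2) this]
    show ?thesis unfolding g'_def D_def comp_def by (rule has_derivative_at_withinI)
  qed
  have det: "\<bar>det (matrix (D u))\<bar> = (cmod (det (M (complex_coords u))))\<^sup>2" for u
  proof -
    have "complex_of_real (det (matrix (D u))) = of_real ((cmod (det (M (complex_coords u))))\<^sup>2)"
      unfolding D_def det_real_coords_complex_linear complex_norm_square by simp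
    then show ?thesis unfolding of_real_eq_iff by simp
  qed
  have inj': "inj_on g' S"
  proof (rule inj_onI)
    fix u w assume uw: "u \<in> S" "w \<in> S" "g' u = g' w"
    then have "complex_coords (g' u) = complex_coords (g' w)" by simp
    then have "g (complex_coords u) = g (complex_coords w)" by (simp add: g'_def complex_coords_real_coords)
    then have "complex_coords u = complex_coords w" using inj uw by (auto simp: S_def inj_on_def)
    then show "u = w" by (metis real_coords_complex_coords)
  qed
  have f0: "f u = 0" if "u \<notin> g' ` S" for u
  proof -
    have "complex_coords u \<notin> g ` U"
    proof
      assume "complex_coords u \<in> g ` U"
      then obtain x where x: "x \<in> U" "complex_coords u = g x" by auto
      then have "u = g' (real_coords x)" by (metis comp_apply complex_coords_real_coords g'_def real_coords_complex_coords)
      moreover have "real_coords x \<in> S" using x by (simp add: S_def complex_coords_real_coords)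
      ultimately show False using that by blast
    qed
    then show ?thesis by (simp add: f_def supp vec_eq_iff)
  qed
  then have f_eq: "(\<lambda>u. if u \<in> g' ` S then f u else 0) = f" by auto
  have "(\<lambda>u. F (complex_coords u)) absolutely_integrable_on UNIV"
    by (rule absolutely_integrable_compact_supp test_fun_complex_coords F)+
  then have "f absolutely_integrable_on UNIV"
    by (simp add: absolutely_integrable_on_1_iff f_def)
  then have abs: "f absolutely_integrable_on (g' ` S)"
    using absolutely_integrable_restrict_UNIV[of "g' ` S" f] unfolding f_eq by simp
  have "integral (g' ` S) f = integral UNIV f"
    using integral_restrict_UNIV[of "g' ` S" f] unfolding f_eq by simp
  then have "integral S (\<lambda>u. \<bar>det (matrix (D u))\<bar> *\<^sub>R f (g' u)) = integral UNIV f"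
    using has_absolute_integral_change_of_variables[OF _ D inj', of f "integral UNIV f"] abs \<open>open S\<close>
    by (simp add: lebesgue_openin)
  then have "integral S (\<lambda>u. \<bar>det (matrix (D u))\<bar> * F (g (complex_coords u))) = integral UNIV (\<lambda>u. F (complex_coords u))"
    by (simp add: integral_on_1_eq f_def g'_def complex_coords_real_coords vec_eq_iff)
  moreover have "integral S (\<lambda>u. \<bar>det (matrix (D u))\<bar> * F (g (complex_coords u))) =
    cint (zero_ext U (\<lambda>x. (cmod (det (M x)))\<^sup>2 * F (g x)))"
    unfolding det cint_def zero_ext_def integral_restrict_UNIV[of S, symmetric] by (simp add: S_def)
  ultimately show ?thesis by (simp add: cint_def)
qed

section \<open>Partitions of unity\<close>

lemma holomorphic_map_on_component:
  assumes "holomorphic_map_on S \<phi>"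
  shows "complex_differentiable_on S (\<lambda>x. \<phi> x $ p)"
  unfolding complex_differentiable_on_def
proof
  fix x assume "x \<in> S"
  then obtain L where L: "(\<phi> has_derivative L) (at x)" "Vector_Spaces.linear (*s) (*s) L"
    using assms unfolding holomorphic_map_on_def by blast
  have D: "((\<lambda>x. \<phi> x $ p) has_derivative (\<lambda>v. L v $ p)) (at x)"
    by (rule bounded_linear.has_derivative[OF bounded_linear_vec_nth L(1)])
  have "L (\<i> *s v) = \<i> *s L v" for v
    using L(2) by (simp add: Vector_Spaces.linear_iff)
  then show "(\<lambda>x. \<phi> x $ p) differentiable at x \<and> (\<forall>v. frechet_derivative (\<lambda>x. \<phi> x $ p) (at x) (\<i> *s v) =
      \<i> * frechet_derivative (\<lambda>x. \<phi> x $ p) (at x) v)"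
    unfolding frechet_derivative_at[OF D, symmetric] using differentiableI[OF D] by simp
qed

definition jacobian :: "(complex^'n::finite \<Rightarrow> complex^'m) \<Rightarrow> complex^'n \<Rightarrow> complex^'n^'m" where
  "jacobian \<phi> x = (\<chi> p a. frechet_derivative (\<lambda>x. \<phi> x $ p) (at x) (axis a 1))"

lemma holomorphic_map_on_has_derivative:
  fixes \<phi> :: "complex^'n::finite \<Rightarrow> complex^'m::finite"
  assumes "holomorphic_map_on S \<phi>" "x \<in> S"
  shows "(\<phi> has_derivative (*v) (jacobian \<phi> x)) (at x)"
proof -
  obtain L where L: "(\<phi> has_derivative L) (at x)" "Vector_Spaces.linear (*s) (*s) L"
    using assms unfolding holomorphic_map_on_def by blast
  have "L v $ p = (jacobian \<phi> x *v v) $ p" for v p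
  proof -
    have D: "((\<lambda>x. \<phi> x $ p) has_derivative (\<lambda>v. L v $ p)) (at x)"
      by (rule bounded_linear.has_derivative[OF bounded_linear_vec_nth L(1)])
    have "linear (\<lambda>v. L v $ p)"
      using has_derivative_linear[OF D] .
    moreover have "L (\<i> *s v) $ p = \<i> * L v $ p" for v
      using L(2) by (simp add: Vector_Spaces.linear_iff)
    ultimately have "L v $ p = (\<Sum>j\<in>UNIV. v $ j * L (axis j 1) $ p)"
      by (rule complex_linear_expand)
    then show ?thesis
      by (simp add: jacobian_def matrix_vector_mult_def frechet_derivative_at[OF D, symmetric] mult.commute)
  qed
  then have "L = (*v) (jacobian \<phi> x)" by (simp add: fun_eq_iff vec_eq_iff)
  then show ?thesis using L(1) by simp
qed

lemma has_derivative_max_0_power2: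
  "((\<lambda>s. (max 0 s)\<^sup>2) has_field_derivative 2 * max 0 s) (at (s :: real))"
proof (cases s "0 :: real" rule: linorder_cases)
  case less
  have "((\<lambda>s. 0) has_field_derivative 0) (at s)" by simp
  then have "((\<lambda>s. (max 0 s)\<^sup>2) has_field_derivative 0) (at s)"
    by (rule has_field_derivative_transform_within_open[of _ _ _ "{..<0}"]) (use less in auto)
  then show ?thesis using less by simp
next
  case equal
  have "((\<lambda>y :: real. max 0 y) \<longlongrightarrow> max 0 0) (at 0)"
    by (intro tendsto_intros)
  moreover have "\<forall>\<^sub>F y in at (0::real). max 0 y = ((max 0 y)\<^sup>2 - (max 0 0)\<^sup>2) / (y - 0)"
    by (auto simp: eventually_at_filter max_def power2_eq_square)
  ultimately have "((\<lambda>y. ((max 0 y)\<^sup>2 - (max 0 0)\<^sup>2) / (y - 0)) \<longlongrightarrow> 0) (at (0::real))"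
    by (auto intro: Lim_transform_eventually)
  then show ?thesis using equal by (simp add: has_field_derivative_iff)
next
  case greater
  have "((\<lambda>s. s\<^sup>2) has_field_derivative 2 * s) (at s)"
    by (auto intro!: derivative_eq_intros)
  then have "((\<lambda>s. (max 0 s)\<^sup>2) has_field_derivative 2 * s) (at s)"
    by (rule has_field_derivative_transform_within_open[of _ _ _ "{0<..}"]) (use greater in auto)
  then show ?thesis using greater by simp
qed

text \<open>Squaring the positive part makes the function C^1, and for r > 0 it is nonzero exactly
  on the open ball. It is complex-valued because it multiplies complex densities.\<close>

definition bump :: "'a::euclidean_space \<Rightarrow> real \<Rightarrow> 'a \<Rightarrow> complex" where
  "bump z r x = of_real ((max 0 (r\<^sup>2 - (x - z) \<bullet> (x - z)))\<^sup>2)"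

lemma bump_nonneg: "bump z r x \<in> \<real>\<^sub>\<ge>\<^sub>0"
  by (simp add: bump_def)

lemma bump_nonzero_iff: "r > 0 \<Longrightarrow> bump z r x \<noteq> 0 \<longleftrightarrow> x \<in> ball z r"
proof -
  assume "r > 0"
  have "bump z r x \<noteq> 0 \<longleftrightarrow> (norm (x - z))\<^sup>2 < r\<^sup>2"
    by (auto simp: bump_def max_def power2_norm_eq_inner)
  also have "\<dots> \<longleftrightarrow> norm (x - z) < r"
    using power_less_imp_less_base[of "norm (x - z)" 2 r] power_strict_mono[of "norm (x - z)" r 2] \<open>r > 0\<close>
    by auto
  finally show ?thesis by (simp add: dist_norm norm_minus_commute)
qed

lemma Ck_on_1_bump_compose:
  fixes \<phi> :: "'a::euclidean_space \<Rightarrow> 'b::euclidean_space"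
  assumes der: "\<And>x. x \<in> S \<Longrightarrow> (\<phi> has_derivative D x) (at x)"
    and cont: "\<And>v. continuous_on S (\<lambda>x. D x v)"
  shows "Ck_on 1 S (\<lambda>x. bump z r (\<phi> x))"
proof -
  let ?D = "\<lambda>x v. complex_of_real (2 * max 0 (r\<^sup>2 - (\<phi> x - z) \<bullet> (\<phi> x - z)) * (- 2 * ((\<phi> x - z) \<bullet> D x v)))"
  have "((\<lambda>x. bump z r (\<phi> x)) has_derivative ?D x) (at x)" if "x \<in> S" for x
  proof -
    have "((\<lambda>x. r\<^sup>2 - (\<phi> x - z) \<bullet> (\<phi> x - z)) has_derivative (\<lambda>v. - 2 * ((\<phi> x - z) \<bullet> D x v))) (at x)"
      by (auto intro!: derivative_eq_intros der[OF that] simp: inner_commute)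
    from has_derivative_compose[OF this has_derivative_max_0_power2[unfolded has_field_derivative_def]]
    have "((\<lambda>x. (max 0 (r\<^sup>2 - (\<phi> x - z) \<bullet> (\<phi> x - z)))\<^sup>2) has_derivative
      (\<lambda>v. 2 * max 0 (r\<^sup>2 - (\<phi> x - z) \<bullet> (\<phi> x - z)) * (- 2 * ((\<phi> x - z) \<bullet> D x v)))) (at x)" .
    from bounded_linear.has_derivative[OF bounded_linear_of_real this] show ?thesis unfolding bump_def .
  qed
  note D = this
  have "continuous_on S \<phi>"
    using der by (intro continuous_at_imp_continuous_on ballI has_derivative_continuous) auto
  then have cD: "continuous_on S (\<lambda>x. ?D x v)" for v
    by (intro continuous_intros cont)
  have "frechet_derivative (\<lambda>x. bump z r (\<phi> x)) (at x) v = ?D x v" if "x \<in> S" for x v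
    unfolding frechet_derivative_at[OF D[OF that], symmetric] ..
  then have "continuous_on S (\<lambda>x. frechet_derivative (\<lambda>x. bump z r (\<phi> x)) (at x) v)" for v
    using cD[of v] by (simp cong: continuous_on_cong)
  then show ?thesis unfolding Ck_on_1 using D differentiableI by blast
qed

section \<open>Functions on a compact complex manifold\<close>

locale compact_complex_manifold =
  fixes X :: "'a topology" and A :: "('a, 'n::finite) chart set"
  assumes manifold: "complex_manifold X A" and compact: "compact_space X"
begin

abbreviation "param c \<equiv> inv_into (fst c) (snd c)"

definition C1_fun :: "('a \<Rightarrow> complex) \<Rightarrow> bool" where
  "C1_fun \<theta> \<longleftrightarrow> (\<forall>c\<in>A. Ck_on 1 (chart_image c) (\<lambda>x. \<theta> (param c x)))"

text \<open>\<open>K\<close> is a set in coordinate space because the extension by zero and the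
  integrals take place there.\<close>

definition supported_in :: "('a, 'n) chart \<Rightarrow> ('a \<Rightarrow> complex) \<Rightarrow> (complex^'n) set \<Rightarrow> bool" where
  "supported_in c \<theta> K \<longleftrightarrow> compact K \<and> K \<subseteq> chart_image c \<and> (\<forall>q\<in>topspace X. \<theta> q \<noteq> 0 \<longrightarrow> q \<in> fst c \<and> snd c q \<in> K)"

lemma Hausdorff: "Hausdorff_space X"
  using manifold by (simp add: complex_manifold_def)

lemma charts_cover: "q \<in> topspace X \<Longrightarrow> \<exists>c\<in>A. q \<in> fst c"
  using manifold unfolding complex_manifold_def by auto

context
  fixes c assumes c: "c \<in> A"
begin

lemma openin_chart: "openin X (fst c)" and open_chart_image: "open (chart_image c)"
  and homeo_chart: "homeomorphic_map (subtopology X (fst c)) (top_of_set (chart_image c)) (snd c)"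
  using manifold c unfolding complex_manifold_def by auto

lemma chart_subset: "fst c \<subseteq> topspace X"
  using openin_chart by (rule openin_subset)

lemma inj_on_chart: "inj_on (snd c) (fst c)"
  using homeomorphic_imp_injective_map[OF homeo_chart] chart_subset
  by (simp add: Int_absorb1)

lemma param_chart [simp]: "q \<in> fst c \<Longrightarrow> param c (snd c q) = q"
  using inj_on_chart by (rule inv_into_f_f)

lemma chart_param [simp]: "x \<in> chart_image c \<Longrightarrow> snd c (param c x) = x"
  and param_in_chart [simp]: "x \<in> chart_image c \<Longrightarrow> param c x \<in> fst c"
  unfolding chart_image_def by (simp_all add: f_inv_into_f inv_into_into)

lemma open_chart_openin:
  assumes "openin X V" shows "open (snd c ` (fst c \<inter> V))"
proof -
  have "openin (subtopology X (fst c)) (fst c \<inter> V)"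
    using assms by (simp add: openin_subtopology_Int2)
  then have "openin (top_of_set (chart_image c)) (snd c ` (fst c \<inter> V))"
    using homeomorphic_imp_open_map[OF homeo_chart] by (simp add: open_map_def)
  then show ?thesis using open_chart_image openin_open_trans by blast
qed

text \<open>A compact set is closed since the space is Hausdorff. This is what allows a function
  given in one chart to be extended by zero with its regularity intact in all other charts.\<close>

lemma closedin_param_image:
  assumes "compact K" "K \<subseteq> chart_image c" shows "closedin X (param c ` K)"
proof -
  obtain g where g: "homeomorphic_maps (subtopology X (fst c)) (top_of_set (chart_image c)) (snd c) g"
    using homeo_chart by (auto simp: homeomorphic_map_maps)
  then have cont: "continuous_map (top_of_set (chart_image c)) (subtopology X (fst c)) g"
    by (simp add: homeomorphic_maps_def)
  have "g x = param c x" if "x \<in> chart_image c" for x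
  proof -
    have "g x \<in> fst c" "snd c (g x) = x"
      using g that cont chart_subset unfolding homeomorphic_maps_def continuous_map_def by auto
    then show ?thesis using param_chart by metis
  qed
  then have "g ` K = param c ` K" using assms(2) by (intro image_cong) auto
  moreover have "compactin (top_of_set (chart_image c)) K"
    using assms by (simp add: compactin_subtopology)
  then have "compactin (subtopology X (fst c)) (g ` K)"
    using cont by (rule image_compactin)
  ultimately have "compactin X (param c ` K)" by (simp add: compactin_subtopology)
  then show ?thesis using Hausdorff by (intro compactin_imp_closedin)
qed

context
  fixes d assumes d: "d \<in> A"
begin

lemma open_overlap: "open (overlap_image c d)"
proof -
  have "openin X (fst d)" using manifold d unfolding complex_manifold_def by auto
  then show ?thesis unfolding overlap_image_def by (rule open_chart_openin)
qed

lemma overlap_subset: "overlap_image c d \<subseteq> chart_image c"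
  unfolding overlap_image_def chart_image_def by auto

lemma holomorphic_transition: "holomorphic_map_on (overlap_image c d) (transition c d)"
  using manifold c d unfolding complex_manifold_def by auto

lemma in_overlap_iff: "x \<in> overlap_image c d \<longleftrightarrow> x \<in> chart_image c \<and> param c x \<in> fst d"
proof
  assume "x \<in> chart_image c \<and> param c x \<in> fst d"
  then show "x \<in> overlap_image c d"
    unfolding overlap_image_def using chart_param[of x] param_in_chart[of x] by (metis IntI image_eqI)
qed (auto simp: overlap_image_def chart_image_def)

end

end

lemma transition_overlap:
  assumes c: "c \<in> A" and d: "d \<in> A" and x: "x \<in> overlap_image c d"
  shows "transition c d x \<in> overlap_image d c" "param d (transition c d x) = param c x"
    "transition d c (transition c d x) = x"
proof -
  have x': "x \<in> chart_image c" "param c x \<in> fst d"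
    using in_overlap_iff[OF c d] x by auto
  show *: "param d (transition c d x) = param c x"
    using x' by (simp add: transition_def param_chart[OF d])
  have "transition c d x \<in> chart_image d"
    using x' by (simp add: transition_def chart_image_def)
  then show "transition c d x \<in> overlap_image d c"
    using * x' by (simp add: in_overlap_iff[OF d c] param_in_chart[OF c])
  show "transition d c (transition c d x) = x"
    using * x' chart_param[OF c] by (simp add: transition_def)
qed

lemma continuous_on_jacobian:
  fixes \<phi> :: "complex^'m::finite \<Rightarrow> complex^'k::finite"
  assumes "open S" "holomorphic_map_on S \<phi>"
  shows "continuous_on S (\<lambda>x. jacobian \<phi> x *v v)"
  unfolding matrix_vector_mult_def jacobian_def
  by (intro continuous_on_vec_lambda continuous_intros)
    (simp_all add: complex_differentiable_on_imp_continuous_derivative[OF holomorphic_map_on_component[OF assms(2)] assms(1)])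

text \<open>A bump in the coordinates of c, extended by zero. The image of another chart d is
  covered by two open sets: the overlap with c, where the function is a bump composed with a
  transition map, and the complement of the closed set \<open>C\<close>, where it is 0.\<close>

lemma bump_function:
  assumes c: "c \<in> A" and p: "p \<in> fst c"
  obtains \<psi> K where "C1_fun \<psi>" "supported_in c \<psi> K" "\<And>q. \<psi> q \<in> \<real>\<^sub>\<ge>\<^sub>0" "\<psi> p \<noteq> 0" "openin X {q \<in> topspace X. \<psi> q \<noteq> 0}"
proof -
  define z where "z = snd c p"
  have "z \<in> chart_image c" using p by (simp add: z_def chart_image_def)
  then obtain r where r: "r > 0" "cball z r \<subseteq> chart_image c"
    using open_chart_image[OF c] by (auto simp: open_contains_cball)
  define \<psi> where "\<psi> q = (if q \<in> fst c then bump z r (snd c q) else 0)" for q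
  define C where "C = param c ` cball z r"
  have "closedin X C" unfolding C_def by (rule closedin_param_image[OF c compact_cball r(2)])
  then have open_C: "openin X (topspace X - C)" by blast
  have \<psi>_C: "q \<in> C" if "\<psi> q \<noteq> 0" for q
  proof -
    have "q \<in> fst c" "snd c q \<in> ball z r"
      using that bump_nonzero_iff[OF r(1), of z "snd c q"] by (auto simp: \<psi>_def split: if_splits)
    then have "param c (snd c q) \<in> C" unfolding C_def by (intro imageI) auto
    then show ?thesis using \<open>q \<in> fst c\<close> c by simp
  qed
  have "C1_fun \<psi>"
    unfolding C1_fun_def
  proof
    fix d assume d: "d \<in> A"
    let ?U = "snd d ` (fst d \<inter> (topspace X - C))"
    have "Ck_on 1 (overlap_image d c) (\<lambda>x. bump z r (transition d c x))"
      by (rule Ck_on_1_bump_compose[OF holomorphic_map_on_has_derivative[OF holomorphic_transition[OF d c]]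
          continuous_on_jacobian[OF open_overlap[OF d c] holomorphic_transition[OF d c]]])
    then have 1: "Ck_on 1 (overlap_image d c) (\<lambda>x. \<psi> (param d x))"
      by (rule Ck_on_cong[OF _ open_overlap[OF d c]])
        (simp add: \<psi>_def in_overlap_iff[OF d c] transition_def)
    have "open ?U" using open_C by (rule open_chart_openin[OF d])
    then have 2: "Ck_on 1 ?U (\<lambda>x. \<psi> (param d x))"
    proof (rule Ck_on_cong[OF Ck_on_1_const[of _ 0]])
      fix x assume "x \<in> ?U"
      then have "param d x \<notin> C" by (auto simp: param_chart[OF d])
      then show "0 = \<psi> (param d x)" using \<psi>_C[of "param d x"] by auto
    qed
    have "chart_image d \<subseteq> overlap_image d c \<union> ?U"
    proof
      fix x assume x: "x \<in> chart_image d"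
      show "x \<in> overlap_image d c \<union> ?U"
      proof (cases "param d x \<in> fst c")
        case False
        then have "param d x \<notin> C" using r(2) param_in_chart[OF c] by (auto simp: C_def)
        then have "param d x \<in> fst d \<inter> (topspace X - C)"
          using param_in_chart[OF d x] chart_subset[OF d] by auto
        then show ?thesis using chart_param[OF d x] by (metis UnI2 image_eqI)
      qed (use x in_overlap_iff[OF d c] in auto)
    qed
    then show "Ck_on 1 (chart_image d) (\<lambda>x. \<psi> (param d x))"
      by (rule Ck_on_1_subset[OF Ck_on_1_Un[OF 1 2 open_overlap[OF d c] \<open>open ?U\<close>]])
  qed
  moreover have "supported_in c \<psi> (cball z r)"
    unfolding supported_in_def using r bump_nonzero_iff[OF r(1), of z]
    by (auto simp: \<psi>_def less_imp_le split: if_splits)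
  moreover have "\<psi> q \<in> \<real>\<^sub>\<ge>\<^sub>0" for q by (simp add: \<psi>_def bump_nonneg)
  moreover have "\<psi> p \<noteq> 0" using p r(1) bump_nonzero_iff[OF r(1), of z z] by (simp add: \<psi>_def z_def)
  moreover have "openin X {q \<in> topspace X. \<psi> q \<noteq> 0}"
  proof -
    have "continuous_map (subtopology X (fst c)) (top_of_set (chart_image c)) (snd c)"
      using homeo_chart[OF c] by (rule homeomorphic_imp_continuous_map)
    moreover have "openin (top_of_set (chart_image c)) (ball z r)"
      using r(2) ball_subset_cball[of z r] by (intro openin_subset_topspace_eq[THEN iffD2] open_subset) auto
    ultimately have "openin (subtopology X (fst c)) {q \<in> topspace (subtopology X (fst c)). snd c q \<in> ball z r}"
      by (rule openin_continuous_map_preimage)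
    then have "openin X {q \<in> topspace (subtopology X (fst c)). snd c q \<in> ball z r}"
      using openin_chart[OF c] by (rule openin_trans_full)
    also have "{q \<in> topspace (subtopology X (fst c)). snd c q \<in> ball z r} = {q \<in> topspace X. \<psi> q \<noteq> 0}"
      using bump_nonzero_iff[OF r(1), of z] by (auto simp: \<psi>_def)
    finally show ?thesis .
  qed
  ultimately show ?thesis using that by blast
qed

text \<open>Finitely many bumps are divided by their sum. A prescribed point p0 and chart c0 are
  built in, with a weight that is nonzero at p0, because the vanishing argument is carried out at
  one given point in one given chart.\<close>

lemma partition_of_unity:
  assumes c0: "c0 \<in> A" and p0: "p0 \<in> fst c0"
  obtains F :: "'a set" and cc :: "'a \<Rightarrow> ('a, 'n) chart" and \<theta> :: "'a \<Rightarrow> 'a \<Rightarrow> complex" and K :: "'a \<Rightarrow> (complex^'n) set"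
  where "finite F" "p0 \<in> F" "cc p0 = c0" "\<theta> p0 p0 \<noteq> 0" "\<And>p. p \<in> F \<Longrightarrow> cc p \<in> A" "\<And>p. p \<in> F \<Longrightarrow> C1_fun (\<theta> p)"
    "\<And>p. p \<in> F \<Longrightarrow> supported_in (cc p) (\<theta> p) (K p)" "\<And>p q. \<theta> p q \<in> \<real>\<^sub>\<ge>\<^sub>0"
    "\<And>q. q \<in> topspace X \<Longrightarrow> (\<Sum>p\<in>F. \<theta> p q) = 1"
proof -
  have "\<exists>c\<in>A. p \<in> fst c \<and> (p = p0 \<longrightarrow> c = c0)" if "p \<in> topspace X" for p
    using charts_cover[OF that] c0 p0 by blast
  then obtain cc where cc: "\<And>p. p \<in> topspace X \<Longrightarrow> cc p \<in> A \<and> p \<in> fst (cc p) \<and> (p = p0 \<longrightarrow> cc p = c0)"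
    by metis
  have p0X: "p0 \<in> topspace X" using chart_subset[OF c0] p0 by auto
  define P where "P p \<psi> K \<longleftrightarrow> C1_fun \<psi> \<and> supported_in (cc p) \<psi> K \<and> (\<forall>q. \<psi> q \<in> \<real>\<^sub>\<ge>\<^sub>0) \<and> \<psi> p \<noteq> 0 \<and>
    openin X {q \<in> topspace X. \<psi> q \<noteq> 0}" for p \<psi> K
  have "\<exists>\<psi> K. P p \<psi> K" if "p \<in> topspace X" for p
    using cc[OF that] by (rule_tac bump_function[of "cc p" p]) (auto simp: P_def)
  then obtain \<psi> K where "\<And>p. p \<in> topspace X \<Longrightarrow> P p (\<psi> p) (K p)" by metis
  then have \<psi>: "\<And>p. p \<in> topspace X \<Longrightarrow> C1_fun (\<psi> p)" "\<And>p. p \<in> topspace X \<Longrightarrow> supported_in (cc p) (\<psi> p) (K p)"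
    "\<And>p q. p \<in> topspace X \<Longrightarrow> \<psi> p q \<in> \<real>\<^sub>\<ge>\<^sub>0" "\<And>p. p \<in> topspace X \<Longrightarrow> \<psi> p p \<noteq> 0"
    "\<And>p. p \<in> topspace X \<Longrightarrow> openin X {q \<in> topspace X. \<psi> p q \<noteq> 0}"
    unfolding P_def by blast+
  let ?U = "\<lambda>p. {q \<in> topspace X. \<psi> p q \<noteq> 0}"
  have "\<forall>U\<in>?U ` topspace X. openin X U" "topspace X \<subseteq> \<Union> (?U ` topspace X)"
    using \<psi>(4,5) by auto
  then obtain \<F> where \<F>: "finite \<F>" "\<F> \<subseteq> ?U ` topspace X" "topspace X \<subseteq> \<Union> \<F>"
    using compact unfolding compact_space_alt by meson
  obtain F0 where F0: "F0 \<subseteq> topspace X" "finite F0" "\<F> = ?U ` F0"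
    using finite_subset_image[OF \<F>(1,2)] by blast
  define F where "F = insert p0 F0"
  have F: "finite F" "F \<subseteq> topspace X" using F0 p0X by (auto simp: F_def)
  define \<rho> where "\<rho> q = (\<Sum>p\<in>F. \<psi> p q)" for q
  have \<rho>: "\<rho> q \<noteq> 0" if q: "q \<in> topspace X" for q
  proof
    assume "\<rho> q = 0"
    then have "(\<Sum>p\<in>F. Re (\<psi> p q)) = 0" by (simp add: \<rho>_def flip: Re_sum)
    moreover have nonneg: "Re (\<psi> p q) \<ge> 0" "Im (\<psi> p q) = 0" if "p \<in> F" for p
      using \<psi>(3)[of p q] F that by (auto simp: complex_nonneg_Reals_iff)
    ultimately have "\<psi> p q = 0" if "p \<in> F" for p
      using F(1) that by (simp add: sum_nonneg_eq_0_iff complex_eq_iff)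
    moreover obtain p where "p \<in> F0" "\<psi> p q \<noteq> 0" using F0(3) \<F>(3) q by auto
    ultimately show False by (simp add: F_def)
  qed
  have \<rho>_nonneg: "\<rho> q \<in> \<real>\<^sub>\<ge>\<^sub>0" for q
  proof -
    have "Re (\<psi> p q) \<ge> 0" "Im (\<psi> p q) = 0" if "p \<in> F" for p
      using \<psi>(3)[of p q] F that by (auto simp: complex_nonneg_Reals_iff)
    then show ?thesis by (simp add: \<rho>_def complex_nonneg_Reals_iff sum_nonneg)
  qed
  \<comment> \<open>The default 0 outside \<open>F\<close> makes the nonnegativity hold for every
    index.\<close>
  define \<theta> where "\<theta> p q = (if p \<in> F then \<psi> p q * inverse (\<rho> q) else 0)" for p q
  show ?thesis
  proof (rule that[of F cc \<theta> K])
    show "C1_fun (\<theta> p)" if "p \<in> F" for p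
      unfolding C1_fun_def
    proof
      fix c assume c: "c \<in> A"
      have C1: "Ck_on 1 (chart_image c) (\<lambda>x. \<psi> p (param c x))" if "p \<in> F" for p
        using \<psi>(1)[of p] that F c by (auto simp: C1_fun_def)
      have "\<rho> (param c x) \<noteq> 0" if "x \<in> chart_image c" for x
        using param_in_chart[OF c that] chart_subset[OF c] by (intro \<rho>) auto
      then have "Ck_on 1 (chart_image c) (\<lambda>x. \<psi> p (param c x) * inverse (\<rho> (param c x)))"
        unfolding \<rho>_def using \<open>p \<in> F\<close> by (intro Ck_on_1_mult Ck_on_1_inverse Ck_on_1_sum C1)
      then show "Ck_on 1 (chart_image c) (\<lambda>x. \<theta> p (param c x))"
        using \<open>p \<in> F\<close> by (simp only: \<theta>_def if_True)
    qed
    show "supported_in (cc p) (\<theta> p) (K p)" if "p \<in> F" for p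
      using \<psi>(2)[of p] that F by (auto simp: supported_in_def \<theta>_def)
    show "\<theta> p q \<in> \<real>\<^sub>\<ge>\<^sub>0" for p q
      using \<psi>(3)[of p q] \<rho>_nonneg[of q] F by (auto simp: \<theta>_def intro!: nonneg_Reals_mult_I nonneg_Reals_inverse_I)
    show "(\<Sum>p\<in>F. \<theta> p q) = 1" if "q \<in> topspace X" for q
      using \<rho>[OF that] by (simp add: \<theta>_def sum_distrib_right[symmetric] flip: \<rho>_def)
  qed (use F p0X cc \<psi>(4)[OF p0X] \<rho>[OF p0X] in \<open>auto simp: F_def \<theta>_def\<close>)
qed

end

section \<open>Boundary terms of Stokes' theorem\<close>

text \<open>In the order dz_p, dzbar_s, dz_q, dzbar_t, dz_r, dzbar_u this is, up to a constant, the
  coefficient of \<partial>f \<and> \<partial>bar h \<and> g + \<partial>bar f \<and> h \<and>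
  \<partial>g. The minus sign comes from moving dz_p out of \<partial>g across three
  covectors.\<close>

definition boundary_density :: "(complex^3 \<Rightarrow> complex) \<Rightarrow> (3 \<Rightarrow> 3 \<Rightarrow> complex^3 \<Rightarrow> complex) \<Rightarrow>
    (3 \<Rightarrow> 3 \<Rightarrow> complex^3 \<Rightarrow> complex) \<Rightarrow> complex^3 \<Rightarrow> complex" where
  "boundary_density f h g x = alt3 (\<lambda>p q r. alt3 (\<lambda>s t u.
     D10 f x (axis p 1) * (D01 (h q t) x (axis s 1) * g r u x) -
     D01 f x (axis s 1) * (h q t x * D10 (g r u) x (axis p 1))))"

lemma alt3_sum3:
  "alt3 (\<lambda>i j k. sum3 (\<lambda>p q r. F p q r i j k)) = sum3 (\<lambda>p q r. alt3 (F p q r))"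
  by (simp add: alt3_def sum3_def sum.distrib sum_subtractf)

lemma sum3_cmult: "sum3 (\<lambda>p q r. c * f p q r) = c * sum3 f"
  by (simp add: sum3_def sum_distrib_left)

lemma alt3_alt3_det:
  fixes M N :: "complex^3^3"
  shows "alt3 (\<lambda>p q r. alt3 (\<lambda>s t u. sum3 (\<lambda>p' q' r'. sum3 (\<lambda>s' t' u'.
      M$p'$p * M$q'$q * M$r'$r * (N$s'$s * N$t'$t * N$u'$u * f p' q' r' s' t' u'))))) =
    det M * (det N * alt3 (\<lambda>p q r. alt3 (\<lambda>s t u. f p q r s t u)))"
proof -
  have "alt3 (\<lambda>s t u. sum3 (\<lambda>p' q' r'. sum3 (\<lambda>s' t' u'.
      M$p'$p * M$q'$q * M$r'$r * (N$s'$s * N$t'$t * N$u'$u * f p' q' r' s' t' u')))) =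
    sum3 (\<lambda>p' q' r'. M$p'$p * M$q'$q * M$r'$r * (det N * alt3 (\<lambda>s t u. f p' q' r' s t u)))" for p q r
    by (simp only: alt3_sum3 sum3_cmult alt3_linear(3)) (simp only: alt3_det flip: alt3_sum3)
  then show ?thesis
    by (simp only: alt3_det alt3_linear(3))
qed

lemma sum_product_sum3:
  fixes A :: "3 \<Rightarrow> complex"
  shows "sum A UNIV * ((\<Sum>q\<in>UNIV. \<Sum>s\<in>UNIV. \<Sum>t\<in>UNIV. E q s t) * (\<Sum>r\<in>UNIV. \<Sum>u\<in>UNIV. C r u)) =
      sum3 (\<lambda>p q r. sum3 (\<lambda>s t u. A p * (E q s t * C r u)))"
    and "sum A UNIV * ((\<Sum>q\<in>UNIV. \<Sum>t\<in>UNIV. C q t) * (\<Sum>p\<in>UNIV. \<Sum>r\<in>UNIV. \<Sum>u\<in>UNIV. E p r u)) =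
      sum3 (\<lambda>p q r. sum3 (\<lambda>s t u. A s * (C q t * E p r u)))"
  by (simp_all add: sum3_def sum_distrib_left[symmetric] sum_distrib_right[symmetric] mult.assoc)

lemma alt3_eq_0_if_symmetric_13:
  assumes "\<And>i j k. f k j i = f i j k" shows "alt3 f = 0"
  using assms[of 1 2 3] assms[of 2 3 1] assms[of 3 1 2] by (simp add: alt3_def)

text \<open>The inhomogeneous terms \<open>S1\<close>, \<open>S2\<close> are second derivatives of the coordinate change; they
  are symmetric in two of the indices that are antisymmetrised.\<close>

lemma boundary_density_transform:
  fixes J :: "complex^3^3"
  assumes f10: "\<And>p. D10 f x (axis p 1) = (\<Sum>p'\<in>UNIV. J$p'$p * D10 f' y (axis p' 1))"
    and f01: "\<And>s. D01 f x (axis s 1) = (\<Sum>s'\<in>UNIV. cnj (J$s'$s) * D01 f' y (axis s' 1))"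
    and h: "\<And>q t. h q t x = (\<Sum>q'\<in>UNIV. \<Sum>t'\<in>UNIV. J$q'$q * cnj (J$t'$t) * h' q' t' y)"
    and g: "\<And>q t. g q t x = (\<Sum>q'\<in>UNIV. \<Sum>t'\<in>UNIV. J$q'$q * cnj (J$t'$t) * g' q' t' y)"
    and h01: "\<And>q s t. D01 (h q t) x (axis s 1) =
      (\<Sum>q'\<in>UNIV. \<Sum>s'\<in>UNIV. \<Sum>t'\<in>UNIV. J$q'$q * cnj (J$s'$s) * cnj (J$t'$t) * D01 (h' q' t') y (axis s' 1)) + S1 q s t"
    and g10: "\<And>p r u. D10 (g r u) x (axis p 1) =
      (\<Sum>p'\<in>UNIV. \<Sum>r'\<in>UNIV. \<Sum>u'\<in>UNIV. J$p'$p * J$r'$r * cnj (J$u'$u) * D10 (g' r' u') y (axis p' 1)) + S2 p r u"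
    and S1: "\<And>q s t. S1 q t s = S1 q s t" and S2: "\<And>p r u. S2 r p u = S2 p r u"
  shows "boundary_density f h g x = det J * cnj (det J) * boundary_density f' h' g' y"
proof -
  let ?N = "\<chi> i j. cnj (J $ i $ j)"
  let ?t1 = "\<lambda>p q r s t u. D10 f' y (axis p 1) * (D01 (h' q t) y (axis s 1) * g' r u y)"
  let ?t2 = "\<lambda>p q r s t u. D01 f' y (axis s 1) * (h' q t y * D10 (g' r u) y (axis p 1))"
  let ?T = "\<lambda>F p q r s t u. sum3 (\<lambda>p' q' r'. sum3 (\<lambda>s' t' u'.
      J$p'$p * J$q'$q * J$r'$r * (?N$s'$s * ?N$t'$t * ?N$u'$u * F p' q' r' s' t' u')))"
  have 1: "D10 f x (axis p 1) * (D01 (h q t) x (axis s 1) * g r u x) =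
    ?T ?t1 p q r s t u + D10 f x (axis p 1) * (S1 q s t * g r u x)" for p q r s t u
    unfolding h01 distrib_right distrib_left
    unfolding f10 g sum_product_sum3 by (simp add: mult_ac)
  have 2: "D01 f x (axis s 1) * (h q t x * D10 (g r u) x (axis p 1)) =
    ?T ?t2 p q r s t u + D01 f x (axis s 1) * (h q t x * S2 p r u)" for p q r s t u
    unfolding g10 distrib_left
    unfolding f01 h sum_product_sum3 by (simp add: mult_ac)
  have "boundary_density f h g x =
    alt3 (\<lambda>p q r. alt3 (\<lambda>s t u. ?T ?t1 p q r s t u)) + alt3 (\<lambda>p q r. alt3 (\<lambda>s t u. D10 f x (axis p 1) * (S1 q s t * g r u x)))
    - (alt3 (\<lambda>p q r. alt3 (\<lambda>s t u. ?T ?t2 p q r s t u)) + alt3 (\<lambda>p q r. alt3 (\<lambda>s t u. D01 f x (axis s 1) * (h q t x * S2 p r u))))"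
    unfolding boundary_density_def 1 2 alt3_linear ..
  also have "alt3 (\<lambda>p q r. alt3 (\<lambda>s t u. D10 f x (axis p 1) * (S1 q s t * g r u x))) = 0"
    using S1 by (simp add: alt3_symmetric_eq_0 alt3_linear)
  also have "alt3 (\<lambda>p q r. alt3 (\<lambda>s t u. D01 f x (axis s 1) * (h q t x * S2 p r u))) = 0"
    by (rule alt3_eq_0_if_symmetric_13) (simp only: S2)
  also have "alt3 (\<lambda>p q r. alt3 (\<lambda>s t u. ?T ?t1 p q r s t u)) = det J * (det ?N * alt3 (\<lambda>p q r. alt3 (\<lambda>s t u. ?t1 p q r s t u)))"
    by (rule alt3_alt3_det)
  also have "alt3 (\<lambda>p q r. alt3 (\<lambda>s t u. ?T ?t2 p q r s t u)) = det J * (det ?N * alt3 (\<lambda>p q r. alt3 (\<lambda>s t u. ?t2 p q r s t u)))"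
    by (rule alt3_alt3_det)
  also have "det ?N = cnj (det J)" by (simp add: det_3)
  finally show ?thesis
    unfolding boundary_density_def alt3_linear by (simp add: algebra_simps)
qed

section \<open>Holomorphic changes of coordinates\<close>

lemma D_compose_holomorphic:
  fixes \<phi> :: "complex^'n::finite \<Rightarrow> complex^'m::finite" and f :: "complex^'m \<Rightarrow> complex"
  assumes \<phi>: "(\<phi> has_derivative (*v) J) (at x)" and f: "f differentiable (at (\<phi> x))"
  shows "D10 (\<lambda>z. f (\<phi> z)) x (axis a 1) = (\<Sum>p\<in>UNIV. J$p$a * D10 f (\<phi> x) (axis p 1))"
    and "D01 (\<lambda>z. f (\<phi> z)) x (axis a 1) = (\<Sum>p\<in>UNIV. cnj (J$p$a) * D01 f (\<phi> x) (axis p 1))"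
    and "(\<lambda>z. f (\<phi> z)) differentiable (at x)"
proof -
  have D: "((\<lambda>z. f (\<phi> z)) has_derivative (\<lambda>v. frechet_derivative f (at (\<phi> x)) (J *v v))) (at x)"
    by (rule has_derivative_compose[OF \<phi> differentiable_has_frechet[OF f]])
  have J: "J *v (\<i> *s v) = \<i> *s (J *v v)" for v by (rule vector_scalar_commute)
  have e: "(J *v axis a 1) $ p = J$p$a" for p
    by (simp add: matrix_vector_mult_def axis_def if_distrib cong: if_cong)
  show "D10 (\<lambda>z. f (\<phi> z)) x (axis a 1) = (\<Sum>p\<in>UNIV. J$p$a * D10 f (\<phi> x) (axis p 1))"
    using D10_expand[OF f, of "J *v axis a 1"] unfolding D10_has_derivative[OF D] J e by (simp add: D10_def)
  show "D01 (\<lambda>z. f (\<phi> z)) x (axis a 1) = (\<Sum>p\<in>UNIV. cnj (J$p$a) * D01 f (\<phi> x) (axis p 1))"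
    using D01_expand[OF f, of "J *v axis a 1"] unfolding D01_has_derivative[OF D] J e by (simp add: D01_def)
  show "(\<lambda>z. f (\<phi> z)) differentiable (at x)" using D by (rule differentiableI)
qed

lemma D_complex_differentiable:
  assumes "complex_differentiable_on S f" "x \<in> S"
  shows "D01 f x v = 0" "D10 f x v = frechet_derivative f (at x) v"
  unfolding D01_def D10_def complex_differentiable_on_scale[OF assms] by simp_all

lemma D10_cnj:
  assumes "f differentiable (at x)" shows "D10 (\<lambda>y. cnj (f y)) x v = cnj (D01 f x v)"
  using D10_has_derivative[OF has_derivative_cnj[OF differentiable_has_frechet[OF assms]]]
  by (simp add: D01_def)

text \<open>The entries of the Jacobian are holomorphic, so \<open>D01\<close> acts on their
  conjugates and \<open>D10\<close> on the entries themselves. Each derivative thus acquires a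
  single inhomogeneous term, which contains the second derivatives \<open>J2\<close>. The order of
  the sums is that of \<open>boundary_density_transform\<close>.\<close>

lemma pullback_coeff_derivative:
  fixes \<phi> :: "complex^'n::finite \<Rightarrow> complex^'n" and k :: "'n \<Rightarrow> 'n \<Rightarrow> complex^'n \<Rightarrow> complex"
  assumes U: "open U" "x \<in> U" and \<phi>: "holomorphic_map_on U \<phi>" and k: "\<And>q t. k q t differentiable (at (\<phi> x))"
    and h: "\<And>z q t. z \<in> U \<Longrightarrow> h q t z = (\<Sum>q'\<in>UNIV. \<Sum>t'\<in>UNIV. jacobian \<phi> z$q'$q * cnj (jacobian \<phi> z$t'$t) * k q' t' (\<phi> z))"
  defines "J \<equiv> jacobian \<phi> x" and "J2 \<equiv> \<lambda>i a b. frechet_derivative (\<lambda>z. jacobian \<phi> z$i$a) (at x) (axis b 1)"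
  shows "D01 (h q t) x (axis s 1) =
      (\<Sum>q'\<in>UNIV. \<Sum>s'\<in>UNIV. \<Sum>t'\<in>UNIV. J$q'$q * cnj (J$s'$s) * cnj (J$t'$t) * D01 (k q' t') (\<phi> x) (axis s' 1))
      + (\<Sum>q'\<in>UNIV. \<Sum>t'\<in>UNIV. J$q'$q * cnj (J2 t' t s) * k q' t' (\<phi> x))" (is ?D01)
    and "D10 (h q t) x (axis s 1) =
      (\<Sum>s'\<in>UNIV. \<Sum>q'\<in>UNIV. \<Sum>t'\<in>UNIV. J$s'$s * J$q'$q * cnj (J$t'$t) * D10 (k q' t') (\<phi> x) (axis s' 1))
      + (\<Sum>q'\<in>UNIV. \<Sum>t'\<in>UNIV. J2 q' q s * cnj (J$t'$t) * k q' t' (\<phi> x))" (is ?D10)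
    and "J2 i b a = J2 i a b"
proof -
  have hol: "complex_differentiable_on U (\<lambda>z. jacobian \<phi> z$i$a)" for i a
    using complex_differentiable_on_derivative[OF holomorphic_map_on_component[OF \<phi>, of i] U(1), of "axis a 1"]
    by (simp add: jacobian_def)
  have dJ: "(\<lambda>z. jacobian \<phi> z$i$a) differentiable (at x)" for i a
    using hol U(2) by (simp add: complex_differentiable_on_def)
  have dcJ: "(\<lambda>z. cnj (jacobian \<phi> z$i$a)) differentiable (at x)" for i a
    using has_derivative_cnj[OF differentiable_has_frechet[OF dJ]] by (rule differentiableI)
  note comp = D_compose_holomorphic[OF holomorphic_map_on_has_derivative[OF \<phi> U(2)] k]
  note cnjJ = D01_cnj[OF dJ dJ]
  note J_simps = D_complex_differentiable[OF hol U(2)]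
  have d: "(\<lambda>z. jacobian \<phi> z$q'$q * cnj (jacobian \<phi> z$t'$t)) differentiable (at x)"
     "(\<lambda>z. jacobian \<phi> z$q'$q * cnj (jacobian \<phi> z$t'$t) * k q' t' (\<phi> z)) differentiable (at x)" for q' t'
    by (intro differentiable_mult dJ dcJ comp(3))+
  have "D01 (h q t) x (axis s 1) = D01 (\<lambda>z. \<Sum>q'\<in>UNIV. \<Sum>t'\<in>UNIV. jacobian \<phi> z$q'$q * cnj (jacobian \<phi> z$t'$t) * k q' t' (\<phi> z)) x (axis s 1)"
    by (rule fun_cong[OF D01_cong_open[OF U h]])
  also have "\<dots> = (\<Sum>q'\<in>UNIV. \<Sum>t'\<in>UNIV. J$q'$q * cnj (J$t'$t) * (\<Sum>s'\<in>UNIV. cnj (J$s'$s) * D01 (k q' t') (\<phi> x) (axis s' 1))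
      + J$q'$q * cnj (J2 t' t s) * k q' t' (\<phi> x))"
    unfolding J_def J2_def
    by (simp add: D01_sum d differentiable_sum D01_mult dJ dcJ comp cnjJ J_simps)
  also have "\<dots> = (\<Sum>q'\<in>UNIV. (\<Sum>t'\<in>UNIV. \<Sum>s'\<in>UNIV. J$q'$q * cnj (J$s'$s) * cnj (J$t'$t) * D01 (k q' t') (\<phi> x) (axis s' 1))
     + (\<Sum>t'\<in>UNIV. J$q'$q * cnj (J2 t' t s) * k q' t' (\<phi> x)))"
    by (simp add: sum.distrib sum_distrib_left mult_ac)
  also have "\<dots> = (\<Sum>q'\<in>UNIV. (\<Sum>s'\<in>UNIV. \<Sum>t'\<in>UNIV. J$q'$q * cnj (J$s'$s) * cnj (J$t'$t) * D01 (k q' t') (\<phi> x) (axis s' 1))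
     + (\<Sum>t'\<in>UNIV. J$q'$q * cnj (J2 t' t s) * k q' t' (\<phi> x)))"
    by (subst sum.swap) (rule refl)
  finally show ?D01 by (simp only: sum.distrib)
  have "D10 (h q t) x (axis s 1) = D10 (\<lambda>z. \<Sum>q'\<in>UNIV. \<Sum>t'\<in>UNIV. jacobian \<phi> z$q'$q * cnj (jacobian \<phi> z$t'$t) * k q' t' (\<phi> z)) x (axis s 1)"
    by (rule fun_cong[OF D10_cong_open[OF U h]])
  also have "\<dots> = (\<Sum>q'\<in>UNIV. \<Sum>t'\<in>UNIV. J$q'$q * cnj (J$t'$t) * (\<Sum>s'\<in>UNIV. J$s'$s * D10 (k q' t') (\<phi> x) (axis s' 1))
      + J2 q' q s * cnj (J$t'$t) * k q' t' (\<phi> x))"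
    unfolding J_def J2_def
    by (simp add: D10_sum d differentiable_sum D10_mult dJ dcJ comp D10_cnj[OF dJ] J_simps)
  also have "\<dots> = (\<Sum>q'\<in>UNIV. (\<Sum>t'\<in>UNIV. \<Sum>s'\<in>UNIV. J$s'$s * J$q'$q * cnj (J$t'$t) * D10 (k q' t') (\<phi> x) (axis s' 1))
     + (\<Sum>t'\<in>UNIV. J2 q' q s * cnj (J$t'$t) * k q' t' (\<phi> x)))"
    by (simp add: sum.distrib sum_distrib_left mult_ac)
  also have "\<dots> = (\<Sum>q'\<in>UNIV. (\<Sum>s'\<in>UNIV. \<Sum>t'\<in>UNIV. J$s'$s * J$q'$q * cnj (J$t'$t) * D10 (k q' t') (\<phi> x) (axis s' 1))
     + (\<Sum>t'\<in>UNIV. J2 q' q s * cnj (J$t'$t) * k q' t' (\<phi> x)))"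
    by (subst sum.swap) (rule refl)
  also have "\<dots> = (\<Sum>q'\<in>UNIV. (\<Sum>s'\<in>UNIV. \<Sum>t'\<in>UNIV. J$s'$s * J$q'$q * cnj (J$t'$t) * D10 (k q' t') (\<phi> x) (axis s' 1)))
     + (\<Sum>q'\<in>UNIV. \<Sum>t'\<in>UNIV. J2 q' q s * cnj (J$t'$t) * k q' t' (\<phi> x))"
    by (simp only: sum.distrib)
  also have "(\<Sum>q'\<in>UNIV. (\<Sum>s'\<in>UNIV. \<Sum>t'\<in>UNIV. J$s'$s * J$q'$q * cnj (J$t'$t) * D10 (k q' t') (\<phi> x) (axis s' 1))) =
    (\<Sum>s'\<in>UNIV. \<Sum>q'\<in>UNIV. \<Sum>t'\<in>UNIV. J$s'$s * J$q'$q * cnj (J$t'$t) * D10 (k q' t') (\<phi> x) (axis s' 1))"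
    by (rule sum.swap)
  finally show ?D10 .
  let ?D = "\<lambda>a y. frechet_derivative (\<lambda>z. \<phi> z $ i) (at y) (axis a 1)"
  note c = holomorphic_map_on_component[OF \<phi>, of i]
  have "frechet_derivative (?D b) (at x) (axis a 1) = frechet_derivative (?D a) (at x) (axis b 1)"
  proof (rule mixed_derivatives_commute[OF U])
    note c1 = complex_differentiable_on_derivative[OF c U(1)]
    show "(\<lambda>z. \<phi> z $ i) differentiable (at y)" if "y \<in> U" for y
      using c that by (simp add: complex_differentiable_on_def)
    show "?D a differentiable (at x)" using c1 U(2) by (simp add: complex_differentiable_on_def)
    show "?D b differentiable (at y)" if "y \<in> U" for y using c1 that by (simp add: complex_differentiable_on_def)
    show "continuous_on U (\<lambda>y. frechet_derivative (?D b) (at y) (axis a 1))"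
      by (rule complex_differentiable_on_imp_continuous_derivative[OF c1 U(1)])
  qed
  then show "J2 i b a = J2 i a b" by (simp add: J2_def jacobian_def)
qed

section \<open>Stokes' theorem in one chart\<close>

lemma test_fun_diff:
  fixes F G :: "complex^3 \<Rightarrow> 'b::euclidean_space"
  assumes "test_fun F" "test_fun G"
  shows "test_fun (\<lambda>x. F x - G x)" "cint (\<lambda>x. F x - G x) = cint F - cint G"
proof -
  have neg: "bounded_linear (\<lambda>x :: 'b. - x)" by (rule bounded_linear_minus[OF bounded_linear_ident])
  have n: "test_fun (\<lambda>x. - G x)" by (rule test_fun_bounded_linear[OF assms(2) neg])
  have "test_fun (\<lambda>x. F x + - G x)" by (rule test_fun_add[OF assms(1) n])
  then show "test_fun (\<lambda>x. F x - G x)" by simp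
  have "cint (\<lambda>x. F x + - G x) = cint F + cint (\<lambda>x. - G x)" by (rule cint_add[OF assms(1) n])
  also have "cint (\<lambda>x. - G x) = - cint G" by (rule cint_bounded_linear[OF assms(2) neg])
  finally show "cint (\<lambda>x. F x - G x) = cint F - cint G" by simp
qed

lemma test_fun_alt3:
  assumes "\<And>i j k. test_fun (F i j k)"
  shows "test_fun (\<lambda>x. alt3 (\<lambda>i j k. F i j k x))" "cint (\<lambda>x. alt3 (\<lambda>i j k. F i j k x)) = alt3 (\<lambda>i j k. cint (F i j k))"
proof -
  note 2 = test_fun_add[OF assms[of 1 2 3] assms[of 2 3 1]]
  note 3 = test_fun_add[OF 2 assms[of 3 1 2]]
  note 4 = test_fun_diff(1)[OF 3 assms[of 2 1 3]]
  note 5 = test_fun_diff(1)[OF 4 assms[of 3 2 1]]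
  show "test_fun (\<lambda>x. alt3 (\<lambda>i j k. F i j k x))"
    unfolding alt3_def by (rule test_fun_diff(1)[OF 5 assms])
  show "cint (\<lambda>x. alt3 (\<lambda>i j k. F i j k x)) = alt3 (\<lambda>i j k. cint (F i j k))"
    unfolding alt3_def test_fun_diff(2)[OF 5 assms[of 1 3 2]] test_fun_diff(2)[OF 4 assms[of 3 2 1]]
      test_fun_diff(2)[OF 3 assms[of 2 1 3]] cint_add[OF 2 assms[of 3 1 2]] cint_add[OF assms[of 1 2 3] assms[of 2 3 1]] ..
qed

lemma D_zero_ext:
  fixes S :: "(complex^'n::finite) set" and f :: "complex^'n \<Rightarrow> complex"
  assumes "compact_in_open S K" "\<And>x. x \<in> S - K \<Longrightarrow> f x = 0"
  shows "D10 (zero_ext S f) x v = zero_ext S (\<lambda>x. D10 f x v) x" "D01 (zero_ext S f) x v = zero_ext S (\<lambda>x. D01 f x v) x"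
proof -
  have "frechet_derivative (zero_ext S f) (at x) w = zero_ext S (\<lambda>x. frechet_derivative f (at x) w) x" for w
    by (rule compact_in_open.frechet_derivative_zero_ext[OF assms(1)]) (rule assms(2))
  then show "D10 (zero_ext S f) x v = zero_ext S (\<lambda>x. D10 f x v) x" "D01 (zero_ext S f) x v = zero_ext S (\<lambda>x. D01 f x v) x"
    by (simp_all add: D10_def D01_def zero_ext_def)
qed

lemma boundary_density_eq_0:
  assumes "open W" "x \<in> W" "\<And>y. y \<in> W \<Longrightarrow> f y = 0"
  shows "boundary_density f h g x = 0"
proof -
  have "D10 f x v = 0" "D01 f x v = 0" for v
    using D10_cong_open[of W x f "\<lambda>_. 0", OF assms] D01_cong_open[of W x f "\<lambda>_. 0", OF assms]
    by (simp_all add: D10_const D01_const)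
  then show ?thesis by (simp add: boundary_density_def alt3_linear)
qed

lemma continuous_on_alt3:
  assumes "\<And>i j k. continuous_on S (F i j k)"
  shows "continuous_on S (\<lambda>x. alt3 (\<lambda>i j k. F i j k x))"
  unfolding alt3_def by (intro continuous_intros assms)

lemma continuous_on_boundary_density:
  assumes "Ck_on 1 S f" "\<And>j k. Ck_on 1 S (h j k)" "\<And>j k. Ck_on 1 S (g j k)"
  shows "continuous_on S (boundary_density f h g)"
  unfolding boundary_density_def[abs_def]
  by (intro continuous_on_alt3 continuous_intros continuous_on_D Ck_on_1_imp_continuous_on assms)

lemma continuous_on_top_coeff:
  assumes "\<And>j k. Ck_on 2 S (h j k)" "\<And>j k. continuous_on S (g j k)"
  shows "continuous_on S (\<lambda>x. top_coeff (ddbar_coeff h x) (\<lambda>j k. g j k x))"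
  unfolding top_coeff_def ddbar_coeff_def
  by (intro continuous_on_alt3 continuous_intros continuous_on_D Ck_on_1_D assms)

text \<open>Exchanging q with r and t with u costs two signs, which cancel. Afterwards
  \<open>h\<close> carries the indices q, t in both parts of the defect, as the product rule
  demands.\<close>

lemma top_coeff_swap: "top_coeff (ddbar_coeff g x) (\<lambda>j k. h j k x) =
    alt3 (\<lambda>p q r. alt3 (\<lambda>s t u. h q t x * ddbar_coeff g x p s r u))"
  by (simp add: top_coeff_def alt3_def algebra_simps)

definition stokes_defect :: "(3 \<Rightarrow> 3 \<Rightarrow> complex^3 \<Rightarrow> complex) \<Rightarrow> (3 \<Rightarrow> 3 \<Rightarrow> complex^3 \<Rightarrow> complex) \<Rightarrow> complex^3 \<Rightarrow> complex" where
  "stokes_defect h g x = top_coeff (ddbar_coeff h x) (\<lambda>j k. g j k x) - top_coeff (ddbar_coeff g x) (\<lambda>j k. h j k x)"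

text \<open>\<open>f\<close> stands for a partition function in one chart, \<open>h\<close> and
  \<open>g\<close> for the coefficients of the two metrics. The compact support is carried by
  \<open>f\<close> alone.\<close>

locale stokes_data =
  fixes S K :: "(complex^3) set" and f :: "complex^3 \<Rightarrow> complex" and h g :: "3 \<Rightarrow> 3 \<Rightarrow> complex^3 \<Rightarrow> complex"
  assumes S: "compact_in_open S K" and f: "Ck_on 1 S f" and f0: "\<And>x. x \<in> S - K \<Longrightarrow> f x = 0"
    and h: "\<And>j k. Ck_on 2 S (h j k)" and g: "\<And>j k. Ck_on 2 S (g j k)"
begin

interpretation compact_in_open S K by (rule S)

lemma test_fun_zero_ext:
  fixes F :: "complex^3 \<Rightarrow> 'b::euclidean_space"
  assumes "continuous_on S F" "\<And>x. x \<in> S - K \<Longrightarrow> F x = 0"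
  shows "test_fun (zero_ext S F)"
  using continuous_zero_ext[OF assms] compact_supp_zero_ext[OF assms(2)] by (simp add: test_fun_def)

lemma test_fun_defect: "test_fun (zero_ext S (\<lambda>x. f x * stokes_defect h g x))"
proof (rule test_fun_zero_ext)
  show "continuous_on S (\<lambda>x. f x * stokes_defect h g x)"
    unfolding stokes_defect_def
    by (intro continuous_on_mult continuous_on_diff continuous_on_top_coeff Ck_on_1_imp_continuous_on f h g Ck_on_2_imp_1)
qed (simp add: f0)

lemma boundary_density_outside: "x \<in> S - K \<Longrightarrow> boundary_density f h g x = 0"
  using f0 open_S compact_K by (intro boundary_density_eq_0[of "S - K"]) (auto intro!: open_Diff compact_imp_closed)

lemma test_fun_boundary_density: "test_fun (zero_ext S (boundary_density f h g))"
  by (intro test_fun_zero_ext continuous_on_boundary_density f Ck_on_2_imp_1 h g boundary_density_outside)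

text \<open>For each choice of indices, \<partial>_p(f g \<partial>bar_s h) - \<partial>bar_s(f h
  \<partial>_p g) is f times a term of the defect plus a term of the boundary density: the two
  products of \<partial>bar_s h with \<partial>_p g cancel. Its integral is 0, since the functions
  being differentiated have compact support.\<close>

lemma stokes: "cint (zero_ext S (\<lambda>x. f x * stokes_defect h g x)) = - cint (zero_ext S (boundary_density f h g))"
proof -
  let ?U = "\<lambda>q r s t u x. f x * (D01 (h q t) x (axis s 1) * g r u x)"
  let ?V = "\<lambda>p q r t u x. f x * (h q t x * D10 (g r u) x (axis p 1))"
  note C1 = f Ck_on_2_imp_1[OF h] Ck_on_2_imp_1[OF g] Ck_on_1_D[OF h] Ck_on_1_D[OF g]
  have U: "Ck_on 1 S (?U q r s t u)" and V: "Ck_on 1 S (?V p q r t u)" for p q r s t u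
    by (intro Ck_on_1_mult C1)+
  have U0: "?U q r s t u x = 0" and V0: "?V p q r t u x = 0" if "x \<in> S - K" for p q r s t u x
    using f0[OF that] by simp_all
  let ?W = "\<lambda>p q r s t u x. D10 (zero_ext S (?U q r s t u)) x (axis p 1) - D01 (zero_ext S (?V p q r t u)) x (axis s 1)"
  note UV = cint_D10_D01[OF Ck_on_1_zero_ext[OF U U0] compact_supp_zero_ext[OF U0]]
    cint_D10_D01[OF Ck_on_1_zero_ext[OF V V0] compact_supp_zero_ext[OF V0]]
  have W: "test_fun (?W p q r s t u)" "cint (?W p q r s t u) = 0" for p q r s t u
    using test_fun_diff[OF UV(3,8)] UV(1,6) by simp_all
  have ext: "D10 (zero_ext S (?U q r s t u)) x v = zero_ext S (\<lambda>x. D10 (?U q r s t u) x v) x"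
    "D01 (zero_ext S (?V p q r t u)) x v = zero_ext S (\<lambda>x. D01 (?V p q r t u) x v) x" for p q r s t u x v
    using D_zero_ext(1)[of S K "?U q r s t u", OF S U0] D_zero_ext(2)[of S K "?V p q r t u", OF S V0] by simp_all
  have "zero_ext S (\<lambda>x. f x * stokes_defect h g x) x + zero_ext S (boundary_density f h g) x =
    alt3 (\<lambda>p q r. alt3 (\<lambda>s t u. ?W p q r s t u x))" for x
  proof (cases "x \<in> S")
    case True
    have diff: "f differentiable (at x)" "h j k differentiable (at x)" "g j k differentiable (at x)"
      "(\<lambda>y. D01 (h j k) y v) differentiable (at x)" "(\<lambda>y. D10 (g j k) y v) differentiable (at x)" for j k v
      using C1(1) C1(2)[of j k] C1(3)[of j k] C1(4)[of j k v] C1(7)[of j k v] True unfolding Ck_on_1 by blast+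
    have "?W p q r s t u x = f x * (ddbar_coeff h x p s q t * g r u x) - f x * (h q t x * ddbar_coeff g x p s r u)
      + (D10 f x (axis p 1) * (D01 (h q t) x (axis s 1) * g r u x) - D01 f x (axis s 1) * (h q t x * D10 (g r u) x (axis p 1)))" for p q r s t u
      unfolding ext ddbar_coeff_def D01_D10_commute[OF open_S True g]
      using True by (simp add: zero_ext_def D10_mult D01_mult diff differentiable_mult algebra_simps)
    then show ?thesis
      using True unfolding zero_ext_def stokes_defect_def boundary_density_def top_coeff_swap[of g x h]
      unfolding top_coeff_def
      by (simp only: if_True alt3_linear right_diff_distrib)
  next
    case False
    then show ?thesis
      unfolding ext by (simp add: zero_ext_def alt3_linear)
  qed
  then have "cint (zero_ext S (\<lambda>x. f x * stokes_defect h g x)) + cint (zero_ext S (boundary_density f h g)) =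
      cint (\<lambda>x. alt3 (\<lambda>p q r. alt3 (\<lambda>s t u. ?W p q r s t u x)))"
    using cint_add[OF test_fun_defect test_fun_boundary_density] by presburger
  also have "\<dots> = alt3 (\<lambda>p q r. cint (\<lambda>x. alt3 (\<lambda>s t u. ?W p q r s t u x)))"
    by (rule test_fun_alt3(2), rule test_fun_alt3(1), rule W(1))
  also have "\<dots> = alt3 (\<lambda>p q r. alt3 (\<lambda>s t u. cint (?W p q r s t u)))"
    by (simp only: test_fun_alt3(2)[OF W(1)])
  also have "\<dots> = 0"
    by (simp only: W(2) alt3_linear(5))
  finally show ?thesis by (simp add: eq_neg_iff_add_eq_0)
qed

end

lemma boundary_density_sum:
  assumes "\<And>p. p \<in> F \<Longrightarrow> f p differentiable (at x)"
  shows "(\<Sum>p\<in>F. boundary_density (f p) h g x) = boundary_density (\<lambda>y. \<Sum>p\<in>F. f p y) h g x"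
proof -
  have "D10 (\<lambda>y. \<Sum>p\<in>F. f p y) x v = (\<Sum>p\<in>F. D10 (f p) x v)"
    "D01 (\<lambda>y. \<Sum>p\<in>F. f p y) x v = (\<Sum>p\<in>F. D01 (f p) x v)" for v
    by (rule D10_sum D01_sum; rule assms; assumption)+
  then have "boundary_density (\<lambda>y. \<Sum>p\<in>F. f p y) h g x =
    alt3 (\<lambda>p q r. alt3 (\<lambda>s t u. \<Sum>i\<in>F. D10 (f i) x (axis p 1) * (D01 (h q t) x (axis s 1) * g r u x) -
     D01 (f i) x (axis s 1) * (h q t x * D10 (g r u) x (axis p 1))))"
    by (simp only: boundary_density_def sum_subtractf sum_distrib_right)
  also have "\<dots> = (\<Sum>p\<in>F. boundary_density (f p) h g x)"
    by (simp only: boundary_density_def alt3_def sum_subtractf sum.distrib)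
  finally show ?thesis by simp
qed

section \<open>Metrics in the charts\<close>

lemma sum_swap4:
  "(\<Sum>p\<in>P. \<Sum>q\<in>Q. \<Sum>j\<in>J. \<Sum>k\<in>K. F p q j k) = (\<Sum>j\<in>J. \<Sum>k\<in>K. \<Sum>p\<in>P. \<Sum>q\<in>Q. F p q j k)"
proof -
  have "(\<Sum>p\<in>P. \<Sum>q\<in>Q. \<Sum>j\<in>J. \<Sum>k\<in>K. F p q j k) = (\<Sum>p\<in>P. \<Sum>j\<in>J. \<Sum>q\<in>Q. \<Sum>k\<in>K. F p q j k)"
    by (rule sum.cong[OF refl], rule sum.swap)
  also have "\<dots> = (\<Sum>j\<in>J. \<Sum>p\<in>P. \<Sum>q\<in>Q. \<Sum>k\<in>K. F p q j k)" by (rule sum.swap)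
  also have "\<dots> = (\<Sum>j\<in>J. \<Sum>p\<in>P. \<Sum>k\<in>K. \<Sum>q\<in>Q. F p q j k)"
    by (rule sum.cong[OF refl], rule sum.cong[OF refl], rule sum.swap)
  also have "\<dots> = (\<Sum>j\<in>J. \<Sum>k\<in>K. \<Sum>p\<in>P. \<Sum>q\<in>Q. F p q j k)"
    by (rule sum.cong[OF refl], rule sum.swap)
  finally show ?thesis .
qed

definition metric_coeff :: "('a, 3) mform \<Rightarrow> ('a, 3) chart \<Rightarrow> 3 \<Rightarrow> 3 \<Rightarrow> complex^3 \<Rightarrow> complex" where
  "metric_coeff \<omega> c j k x = form_coeff (\<omega> c x) j k"

text \<open>The coefficients provided by smoothness agree on the chart image with those read off by
  \<open>form_coeff\<close>. Regularity passes to the latter, which depend on the metric and the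
  chart alone.\<close>

lemma hermitian_metric_local_form:
  assumes \<omega>: "hermitian_metric A \<omega>" and c: "c \<in> A" and "open (chart_image c)"
  shows "local_11_form (chart_image c) (\<omega> c) (metric_coeff \<omega> c)"
proof -
  obtain h where h: "\<And>j k. smooth_on (chart_image c) (h j k)"
    "\<And>x v w. x \<in> chart_image c \<Longrightarrow> \<omega> c x [v, w] = (\<Sum>j\<in>UNIV. \<Sum>k\<in>UNIV. h j k x * wedge 1 1 (dz j) (dzbar k) [v, w])"
  proof -
    have "smooth_11_form_on (chart_image c) (\<omega> c)"
      using \<omega> c by (simp add: hermitian_metric_def smooth_11_form_def)
    then obtain h where "(\<forall>j k. smooth_on (chart_image c) (h j k)) \<and> (\<forall>x\<in>chart_image c. \<forall>v w.
        \<omega> c x [v, w] = (\<Sum>j\<in>UNIV. \<Sum>k\<in>UNIV. h j k x * wedge 1 1 (dz j) (dzbar k) [v, w]))"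
      unfolding smooth_11_form_on_def ..
    then show ?thesis by (intro that[of h]) blast+
  qed
  have form: "\<omega> c x [v, w] = (\<Sum>j\<in>UNIV. \<Sum>k\<in>UNIV. h j k x * (v $ j * cnj (w $ k) - w $ j * cnj (v $ k)))"
    if "x \<in> chart_image c" for x v w
    unfolding h(2)[OF that] wedge_1_1 by (simp add: dz_def dzbar_def)
  have coeff: "metric_coeff \<omega> c j k x = h j k x" if "x \<in> chart_image c" for x j k
    unfolding metric_coeff_def by (rule form_coeff_unique(1)[OF form[OF that]])
  show ?thesis
  proof
    show "Ck_on 2 (chart_image c) (metric_coeff \<omega> c j k)" for j k
    proof (rule Ck_on_cong[OF _ assms(3)])
      show "Ck_on 2 (chart_image c) (h j k)"
        using h(1)[of j k] unfolding smooth_on_def by blast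
    qed (simp add: coeff)
    show "\<omega> c x [v, w] = (\<Sum>j\<in>UNIV. \<Sum>k\<in>UNIV. metric_coeff \<omega> c j k x * (v $ j * cnj (w $ k) - w $ j * cnj (v $ k)))"
      if "x \<in> chart_image c" for x v w
      unfolding coeff[OF that] by (rule form[OF that])
  qed (rule assms(3))
qed

locale compact_hermitian_threefold = compact_complex_manifold X A
  for X :: "'a topology" and A :: "('a, 3) chart set" +
  fixes \<omega>1 \<omega>2 :: "('a, 3) mform"
  assumes metric1: "hermitian_metric A \<omega>1" and metric2: "hermitian_metric A \<omega>2"
begin

text \<open>Expanding the pullback of the form in chart d produces these sums as coefficients, and
  coefficients are unique by \<open>form_coeff_unique\<close>.\<close>

lemma metric_coeff_transform:
  assumes \<omega>: "hermitian_metric A \<omega>" and c: "c \<in> A" and d: "d \<in> A" and x: "x \<in> overlap_image c d"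
  defines "J \<equiv> jacobian (transition c d) x"
  shows "metric_coeff \<omega> c j k x = (\<Sum>p\<in>UNIV. \<Sum>q\<in>UNIV. J$p$j * cnj (J$q$k) * metric_coeff \<omega> d p q (transition c d x))"
proof -
  interpret d: local_11_form "chart_image d" "\<omega> d" "metric_coeff \<omega> d"
    by (rule hermitian_metric_local_form[OF \<omega> d open_chart_image[OF d]])
  have y: "transition c d x \<in> chart_image d"
    using transition_overlap(1)[OF c d x] overlap_subset[OF d c] by auto
  have D: "frechet_derivative (transition c d) (at x) = (*v) J"
    unfolding J_def by (rule frechet_derivative_at[symmetric, OF holomorphic_map_on_has_derivative[OF holomorphic_transition[OF c d] x]])
  let ?k = "\<lambda>p q. metric_coeff \<omega> d p q (transition c d x)"
  have "\<omega> c x [v, w] = (\<Sum>j\<in>UNIV. \<Sum>k\<in>UNIV. (\<Sum>p\<in>UNIV. \<Sum>q\<in>UNIV. J$p$j * cnj (J$q$k) * ?k p q) *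
    (v $ j * cnj (w $ k) - w $ j * cnj (v $ k)))" for v w
  proof -
    have "\<omega> c x [v, w] = pullback (transition c d) (\<omega> d) x [v, w]"
      using \<omega> c d x unfolding hermitian_metric_def smooth_11_form_def by blast
    also have "\<dots> = \<omega> d (transition c d x) [J *v v, J *v w]"
      by (simp add: pullback_def D)
    also have "\<dots> = (\<Sum>p\<in>UNIV. \<Sum>q\<in>UNIV. ?k p q * ((J *v v) $ p * cnj ((J *v w) $ q) - (J *v w) $ p * cnj ((J *v v) $ q)))"
      by (rule d.form_eq[OF y])
    also have "\<dots> = (\<Sum>p\<in>UNIV. \<Sum>q\<in>UNIV. \<Sum>j\<in>UNIV. \<Sum>k\<in>UNIV. J$p$j * cnj (J$q$k) * ?k p q * (v $ j * cnj (w $ k) - w $ j * cnj (v $ k)))"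
    proof (intro sum.cong refl)
      fix p q
      have e: "(J *v a) $ p * cnj ((J *v b) $ q) = (\<Sum>j\<in>UNIV. \<Sum>k\<in>UNIV. J$p$j * cnj (J$q$k) * (a $ j * cnj (b $ k)))" for a b
        by (simp add: matrix_vector_mult_def sum_product mult_ac)
      show "?k p q * ((J *v v) $ p * cnj ((J *v w) $ q) - (J *v w) $ p * cnj ((J *v v) $ q)) =
        (\<Sum>j\<in>UNIV. \<Sum>k\<in>UNIV. J$p$j * cnj (J$q$k) * ?k p q * (v $ j * cnj (w $ k) - w $ j * cnj (v $ k)))"
        unfolding e sum_subtractf[symmetric] sum_distrib_left by (simp add: algebra_simps)
    qed
    also have "\<dots> = (\<Sum>j\<in>UNIV. \<Sum>k\<in>UNIV. \<Sum>p\<in>UNIV. \<Sum>q\<in>UNIV. J$p$j * cnj (J$q$k) * ?k p q * (v $ j * cnj (w $ k) - w $ j * cnj (v $ k)))"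
      by (rule sum_swap4)
    finally show ?thesis by (simp only: sum_distrib_right)
  qed
  then show ?thesis
    unfolding metric_coeff_def[of \<omega> c] by (rule form_coeff_unique(1))
qed

abbreviation "bd c f \<equiv> boundary_density (\<lambda>x. f (param c x)) (metric_coeff \<omega>1 c) (metric_coeff \<omega>2 c)"

text \<open>The factor is the one that \<open>cint_change_of_variables\<close> absorbs.\<close>

lemma bd_transform:
  assumes c: "c \<in> A" and d: "d \<in> A" and x: "x \<in> overlap_image c d" and f: "C1_fun f"
  shows "bd c f x = (cmod (det (jacobian (transition c d) x)))\<^sup>2 * bd d f (transition c d x)"
proof -
  let ?\<phi> = "transition c d" and ?U = "overlap_image c d" and ?J = "jacobian (transition c d) x"
  note U = open_overlap[OF c d] and hol = holomorphic_transition[OF c d]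
  have y: "?\<phi> x \<in> chart_image d"
    using transition_overlap(1)[OF c d x] overlap_subset[OF d c] by auto
  have f': "(\<lambda>x. f (param d x)) differentiable (at (?\<phi> x))"
    using f d y by (simp add: C1_fun_def Ck_on_1)
  have f_eq: "f (param c z) = f (param d (?\<phi> z))" if "z \<in> ?U" for z
    using transition_overlap(2)[OF c d that] by simp
  note chain = D_compose_holomorphic[OF holomorphic_map_on_has_derivative[OF hol x] f']
  interpret d1: local_11_form "chart_image d" "\<omega>1 d" "metric_coeff \<omega>1 d"
    by (rule hermitian_metric_local_form[OF metric1 d open_chart_image[OF d]])
  interpret d2: local_11_form "chart_image d" "\<omega>2 d" "metric_coeff \<omega>2 d"
    by (rule hermitian_metric_local_form[OF metric2 d open_chart_image[OF d]])
  note P1 = pullback_coeff_derivative[of ?U x ?\<phi> "metric_coeff \<omega>1 d" "metric_coeff \<omega>1 c", OF U x hol Ck2_D(1)[OF d1.C2 y]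
    metric_coeff_transform[OF metric1 c d]]
  note P2 = pullback_coeff_derivative[of ?U x ?\<phi> "metric_coeff \<omega>2 d" "metric_coeff \<omega>2 c", OF U x hol Ck2_D(1)[OF d2.C2 y]
    metric_coeff_transform[OF metric2 c d]]
  have "bd c f x = det ?J * cnj (det ?J) * bd d f (?\<phi> x)"
  proof (rule boundary_density_transform)
    show "D10 (\<lambda>x. f (param c x)) x (axis p 1) = (\<Sum>p'\<in>UNIV. ?J$p'$p * D10 (\<lambda>x. f (param d x)) (?\<phi> x) (axis p' 1))" for p
      unfolding chain(1)[symmetric] by (rule fun_cong[OF D10_cong_open[OF U x f_eq]])
    show "D01 (\<lambda>x. f (param c x)) x (axis s 1) = (\<Sum>s'\<in>UNIV. cnj (?J$s'$s) * D01 (\<lambda>x. f (param d x)) (?\<phi> x) (axis s' 1))" for s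
      unfolding chain(2)[symmetric] by (rule fun_cong[OF D01_cong_open[OF U x f_eq]])
  qed (rule metric_coeff_transform[OF metric1 c d x] metric_coeff_transform[OF metric2 c d x] P1(1) P2(2)
      | simp only: P1(3) P2(3))+
  then show ?thesis by (simp only: complex_norm_square)
qed

text \<open>\<open>bd\<close> contains derivatives of \<open>f\<close>, so \<open>f\<close> has to
  vanish near the point. It does so on the complement of the image of \<open>K\<close> under
  \<open>param c\<close>, which is open because that image is closed.\<close>

lemma bd_eq_0:
  assumes c: "c \<in> A" and d: "d \<in> A" and f: "supported_in c f K" and x: "x \<in> chart_image d" "param d x \<notin> param c ` K"
  shows "bd d f x = 0"
proof (rule boundary_density_eq_0)
  let ?W = "snd d ` (fst d \<inter> (topspace X - param c ` K))"
  have "closedin X (param c ` K)"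
    using f by (intro closedin_param_image[OF c]) (auto simp: supported_in_def)
  then have "openin X (topspace X - param c ` K)" by blast
  then show "open ?W" by (rule open_chart_openin[OF d])
  have "param d x \<in> fst d \<inter> (topspace X - param c ` K)"
    using x param_in_chart[OF d x(1)] chart_subset[OF d] by auto
  then show "x \<in> ?W" using chart_param[OF d x(1)] by (metis image_eqI)
  fix y assume "y \<in> ?W"
  then have y: "param d y \<in> topspace X" "param d y \<notin> param c ` K"
    by (auto simp: param_chart[OF d])
  show "f (param d y) = 0"
  proof (rule ccontr)
    assume "f (param d y) \<noteq> 0"
    then have "param d y \<in> fst c" "snd c (param d y) \<in> K"
      using f y(1) by (auto simp: supported_in_def)
    then show False using y(2) param_chart[OF c, of "param d y"] by (metis image_eqI)
  qed
qed

end

section \<open>Two metrics on a compact threefold\<close>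

lemma wedge_uminus: "wedge k l (\<lambda>vs. - \<Theta> vs) \<rho> vs = - wedge k l \<Theta> \<rho> vs"
  by (simp add: wedge_def sum_negf)

context compact_hermitian_threefold
begin

lemma local_forms:
  assumes c: "c \<in> A"
  shows "local_11_form (chart_image c) (\<omega>1 c) (metric_coeff \<omega>1 c)"
    "local_11_form (chart_image c) (\<omega>2 c) (metric_coeff \<omega>2 c)"
  by (rule hermitian_metric_local_form[OF metric1 c open_chart_image[OF c]]
      hermitian_metric_local_form[OF metric2 c open_chart_image[OF c]])+

lemma nonneg_top_coeff:
  assumes nonneg: "form_nonneg_22 A (ddc \<omega>1)" and c: "c \<in> A" and x: "x \<in> chart_image c"
  shows "- top_coeff (ddbar_coeff (metric_coeff \<omega>1 c) x) (\<lambda>j k. metric_coeff \<omega>2 c j k x) \<in> \<real>\<^sub>\<ge>\<^sub>0"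
    and "top_coeff (ddbar_coeff (metric_coeff \<omega>1 c) x) (\<lambda>j k. metric_coeff \<omega>2 c j k x) = 0 \<Longrightarrow>
      top_coeff (ddbar_coeff (metric_coeff \<omega>1 c) x) g = 0"
proof -
  have \<Theta>: "nonneg_22 (ddc \<omega>1 c x)" using nonneg c x by (simp add: form_nonneg_22_def)
  have "ddc \<omega>1 c x = (\<lambda>vs. \<i> * del (delbar (\<omega>1 c)) x vs)" by (simp add: ddc_def fun_eq_iff)
  note w = local_11_form.wedge_ddc[OF local_forms(1)[OF c] x, folded this top_coeff_def]
  have pos: "\<And>v w. \<omega>2 c x [v, w] \<in> \<real>" "\<And>v. v \<noteq> 0 \<Longrightarrow> Re (\<omega>2 c x [v, \<i> *s v]) > 0"
    using metric2 c x by (auto simp: hermitian_metric_def)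
  note R = nonneg_22_top_coeff[OF w \<Theta> local_11_form.form_eq[OF local_forms(2)[OF c] x] pos]
  show "- top_coeff (ddbar_coeff (metric_coeff \<omega>1 c) x) (\<lambda>j k. metric_coeff \<omega>2 c j k x) \<in> \<real>\<^sub>\<ge>\<^sub>0"
    by (rule R(1))
  show "top_coeff (ddbar_coeff (metric_coeff \<omega>1 c) x) g = 0"
    if "top_coeff (ddbar_coeff (metric_coeff \<omega>1 c) x) (\<lambda>j k. metric_coeff \<omega>2 c j k x) = 0"
    by (rule R(2), assumption, rule that)
qed

text \<open>This is \<open>nonneg_22_top_coeff\<close> for the negative of
  \<open>ddc \<omega>2\<close>; the sign moves through \<open>top_coeff\<close> and is the opposite
  of that in \<open>nonneg_top_coeff\<close>.\<close>

lemma nonpos_top_coeff: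
  assumes nonpos: "form_nonpos_22 A (ddc \<omega>2)" and c: "c \<in> A" and x: "x \<in> chart_image c"
  shows "top_coeff (ddbar_coeff (metric_coeff \<omega>2 c) x) (\<lambda>j k. metric_coeff \<omega>1 c j k x) \<in> \<real>\<^sub>\<ge>\<^sub>0"
    and "top_coeff (ddbar_coeff (metric_coeff \<omega>2 c) x) (\<lambda>j k. metric_coeff \<omega>1 c j k x) = 0 \<Longrightarrow>
      top_coeff (ddbar_coeff (metric_coeff \<omega>2 c) x) g = 0"
proof -
  have \<Theta>: "nonneg_22 (\<lambda>vs. - ddc \<omega>2 c x vs)"
    using nonpos c x by (simp add: form_nonpos_22_def form_nonneg_22_def)
  have "ddc \<omega>2 c x = (\<lambda>vs. \<i> * del (delbar (\<omega>2 c)) x vs)" by (simp add: ddc_def fun_eq_iff)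
  note w = local_11_form.wedge_ddc[OF local_forms(2)[OF c] x, folded this top_coeff_def]
  have w': "wedge 4 2 (\<lambda>vs. - ddc \<omega>2 c x vs)
      (\<lambda>us. \<i> * wedge 1 1 (\<lambda>vs. \<Sum>r\<in>UNIV. hd vs $ r * y r) (\<lambda>vs. cnj (\<Sum>r\<in>UNIV. hd vs $ r * y r)) us) std_basis =
    - 8 * \<i> * top_coeff (\<lambda>a b p q. - ddbar_coeff (metric_coeff \<omega>2 c) x a b p q) (\<lambda>r u. y r * cnj (y u))" for y
    unfolding wedge_uminus w top_coeff_uminus by simp
  have pos: "\<And>v w. \<omega>1 c x [v, w] \<in> \<real>" "\<And>v. v \<noteq> 0 \<Longrightarrow> Re (\<omega>1 c x [v, \<i> *s v]) > 0"
    using metric1 c x by (auto simp: hermitian_metric_def)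
  note R = nonneg_22_top_coeff[OF w' \<Theta> local_11_form.form_eq[OF local_forms(1)[OF c] x] pos, unfolded top_coeff_uminus minus_minus neg_equal_0_iff_equal]
  show "top_coeff (ddbar_coeff (metric_coeff \<omega>2 c) x) (\<lambda>j k. metric_coeff \<omega>1 c j k x) \<in> \<real>\<^sub>\<ge>\<^sub>0"
    by (rule R(1))
  show "top_coeff (ddbar_coeff (metric_coeff \<omega>2 c) x) g = 0"
    if "top_coeff (ddbar_coeff (metric_coeff \<omega>2 c) x) (\<lambda>j k. metric_coeff \<omega>1 c j k x) = 0"
    by (rule R(2), assumption, rule that)
qed

section \<open>Moving the boundary terms between charts\<close>

abbreviation "local_defect c \<equiv> stokes_defect (metric_coeff \<omega>1 c) (metric_coeff \<omega>2 c)"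

lemma supported_in_stokes_data:
  assumes c: "c \<in> A" and f: "C1_fun f" and supp: "supported_in c f K"
  shows "stokes_data (chart_image c) K (\<lambda>x. f (param c x)) (metric_coeff \<omega>1 c) (metric_coeff \<omega>2 c)"
proof
  show "open (chart_image c)" by (rule open_chart_image[OF c])
  show "compact K" "K \<subseteq> chart_image c" using supp by (auto simp: supported_in_def)
  show "Ck_on 1 (chart_image c) (\<lambda>x. f (param c x))" using f c by (simp add: C1_fun_def)
  show "f (param c x) = 0" if x: "x \<in> chart_image c - K" for x
  proof (rule ccontr)
    assume "f (param c x) \<noteq> 0"
    moreover have "param c x \<in> topspace X" using x param_in_chart[OF c] chart_subset[OF c] by auto
    ultimately have "snd c (param c x) \<in> K" using supp by (auto simp: supported_in_def)
    then show False using x chart_param[OF c] by auto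
  qed
  show "Ck_on 2 (chart_image c) (metric_coeff \<omega>1 c j k)" for j k
    by (rule local_11_form.C2[OF local_forms(1)[OF c]])
  show "Ck_on 2 (chart_image c) (metric_coeff \<omega>2 c j k)" for j k
    by (rule local_11_form.C2[OF local_forms(2)[OF c]])
qed

lemma continuous_on_bd:
  assumes "c \<in> A" "C1_fun f" shows "continuous_on (chart_image c) (bd c f)"
proof (rule continuous_on_boundary_density)
  show "Ck_on 1 (chart_image c) (\<lambda>x. f (param c x))"
    using assms unfolding C1_fun_def by blast
qed (rule Ck_on_2_imp_1, rule local_11_form.C2[OF local_forms(1)[OF assms(1)]] local_11_form.C2[OF local_forms(2)[OF assms(1)]])+

lemma test_fun_supported:
  assumes c: "c \<in> A" and C1: "C1_fun f" "C1_fun g" and supp: "supported_in c f K"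
  shows "test_fun (zero_ext (chart_image c) (\<lambda>x. f (param c x) * bd c g x))"
proof -
  interpret stokes_data "chart_image c" K "\<lambda>x. f (param c x)" "metric_coeff \<omega>1 c" "metric_coeff \<omega>2 c"
    by (rule supported_in_stokes_data[OF c C1(1) supp])
  have "continuous_on (chart_image c) (\<lambda>x. f (param c x))"
    using C1(1) c unfolding C1_fun_def by (blast intro: Ck_on_1_imp_continuous_on)
  then show ?thesis
    using f0 by (intro test_fun_zero_ext continuous_on_mult continuous_on_bd[OF c C1(2)]) auto
qed

text \<open>Both integrands live on the overlap: in chart c the weight \<open>g\<close> vanishes off
  it, in chart d the boundary term of \<open>f\<close> does. The change of variables then carries
  one into the other. It is stated for real functions, hence the real parts.\<close>

lemma cint_bd_change_chart:
  assumes c: "c \<in> A" and d: "d \<in> A" and hf: "C1_fun f" "supported_in c f K" and hg: "C1_fun g" "supported_in d g L"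
  shows "Re (cint (zero_ext (chart_image c) (\<lambda>x. g (param c x) * bd c f x))) =
    Re (cint (zero_ext (chart_image d) (\<lambda>y. g (param d y) * bd d f y)))"
    and "test_fun (zero_ext (chart_image c) (\<lambda>x. g (param c x) * bd c f x))"
proof -
  let ?U = "overlap_image c d" and ?\<phi> = "transition c d"
  let ?Gc = "zero_ext (chart_image c) (\<lambda>x. g (param c x) * bd c f x)"
  let ?Gd = "zero_ext (chart_image d) (\<lambda>y. g (param d y) * bd d f y)"
  interpret stokes_data "chart_image c" K "\<lambda>x. f (param c x)" "metric_coeff \<omega>1 c" "metric_coeff \<omega>2 c"
    by (rule supported_in_stokes_data[OF c hf])
  have "continuous_on (chart_image c) (\<lambda>x. g (param c x))"
    using hg(1) c unfolding C1_fun_def by (blast intro: Ck_on_1_imp_continuous_on)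
  then show Gc: "test_fun ?Gc"
    using boundary_density_outside by (intro test_fun_zero_ext continuous_on_mult continuous_on_bd[OF c hf(1)]) auto
  have Gd: "test_fun ?Gd" by (rule test_fun_supported[OF d hg(1) hf(1) hg(2)])
  have "cint (zero_ext ?U (\<lambda>x. (cmod (det (jacobian ?\<phi> x)))\<^sup>2 * Re (?Gd (?\<phi> x)))) = cint (\<lambda>y. Re (?Gd y))"
  proof (rule cint_change_of_variables[OF open_overlap[OF c d]])
    show "inj_on ?\<phi> ?U"
      by (rule inj_on_inverseI[of _ "transition d c"]) (rule transition_overlap(3)[OF c d])
    show "(?\<phi> has_derivative (*v) (jacobian ?\<phi> x)) (at x)" if "x \<in> ?U" for x
      by (rule holomorphic_map_on_has_derivative[OF holomorphic_transition[OF c d] that])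
    show "test_fun (\<lambda>y. Re (?Gd y))"
      by (rule test_fun_bounded_linear[OF Gd bounded_linear_Re])
    fix y assume y: "y \<notin> ?\<phi> ` ?U"
    show "Re (?Gd y) = 0"
    proof (cases "y \<in> chart_image d")
      case True
      have "y \<notin> overlap_image d c"
      proof
        assume "y \<in> overlap_image d c"
        from transition_overlap[OF d c this] show False using y by (metis image_eqI)
      qed
      then have "param d y \<notin> fst c" using True in_overlap_iff[OF d c] by blast
      moreover have "param c ` K \<subseteq> fst c"
        using hf(2) param_in_chart[OF c] by (auto simp: supported_in_def)
      ultimately have "bd d f y = 0"
        by (intro bd_eq_0[OF c d hf(2) True]) blast
      then show ?thesis by (simp add: zero_ext_def)
    qed (simp add: zero_ext_def)
  qed
  also have "zero_ext ?U (\<lambda>x. (cmod (det (jacobian ?\<phi> x)))\<^sup>2 * Re (?Gd (?\<phi> x))) = (\<lambda>x. Re (?Gc x))"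
  proof
    fix x
    show "zero_ext ?U (\<lambda>x. (cmod (det (jacobian ?\<phi> x)))\<^sup>2 * Re (?Gd (?\<phi> x))) x = Re (?Gc x)"
    proof (cases "x \<in> ?U")
      case True
      have mem: "x \<in> chart_image c" "?\<phi> x \<in> chart_image d"
        using True overlap_subset[OF c d] transition_overlap(1)[OF c d True] overlap_subset[OF d c] by auto
      have "?Gc x = of_real ((cmod (det (jacobian ?\<phi> x)))\<^sup>2) * ?Gd (?\<phi> x)"
        using mem bd_transform[OF c d True hf(1)] transition_overlap(2)[OF c d True]
        by (simp add: zero_ext_def)
      then have "Re (?Gc x) = (cmod (det (jacobian ?\<phi> x)))\<^sup>2 * Re (?Gd (?\<phi> x))"
        by simp
      then show ?thesis using True by (simp only: zero_ext_def[of ?U] if_True)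
    next
      case False
      have "g (param c x) = 0" if x: "x \<in> chart_image c"
      proof (rule ccontr)
        assume "g (param c x) \<noteq> 0"
        moreover have "param c x \<in> topspace X" using x param_in_chart[OF c] chart_subset[OF c] by auto
        ultimately have "param c x \<in> fst d" using hg(2) by (auto simp: supported_in_def)
        then show False using False x in_overlap_iff[OF c d] by blast
      qed
      then show ?thesis using False by (simp add: zero_ext_def)
    qed
  qed
  finally show "Re (cint ?Gc) = Re (cint ?Gd)"
    using cint_bounded_linear[OF Gc bounded_linear_Re] cint_bounded_linear[OF Gd bounded_linear_Re] by simp
qed

lemma ddc_eq_0:
  assumes nonneg: "form_nonneg_22 A (ddc \<omega>1)" and nonpos: "form_nonpos_22 A (ddc \<omega>2)"
  shows "form_zero 4 A (ddc \<omega>1)" "form_zero 4 A (ddc \<omega>2)"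
proof -
  have main: "top_coeff (ddbar_coeff (metric_coeff \<omega>1 c0) x0) k = 0 \<and> top_coeff (ddbar_coeff (metric_coeff \<omega>2 c0) x0) k = 0"
    if c0: "c0 \<in> A" and x0: "x0 \<in> chart_image c0" for c0 x0 k
  proof -
    define p0 where "p0 = param c0 x0"
    obtain F cc \<theta> K where F: "finite F" "p0 \<in> F" "cc p0 = c0" "\<theta> p0 p0 \<noteq> 0" and cc: "\<And>p. p \<in> F \<Longrightarrow> cc p \<in> A"
      and C1: "\<And>p. p \<in> F \<Longrightarrow> C1_fun (\<theta> p)" and supp: "\<And>p. p \<in> F \<Longrightarrow> supported_in (cc p) (\<theta> p) (K p)"
      and \<theta>: "\<And>p q. \<theta> p q \<in> \<real>\<^sub>\<ge>\<^sub>0" "\<And>q. q \<in> topspace X \<Longrightarrow> (\<Sum>p\<in>F. \<theta> p q) = 1"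
      by (rule partition_of_unity[OF c0 param_in_chart[OF c0 x0], folded p0_def]) blast
    have in_X: "param (cc p) x \<in> topspace X" if "p \<in> F" "x \<in> chart_image (cc p)" for p x
      using param_in_chart[OF cc[OF that(1)] that(2)] chart_subset[OF cc[OF that(1)]] by auto
    let ?S = "\<lambda>p. chart_image (cc p)"
    let ?G = "\<lambda>p q. zero_ext (?S p) (\<lambda>x. \<theta> q (param (cc p) x) * bd (cc p) (\<theta> p) x)"
    let ?G' = "\<lambda>p q. zero_ext (?S q) (\<lambda>x. \<theta> q (param (cc q) x) * bd (cc q) (\<theta> p) x)"
    have sd: "stokes_data (?S p) (K p) (\<lambda>x. \<theta> p (param (cc p) x)) (metric_coeff \<omega>1 (cc p)) (metric_coeff \<omega>2 (cc p))"
      if "p \<in> F" for p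
      by (rule supported_in_stokes_data[OF cc[OF that] C1[OF that] supp[OF that]])
    have G: "test_fun (?G p q)" "Re (cint (?G p q)) = Re (cint (?G' p q))" and G': "test_fun (?G' p q)"
      if "p \<in> F" "q \<in> F" for p q
      by (rule cint_bd_change_chart[OF cc[OF that(1)] cc[OF that(2)] C1[OF that(1)] supp[OF that(1)] C1[OF that(2)] supp[OF that(2)]]
          test_fun_supported[OF cc[OF that(2)] C1[OF that(2)] C1[OF that(1)] supp[OF that(2)]])+
    \<comment> \<open>Inserting 1 as the sum of all \<open>\<theta> q\<close> cuts the boundary term
      of \<open>\<theta> p\<close> into pieces, each of which can be moved to the chart of
      q.\<close>
    have split: "zero_ext (?S p) (bd (cc p) (\<theta> p)) = (\<lambda>x. \<Sum>q\<in>F. ?G p q x)" if "p \<in> F" for p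
      using \<theta>(2)[OF in_X[OF that]] by (auto simp: zero_ext_def fun_eq_iff simp flip: sum_distrib_right)
    \<comment> \<open>For fixed q all pieces lie in one chart and carry the same weight, so they add
      up to that weight times the boundary term of the constant 1.\<close>
    have cancel: "(\<Sum>p\<in>F. ?G' p q x) = 0" if q: "q \<in> F" for q x
    proof (cases "x \<in> ?S q")
      case True
      have "(\<Sum>p\<in>F. bd (cc q) (\<theta> p) x) = boundary_density (\<lambda>y. \<Sum>p\<in>F. \<theta> p (param (cc q) y)) (metric_coeff \<omega>1 (cc q)) (metric_coeff \<omega>2 (cc q)) x"
        using C1 cc[OF q] True by (intro boundary_density_sum) (auto simp: C1_fun_def Ck_on_1)
      also have "\<dots> = 0"
      proof -
        have "D10 (\<lambda>y. \<Sum>p\<in>F. \<theta> p (param (cc q) y)) x v = 0" "D01 (\<lambda>y. \<Sum>p\<in>F. \<theta> p (param (cc q) y)) x v = 0" for v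
          using D10_cong_open[of "?S q" x "\<lambda>y. \<Sum>p\<in>F. \<theta> p (param (cc q) y)" "\<lambda>_. 1", OF open_chart_image[OF cc[OF q]] True]
            D01_cong_open[of "?S q" x "\<lambda>y. \<Sum>p\<in>F. \<theta> p (param (cc q) y)" "\<lambda>_. 1", OF open_chart_image[OF cc[OF q]] True]
            \<theta>(2)[OF in_X[OF q]] by (simp_all add: D10_const D01_const)
        then show ?thesis by (simp add: boundary_density_def alt3_linear)
      qed
      finally show ?thesis using True by (simp add: zero_ext_def flip: sum_distrib_left)
    qed (simp add: zero_ext_def)
    have "(\<Sum>p\<in>F. Re (cint (zero_ext (?S p) (bd (cc p) (\<theta> p))))) = (\<Sum>p\<in>F. \<Sum>q\<in>F. Re (cint (?G p q)))"
      using G(1) by (intro sum.cong refl) (simp add: split cint_sum)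
    also have "\<dots> = (\<Sum>p\<in>F. \<Sum>q\<in>F. Re (cint (?G' p q)))"
      by (intro sum.cong refl G(2))
    also have "\<dots> = (\<Sum>q\<in>F. \<Sum>p\<in>F. Re (cint (?G' p q)))" by (rule sum.swap)
    also have "\<dots> = (\<Sum>q\<in>F. Re (cint (\<lambda>x. \<Sum>p\<in>F. ?G' p q x)))"
      using G' by (intro sum.cong refl) (simp add: cint_sum)
    also have "\<dots> = 0"
      using cancel by (simp add: cint_def)
    finally have total: "(\<Sum>p\<in>F. Re (cint (zero_ext (?S p) (bd (cc p) (\<theta> p))))) = 0" .

    let ?N = "\<lambda>p. zero_ext (?S p) (\<lambda>x. \<theta> p (param (cc p) x) * local_defect (cc p) x)"
    \<comment> \<open>The two hypotheses pull in the same direction: the first summand of the defect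
      is nonpositive, and the second, which is subtracted, is nonnegative.\<close>
    have sign: "- local_defect c x \<in> \<real>\<^sub>\<ge>\<^sub>0" if "c \<in> A" "x \<in> chart_image c" for c x
      using nonneg_Reals_add_I[OF nonneg_top_coeff(1)[OF nonneg that] nonpos_top_coeff(1)[OF nonpos that]]
      by (simp add: stokes_defect_def)
    have N: "test_fun (\<lambda>x. - Re (?N p x))" "cint (\<lambda>x. - Re (?N p x)) = Re (cint (zero_ext (?S p) (bd (cc p) (\<theta> p))))"
      "- Re (?N p x) \<ge> 0" if p: "p \<in> F" for p x
    proof -
      note t = stokes_data.test_fun_defect[OF sd[OF p]]
      have bl: "bounded_linear (\<lambda>z. - Re z)" by (rule bounded_linear_minus[OF bounded_linear_Re])
      show "test_fun (\<lambda>x. - Re (?N p x))" by (rule test_fun_bounded_linear[OF t bl])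
      show "cint (\<lambda>x. - Re (?N p x)) = Re (cint (zero_ext (?S p) (bd (cc p) (\<theta> p))))"
        using cint_bounded_linear[OF t bl] stokes_data.stokes[OF sd[OF p]] by simp
      show "- Re (?N p x) \<ge> 0"
      proof (cases "x \<in> ?S p")
        case True
        have "\<theta> p (param (cc p) x) * - local_defect (cc p) x \<in> \<real>\<^sub>\<ge>\<^sub>0"
          by (rule nonneg_Reals_mult_I[OF \<theta>(1) sign[OF cc[OF p] True]])
        then show ?thesis using True by (simp add: zero_ext_def complex_nonneg_Reals_iff)
      qed (simp add: zero_ext_def)
    qed
    have "(\<Sum>p\<in>F. cint (\<lambda>x. - Re (?N p x))) = 0"
      using total N(2) by simp
    \<comment> \<open>Nonnegative integrals with sum 0 are all 0, in particular the one in the chart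
      c0. Its continuous nonnegative integrand then vanishes at x0, where the weight
      \<open>\<theta> p0\<close> is nonzero, so the defect itself has real part 0 there.\<close>
    then have "cint (\<lambda>x. - Re (?N p0 x)) = 0"
      using F(1,2) N(1,3) by (subst (asm) sum_nonneg_eq_0_iff) (auto intro: cint_nonneg)
    then have "- Re (?N p0 x0) = 0"
      by (rule cint_nonneg_eq_0[OF N(1)[OF F(2)] N(3)[OF F(2)]])
    then have "Re (\<theta> p0 p0 * - local_defect c0 x0) = 0"
      using x0 F(3) by (simp add: zero_ext_def p0_def)
    moreover have "Re (\<theta> p0 p0 * - local_defect c0 x0) = Re (\<theta> p0 p0) * Re (- local_defect c0 x0)"
      using \<theta>(1)[of p0 p0] by (simp add: complex_nonneg_Reals_iff)
    moreover have "Re (\<theta> p0 p0) \<noteq> 0"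
      using F(4) \<theta>(1)[of p0 p0] by (auto simp: complex_nonneg_Reals_iff complex_eq_iff)
    ultimately have 0: "Re (- local_defect c0 x0) = 0" by simp
    note R = nonneg_top_coeff(1)[OF nonneg c0 x0] nonpos_top_coeff(1)[OF nonpos c0 x0]
    have "top_coeff (ddbar_coeff (metric_coeff \<omega>1 c0) x0) (\<lambda>j k. metric_coeff \<omega>2 c0 j k x0) = 0"
      "top_coeff (ddbar_coeff (metric_coeff \<omega>2 c0) x0) (\<lambda>j k. metric_coeff \<omega>1 c0 j k x0) = 0"
      using R 0 unfolding complex_nonneg_Reals_iff stokes_defect_def complex_eq_iff by auto
    then show ?thesis
      using nonneg_top_coeff(2)[OF nonneg c0 x0] nonpos_top_coeff(2)[OF nonpos c0 x0] by blast
  qed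
  have zero: "form_zero 4 A (ddc \<omega>)"
    if form: "\<And>c. c \<in> A \<Longrightarrow> local_11_form (chart_image c) (\<omega> c) (metric_coeff \<omega> c)"
      and coeff: "\<And>c x k. c \<in> A \<Longrightarrow> x \<in> chart_image c \<Longrightarrow> top_coeff (ddbar_coeff (metric_coeff \<omega> c) x) k = 0" for \<omega>
    unfolding form_zero_def
  proof (intro ballI allI impI)
    fix c x and vs :: "(complex^3) list" assume cx: "c \<in> A" "x \<in> chart_image c" and "length vs = 4"
    then obtain a b d e where vs: "vs = [a, b, d, e]"
      by (auto simp: numeral_eq_Suc length_Suc_conv)
    show "ddc \<omega> c x vs = 0"
      unfolding ddc_def vs
      using local_11_form.del_delbar_eq_0[OF form[OF cx(1)] cx(2) coeff[OF cx, unfolded top_coeff_def]] by simp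
  qed
  show "form_zero 4 A (ddc \<omega>1)" "form_zero 4 A (ddc \<omega>2)"
    using main local_forms by (auto intro!: zero)
qed

end

section \<open>The four conditions\<close>

lemma form_zero_imp_nonneg_22:
  assumes "form_zero 4 A \<Theta>" shows "form_nonneg_22 A \<Theta>" "form_nonpos_22 A \<Theta>"
proof -
  have "wedge 4 2 (\<Theta> c x) \<rho> std_basis = 0" if "c \<in> A" "x \<in> chart_image c" for c x \<rho>
    using assms that unfolding wedge_4_2_eq_Alt6 form_zero_def by (simp add: Alt6_def)
  then show "form_nonneg_22 A \<Theta>" "form_nonpos_22 A \<Theta>"
    unfolding form_nonpos_22_def form_nonneg_22_def nonneg_22_def wedge_uminus std_basis_def[symmetric] by simp_all
qed

lemma hermitian_metrics_ddc_eq_0: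
  fixes X :: "'a topology" and A :: "('a, 3) chart set"
  assumes "complex_manifold X A" "compact_space X" "hermitian_metric A \<omega>1" "hermitian_metric A \<omega>2"
    and "form_nonneg_22 A (ddc \<omega>1)" "form_nonpos_22 A (ddc \<omega>2)"
  shows "form_zero 4 A (ddc \<omega>1)" "form_zero 4 A (ddc \<omega>2)"
proof -
  interpret compact_hermitian_threefold X A \<omega>1 \<omega>2
    using assms by unfold_locales
  show "form_zero 4 A (ddc \<omega>1)" "form_zero 4 A (ddc \<omega>2)"
    using ddc_eq_0 assms by auto
qed

lemma mutually_exclusive_4:
  "mutually_exclusive [a, b, c, d] \<longleftrightarrow>
    \<not> (a \<and> b) \<and> \<not> (a \<and> c) \<and> \<not> (b \<and> c) \<and> \<not> (a \<and> d) \<and> \<not> (b \<and> d) \<and> \<not> (c \<and> d)"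
proof -
  have "length [a, b, c, d] = Suc (Suc (Suc (Suc 0)))" by simp
  then show ?thesis
    unfolding mutually_exclusive_def by (simp only: All_less_Suc) auto
qed

theorem corollary3p7:
  fixes X :: "'a topology" and A :: "('a, 3) chart set"
  assumes "complex_manifold X A" and "compact_space X"
  shows "mutually_exclusive
    [\<exists>\<omega>. hermitian_metric A \<omega> \<and> form_nonneg_22 A (ddc \<omega>) \<and> \<not> form_zero 4 A (ddc \<omega>),
     \<exists>\<omega>. hermitian_metric A \<omega> \<and> form_zero 4 A (ddc \<omega>),
     \<exists>\<omega>. hermitian_metric A \<omega> \<and> form_nonpos_22 A (ddc \<omega>) \<and> \<not> form_zero 4 A (ddc \<omega>),
     \<not> (\<exists>\<omega>. hermitian_metric A \<omega> \<and> (form_nonneg_22 A (ddc \<omega>) \<or> form_nonpos_22 A (ddc \<omega>)))]"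
    (is "mutually_exclusive [?P1, ?P2, ?P3, ?P4]")
proof -
  note zero = hermitian_metrics_ddc_eq_0[OF assms]
  \<comment> \<open>A zero form is both nonnegative and nonpositive, so a metric from (2) can take
    either role in \<open>hermitian_metrics_ddc_eq_0\<close>.\<close>
  have "\<not> (?P1 \<and> ?P2)" "\<not> (?P1 \<and> ?P3)" "\<not> (?P2 \<and> ?P3)"
    using zero form_zero_imp_nonneg_22 by blast+
  moreover have "\<not> (?P1 \<and> ?P4)" "\<not> (?P2 \<and> ?P4)" "\<not> (?P3 \<and> ?P4)"
    using form_zero_imp_nonneg_22 by blast+
  ultimately show ?thesis unfolding mutually_exclusive_4 by blast
qed

end
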